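(* For each rational value of $\alpha$ with $0\le\alpha\le 1$, the Destructive Shift Bribery problem for the Copeland$^\alpha$ rule, parameterized by the number of voters, is $\mathrm{W}[1]$-hard, even for the case of unit prices.
   Context: **Elections.** An election is a pair $E=(C,V)$, where $C=\{c_1,\dots,c_m\}$ is a finite set of candidates and $V=\{v_1,\dots,v_n\}$ is a finite multiset of voters; each voter $v$ has a strict ranking (preference order) of all candidates from best to worst, and $\mathrm{pos}_v(c)\in\{1,\dots,m\}$ is the position of $c$ in $v$'s ranking (1 = best). $N_E(c,c')$ is the number of voters who prefer $c$ to $c'$. An election rule $\mathcal{R}$ maps each election $E$ to a set $\mathcal{R}(E)\subseteq C$ of (tied) winners; $c$ is the unique winner if $\mathcal{R}(E)=\{c\}$. **Destructive Shift Bribery for $\mathcal{R}$.** Input: an election $E=(C,V)$ with $m$ candidates and $n$ voters, a despised candidate $d\in C$, a budget $B$ (a nonnegative integer), and for each voter $v_i$ a price function $\rho_i$. Shifting $d$ back by $t$ positions in a vote moves $d$ $t$ places towards the end of the ranking, each passed candidate moving up by one place and all else unchanged. A price function for a voter $v$ with $j=\mathrm{pos}_v(d)$ is $\rho:\mathbb{N}\to\mathbb{N}\cup\{+\infty\}$ with $\rho(0)=0$, $\rho(i)\le\rho(i')$ for $i<i'\le m-j$, and $\rho(i)=+\infty$ for $i>m-j$; $\rho(i)$ is the cost of shifting $d$ back by $i$ positions in $v$'s ranking. Question: are there nonnegative integers $t_1,\dots,t_n$ with $\sum_i\rho_i(t_i)\le B$ such that, after shifting $d$ back by $t_i$ positions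 in the ranking of each $v_i$, $d$ is not the unique $\mathcal{R}$-winner? **Unit prices.** For every voter $v$, $\rho(i)=i$ for all $i\le m-\mathrm{pos}_v(d)$. **Copeland$^\alpha$.** The Copeland$^\alpha$ score of $c$ is $|\{c'\in C\setminus\{c\}: N_E(c,c')>N_E(c',c)\}|+\alpha\,|\{c'\in C\setminus\{c\}: N_E(c,c')=N_E(c',c)\}|$; the candidates with the highest score are the winners. Here $\alpha$ is fixed (not part of the input). **W[1]-hardness.** A parameterized problem is $\mathrm{W}[1]$-hard if the Clique problem (given a graph and an integer $k$, is there a set of $k$ pairwise adjacent vertices?), parameterized by $k$, reduces to it by a parameterized reduction, i.e., a many-one reduction computable in time $f(k)\cdot |I|^{O(1)}$ for a computable $f$, whose output instances have parameter bounded by a computable function of $k$. *)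

theory Defs
  imports Complex_Main "HOL-Library.Extended_Nat"
begin

section \<open>Elections\<close>

text \<open>A ranking is a list, best candidate first. The multiset of voters is given as the list
  of the rankings of \<open>v\<^sub>1, \<dots>, v\<^sub>n\<close>, so that price functions and shifts can refer to a voter
  by index.\<close>

type_synonym 'c ranking = "'c list"
type_synonym 'c election = "'c set \<times> 'c ranking list"
type_synonym 'c election_rule = "'c election \<Rightarrow> 'c set"

definition is_election :: "'c election \<Rightarrow> bool" where
  "is_election E \<longleftrightarrow> (case E of (C, V) \<Rightarrow>
     finite C \<and> (\<forall>v\<in>set V. distinct v \<and> set v = C))"

definition pos :: "'c ranking \<Rightarrow> 'c \<Rightarrow> nat" where
  "pos v c = (THE i. i < length v \<and> v ! i = c) + 1"

definition num_prefer :: "'c election \<Rightarrow> 'c \<Rightarrow> 'c \<Rightarrow> nat" where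
  "num_prefer E c c' = (case E of (C, V) \<Rightarrow>
     card {i. i < length V \<and> pos (V ! i) c < pos (V ! i) c'})"

definition copeland_score :: "rat \<Rightarrow> 'c election \<Rightarrow> 'c \<Rightarrow> rat" where
  "copeland_score \<alpha> E c =
     of_nat (card {c' \<in> fst E - {c}. num_prefer E c c' > num_prefer E c' c}) +
     \<alpha> * of_nat (card {c' \<in> fst E - {c}. num_prefer E c c' = num_prefer E c' c})"

definition copeland :: "rat \<Rightarrow> 'c election_rule" where
  "copeland \<alpha> E = {c \<in> fst E. \<forall>c'\<in>fst E. copeland_score \<alpha> E c' \<le> copeland_score \<alpha> E c}"


section \<open>Destructive Shift Bribery\<close>

text \<open>Only meaningful for \<open>t \<le> length v - pos v d\<close>; larger shifts have infinite price.\<close>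

definition shift_back :: "'c \<Rightarrow> nat \<Rightarrow> 'c ranking \<Rightarrow> 'c ranking" where
  "shift_back d t v =
     (let j = pos v d in take (j - 1) v @ take t (drop j v) @ [d] @ drop (j + t) v)"

text \<open>Here \<open>m\<close> is the number of candidates and \<open>j\<close> the position of the despised candidate
  in the vote.\<close>

definition price_function :: "nat \<Rightarrow> nat \<Rightarrow> (nat \<Rightarrow> enat) \<Rightarrow> bool" where
  "price_function m j \<rho> \<longleftrightarrow> \<rho> 0 = 0 \<and>
     (\<forall>i i'. i < i' \<and> i' \<le> m - j \<longrightarrow> \<rho> i \<le> \<rho> i') \<and>
     (\<forall>i. i > m - j \<longrightarrow> \<rho> i = \<infinity>)"

text \<open>Candidates are named by natural numbers so that instances can be written down.\<close>

record dsb_instance =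
  cands :: "nat set"
  votes :: "nat ranking list"
  despised :: nat
  budget :: nat
  prices :: "(nat \<Rightarrow> enat) list"

definition dsb_instances :: "dsb_instance set" where
  "dsb_instances = {I. is_election (cands I, votes I) \<and> despised I \<in> cands I \<and>
     length (prices I) = length (votes I) \<and>
     (\<forall>i < length (votes I).
        price_function (card (cands I)) (pos (votes I ! i) (despised I)) (prices I ! i))}"

definition dsb_yes :: "nat election_rule \<Rightarrow> dsb_instance set" where
  "dsb_yes R = {I. \<exists>t :: nat \<Rightarrow> nat.
     (\<Sum>i < length (votes I). (prices I ! i) (t i)) \<le> enat (budget I) \<and>
     R (cands I, map (\<lambda>i. shift_back (despised I) (t i) (votes I ! i)) [0..<length (votes I)])
       \<noteq> {despised I}}"

definition unit_prices :: "dsb_instance set" where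
  "unit_prices = {I. \<forall>i < length (votes I).
     \<forall>s \<le> card (cands I) - pos (votes I ! i) (despised I). (prices I ! i) s = enat s}"


section \<open>Model of computation\<close>

text \<open>Jones's WHILE language over binary trees, started with the input in variable 0 and
  returning variable 0. Every evaluation of a subexpression is charged the size of
  its value. Tapes of a Turing machine are lists here and a machine step is a constant
  number of assignments; conversely every command is simulated by a Turing machine in time
  polynomial in its cost, and no program can produce data larger than input size plus cost.
  So running times agree with those of Turing machines up to a polynomial.\<close>

datatype tree = Leaf | Node tree tree

fun tree_size :: "tree \<Rightarrow> nat" where
  "tree_size Leaf = 1"
| "tree_size (Node l r) = 1 + tree_size l + tree_size r"

datatype expr = Var nat | LeafE | NodeE expr expr | Hd expr | Tl expr | EqE expr expr

datatype com = Assign nat expr | Seq com com | If expr com com | While expr com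

type_synonym state = "nat \<Rightarrow> tree"

fun hd_tree :: "tree \<Rightarrow> tree" where
  "hd_tree Leaf = Leaf"
| "hd_tree (Node l r) = l"

fun tl_tree :: "tree \<Rightarrow> tree" where
  "tl_tree Leaf = Leaf"
| "tl_tree (Node l r) = r"

fun eval_expr :: "expr \<Rightarrow> state \<Rightarrow> tree" where
  "eval_expr (Var x) s = s x"
| "eval_expr LeafE s = Leaf"
| "eval_expr (NodeE a b) s = Node (eval_expr a s) (eval_expr b s)"
| "eval_expr (Hd a) s = hd_tree (eval_expr a s)"
| "eval_expr (Tl a) s = tl_tree (eval_expr a s)"
| "eval_expr (EqE a b) s = (if eval_expr a s = eval_expr b s then Node Leaf Leaf else Leaf)"

fun cost :: "expr \<Rightarrow> state \<Rightarrow> nat" where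
  "cost (Var x) s = tree_size (s x)"
| "cost LeafE s = 1"
| "cost (NodeE a b) s = cost a s + cost b s + tree_size (eval_expr (NodeE a b) s)"
| "cost (Hd a) s = cost a s + tree_size (eval_expr (Hd a) s)"
| "cost (Tl a) s = cost a s + tree_size (eval_expr (Tl a) s)"
| "cost (EqE a b) s = cost a s + cost b s + tree_size (eval_expr (EqE a b) s)"

text \<open>\<open>exec c s t s'\<close>: started in \<open>s\<close>, command \<open>c\<close> terminates in \<open>s'\<close> after time \<open>t\<close>.
  In tests, \<^const>\<open>Leaf\<close> counts as false and everything else as true.\<close>

inductive exec :: "com \<Rightarrow> state \<Rightarrow> nat \<Rightarrow> state \<Rightarrow> bool" where
  Assign: "exec (Assign x a) s (1 + cost a s) (s(x := eval_expr a s))"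
| Seq: "exec c1 s t1 s' \<Longrightarrow> exec c2 s' t2 s'' \<Longrightarrow> exec (Seq c1 c2) s (t1 + t2) s''"
| IfTrue: "eval_expr a s \<noteq> Leaf \<Longrightarrow> exec c1 s t s' \<Longrightarrow>
    exec (If a c1 c2) s (1 + cost a s + t) s'"
| IfFalse: "eval_expr a s = Leaf \<Longrightarrow> exec c2 s t s' \<Longrightarrow>
    exec (If a c1 c2) s (1 + cost a s + t) s'"
| WhileFalse: "eval_expr a s = Leaf \<Longrightarrow> exec (While a c) s (1 + cost a s) s"
| WhileTrue: "eval_expr a s \<noteq> Leaf \<Longrightarrow> exec c s t1 s' \<Longrightarrow> exec (While a c) s' t2 s'' \<Longrightarrow>
    exec (While a c) s (1 + cost a s + t1 + t2) s''"

definition computes :: "com \<Rightarrow> tree \<Rightarrow> tree \<Rightarrow> nat \<Rightarrow> bool" where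
  "computes c x y t \<longleftrightarrow> (\<exists>s'. exec c ((\<lambda>_. Leaf)(0 := x)) t s' \<and> s' 0 = y)"


section \<open>Encodings\<close>

text \<open>Numbers are written in binary, least significant bit first.\<close>

definition enc_bool :: "bool \<Rightarrow> tree" where
  "enc_bool b = (if b then Node Leaf Leaf else Leaf)"

fun enc_nat :: "nat \<Rightarrow> tree" where
  "enc_nat n = (if n = 0 then Leaf else Node (enc_bool (odd n)) (enc_nat (n div 2)))"

declare enc_nat.simps [simp del]

definition enc_enat :: "enat \<Rightarrow> tree" where
  "enc_enat x = (case x of enat n \<Rightarrow> Node Leaf (enc_nat n) | \<infinity> \<Rightarrow> Leaf)"

definition enc_list :: "('a \<Rightarrow> tree) \<Rightarrow> 'a list \<Rightarrow> tree" where
  "enc_list enc xs = foldr (\<lambda>x. Node (enc x)) xs Leaf"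

text \<open>A price function is determined by its values on \<open>{0..m - j}\<close> and is written as a table of these.\<close>

definition enc_dsb :: "dsb_instance \<Rightarrow> tree" where
  "enc_dsb I =
     Node (enc_list enc_nat (sorted_list_of_set (cands I)))
    (Node (enc_list (enc_list enc_nat) (votes I))
    (Node (enc_nat (despised I))
    (Node (enc_nat (budget I))
          (enc_list (\<lambda>i. enc_list (\<lambda>s. enc_enat ((prices I ! i) s))
                       [0..<card (cands I) - pos (votes I ! i) (despised I) + 1])
             [0..<length (votes I)]))))"


section \<open>Parameterized problems and reductions\<close>

record 'i param_problem =
  instances :: "'i set"
  yes :: "'i set"
  param :: "'i \<Rightarrow> nat"
  enc :: "'i \<Rightarrow> tree"

definition computable :: "(nat \<Rightarrow> nat) \<Rightarrow> bool" where
  "computable f \<longleftrightarrow> (\<exists>c. \<forall>n. \<exists>t. computes c (enc_nat n) (enc_nat (f n)) t)"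

definition param_reduction ::
  "'i param_problem \<Rightarrow> 'j param_problem \<Rightarrow> ('i \<Rightarrow> 'j) \<Rightarrow> bool" where
  "param_reduction P Q r \<longleftrightarrow>
     (\<forall>x\<in>instances P. r x \<in> instances Q \<and> (x \<in> yes P \<longleftrightarrow> r x \<in> yes Q)) \<and>
     (\<exists>f c e. computable f \<and> (\<forall>x\<in>instances P. \<exists>t.
        computes c (enc P x) (enc Q (r x)) t \<and> t \<le> f (param P x) * tree_size (enc P x) ^ e)) \<and>
     (\<exists>g. computable g \<and> (\<forall>x\<in>instances P. param Q (r x) \<le> g (param P x)))"

text \<open>A clique instance \<open>(n, E, k)\<close> is the simple graph with vertices \<open>{..<n}\<close> and edge set
  \<open>E\<close>, given by its adjacency matrix, together with \<open>k\<close>.\<close>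

type_synonym clique_instance = "nat \<times> nat set set \<times> nat"

definition clique_problem :: "clique_instance param_problem" where
  "clique_problem =
     \<lparr>instances = {(n, E, k). \<forall>e\<in>E. e \<subseteq> {..<n} \<and> card e = 2},
      yes = {(n, E, k). \<exists>S \<subseteq> {..<n}. card S = k \<and> (\<forall>u\<in>S. \<forall>v\<in>S. u \<noteq> v \<longrightarrow> {u, v} \<in> E)},
      param = (\<lambda>(n, E, k). k),
      enc = (\<lambda>(n, E, k).
        Node (enc_list (\<lambda>i. enc_list (\<lambda>j. enc_bool ({i, j} \<in> E)) [0..<n]) [0..<n]) (enc_nat k))\<rparr>"

definition W1_hard :: "'i param_problem \<Rightarrow> bool" where
  "W1_hard Q \<longleftrightarrow> (\<exists>r. param_reduction clique_problem Q r)"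

definition restrict_problem :: "'i param_problem \<Rightarrow> 'i set \<Rightarrow> 'i param_problem" where
  "restrict_problem P A = P\<lparr>instances := instances P \<inter> A\<rparr>"

definition destructive_shift_bribery :: "nat election_rule \<Rightarrow> dsb_instance param_problem" where
  "destructive_shift_bribery R =
     \<lparr>instances = dsb_instances, yes = dsb_yes R,
      param = (\<lambda>I. length (votes I)), enc = enc_dsb\<rparr>"

end

theory Submission
  imports Defs
begin

text \<open>
  Idea. Let \<open>c = min k (n + 1)\<close>. For every colour \<open>i < c\<close> there is a list \<open>seq i\<close> of challengers:
  one block per vertex \<open>u\<close>, each followed by a separator \<open>Sep i u\<close>. One voter ranks \<open>d\<close> immediately
  before \<open>seq i\<close>, another one immediately before its reverse, so a shift in these two votes passes a
  prefix and a suffix of \<open>seq i\<close>. All separators have to be passed, and the budget is just large enough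
  if for every colour exactly one block, that of the chosen vertex, remains unpassed. For every
  non-adjacent (or equal) pair of vertices \<open>u\<close>, \<open>v\<close> and colours \<open>i \<noteq> j\<close> the candidate \<open>Con i u j v\<close>
  lies in block \<open>u\<close> of colour \<open>i\<close> and in block \<open>v\<close> of colour \<open>j\<close>. All of these are passed iff the chosen
  vertices form a clique of size \<open>c\<close>.

  The election makes this count. Initially \<open>d\<close> beats the relevant challengers by a single vote, loses to
  the irrelevant ones, and beats three equally long lists \<open>P\<close>, \<open>Q\<close>, \<open>S\<close> of guards, which beat each
  other cyclically and beat all challengers. One of the three lists always shields \<open>d\<close> from
  everything that is not to be passed. With \<open>w\<close> guards in each list and \<open>w + 1\<close> challengers the best
  score of the others is \<open>3 w\<close>, which is the score of \<open>d\<close> exactly if it loses to every challenger. The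
  number of voters is odd, so there are no ties and \<open>\<alpha>\<close> does not matter.

  The running time is bounded by a calculus of polynomial-time functions that is closed under
  composition and polynomially bounded folds, so that the reduction can be written with list functions.
\<close>

section \<open>A calculus of polynomial-time functions\<close>

text \<open>The number of voters may depend on the clique size only, so the n vertices have to be
  encoded in the lengths of shifts. One shift passes just a prefix; two opposite votes pass a prefix
  and a suffix and can leave a gap in between. If all blocks of a colour have length L, passing all
  its separators costs at least (n - 1) * (L + 1) + 1, because a gap without separators lies within
  one block. The budget is the sum of these bounds, so no colour can save anything for another one
  and every gap is a whole block. This needs blocks whose length does not depend on the adjacency;
  therefore they also contain the candidates of adjacent pairs, which beat \<open>d\<close> from the
  start.

  Shifts change only comparisons with \<open>d\<close>. A guard never profits: in a majority of the
  votes a full list of other guards stands between \<open>d\<close> and this guard, and such a list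
  is at least as long as the budget. So \<open>d\<close> keeps its 3 w victories over the guards,
  and what is left to decide is whether it beats some challenger.\<close>

lemma tree_size_pos [simp]: "0 < tree_size t" "tree_size t \<noteq> 0"
  by (cases t; simp)+

lemma tree_size_ge_1: "1 \<le> tree_size t" "Suc 0 \<le> tree_size t"
  by (cases t; simp)+

text \<open>Encodings have size at least 1, so bounds by monomials are closed under sums, and a
  single monomial serves as normal form of a polynomial bound.\<close>

definition poly_bounded :: "('a \<Rightarrow> tree) \<Rightarrow> ('a \<Rightarrow> nat) \<Rightarrow> bool" where
  "poly_bounded e g \<longleftrightarrow> (\<exists>C k. \<forall>x. g x \<le> C * tree_size (e x) ^ k)"

lemma poly_bounded_mono:
  "poly_bounded e g \<Longrightarrow> (\<And>x. h x \<le> g x) \<Longrightarrow> poly_bounded e h"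
  unfolding poly_bounded_def by (meson le_trans)

lemma poly_bounded_const: "poly_bounded e (\<lambda>_. c)"
  unfolding poly_bounded_def by (rule exI[of _ c], rule exI[of _ 0]) simp

lemma poly_bounded_size: "poly_bounded e (\<lambda>x. tree_size (e x))"
  unfolding poly_bounded_def by (rule exI[of _ 1], rule exI[of _ 1]) simp

lemma poly_bounded_add:
  assumes "poly_bounded e g" "poly_bounded e h"
  shows "poly_bounded e (\<lambda>x. g x + h x)"
proof -
  obtain C k where 1: "\<And>x. g x \<le> C * tree_size (e x) ^ k"
    using assms(1) unfolding poly_bounded_def by blast
  obtain D l where 2: "\<And>x. h x \<le> D * tree_size (e x) ^ l"
    using assms(2) unfolding poly_bounded_def by blast
  have "g x + h x \<le> (C + D) * tree_size (e x) ^ (k + l)" for x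
  proof -
    have "g x \<le> C * tree_size (e x) ^ (k + l)"
      by (rule le_trans[OF 1]) (simp add: power_increasing tree_size_ge_1)
    moreover have "h x \<le> D * tree_size (e x) ^ (k + l)"
      by (rule le_trans[OF 2]) (simp add: power_increasing tree_size_ge_1)
    ultimately show ?thesis by (simp add: algebra_simps)
  qed
  then show ?thesis unfolding poly_bounded_def by blast
qed

lemma poly_bounded_mult:
  assumes "poly_bounded e g" "poly_bounded e h"
  shows "poly_bounded e (\<lambda>x. g x * h x)"
proof -
  obtain C k where 1: "\<And>x. g x \<le> C * tree_size (e x) ^ k"
    using assms(1) unfolding poly_bounded_def by blast
  obtain D l where 2: "\<And>x. h x \<le> D * tree_size (e x) ^ l"
    using assms(2) unfolding poly_bounded_def by blast
  have "g x * h x \<le> (C * D) * tree_size (e x) ^ (k + l)" for x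
    using mult_le_mono[OF 1 2, of x x] by (simp add: power_add algebra_simps)
  then show ?thesis unfolding poly_bounded_def by blast
qed

lemma poly_bounded_power: "poly_bounded e g \<Longrightarrow> poly_bounded e (\<lambda>x. g x ^ k)"
  by (induction k) (simp_all add: poly_bounded_const poly_bounded_mult)

lemmas poly_bounded_intros = poly_bounded_const poly_bounded_size poly_bounded_add
  poly_bounded_mult poly_bounded_power

text \<open>Substitution requires a bound on the size of the intermediate value; this is why
  \<open>poly_time\<close> records a bound on the size of the result besides the running
  time.\<close>

lemma poly_bounded_compose:
  assumes "poly_bounded e1 g" "poly_bounded e (\<lambda>x. tree_size (e1 (f x)))"
  shows "poly_bounded e (\<lambda>x. g (f x))"
proof -
  obtain C k where 1: "\<And>x. g x \<le> C * tree_size (e1 x) ^ k"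
    using assms(1) unfolding poly_bounded_def by blast
  have "poly_bounded e (\<lambda>x. C * tree_size (e1 (f x)) ^ k)"
    by (intro poly_bounded_intros assms(2))
  then show ?thesis by (rule poly_bounded_mono) (rule 1)
qed

section \<open>Programs relative to a base register\<close>

definition runs :: "com \<Rightarrow> nat \<Rightarrow> state \<Rightarrow> tree \<Rightarrow> nat \<Rightarrow> bool" where
  "runs c b s y T \<longleftrightarrow> (\<exists>t s'. exec c s t s' \<and> s' b = y \<and> (\<forall>z<b. s' z = s z) \<and> t \<le> T)"

text \<open>A program is given for every base register \<open>b\<close>: it replaces the argument in \<open>b\<close> by the
  result, keeps the registers below \<open>b\<close> and may find arbitrary values above \<open>b\<close>. This makes
  programs composable without renaming of variables.\<close>

definition poly_time :: "('a \<Rightarrow> tree) \<Rightarrow> ('b \<Rightarrow> tree) \<Rightarrow> ('a \<Rightarrow> 'b) \<Rightarrow> bool" where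
  "poly_time e e' f \<longleftrightarrow> poly_bounded e (\<lambda>x. tree_size (e' (f x))) \<and>
     (\<exists>T. poly_bounded e T \<and> (\<forall>b. \<exists>c. \<forall>s x. s b = e x \<longrightarrow> runs c b s (e' (f x)) (T x)))"

lemma poly_timeI:
  assumes "poly_bounded e (\<lambda>x. tree_size (e' (f x)))" "poly_bounded e T"
    "\<And>b. \<exists>c. \<forall>s x. s b = e x \<longrightarrow> runs c b s (e' (f x)) (T x)"
  shows "poly_time e e' f"
  using assms unfolding poly_time_def by blast

lemma poly_time_size: "poly_time e e' f \<Longrightarrow> poly_bounded e (\<lambda>x. tree_size (e' (f x)))"
  unfolding poly_time_def by blast

lemma poly_timeE:
  assumes "poly_time e e' f"
  obtains T c where "poly_bounded e T"
    "\<And>b s x. s b = e x \<Longrightarrow> runs (c b) b s (e' (f x)) (T x)"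
proof -
  from assms obtain T where T: "poly_bounded e T"
    "\<forall>b. \<exists>c. \<forall>s x. s b = e x \<longrightarrow> runs c b s (e' (f x)) (T x)"
    unfolding poly_time_def by blast
  from T(2) obtain c where "\<forall>b. \<forall>s x. s b = e x \<longrightarrow> runs (c b) b s (e' (f x)) (T x)"
    by metis
  with T(1) that show thesis by blast
qed

lemma poly_time_expr:
  assumes "\<And>s b x. s b = e x \<Longrightarrow> eval_expr (a b) s = e' (f x) \<and> cost (a b) s \<le> T x"
    and "poly_bounded e T" "poly_bounded e (\<lambda>x. tree_size (e' (f x)))"
  shows "poly_time e e' f"
proof (rule poly_timeI)
  show "poly_bounded e (\<lambda>x. 1 + T x)" by (intro poly_bounded_intros assms(2))
  fix b
  show "\<exists>c. \<forall>s x. s b = e x \<longrightarrow> runs c b s (e' (f x)) (1 + T x)"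
  proof (intro exI allI impI)
    fix s x assume s: "s b = e x"
    have "exec (Assign b (a b)) s (1 + cost (a b) s) (s(b := eval_expr (a b) s))"
      by (rule exec.Assign)
    with assms(1)[of s b x] s show "runs (Assign b (a b)) b s (e' (f x)) (1 + T x)"
      unfolding runs_def by fastforce
  qed
qed (rule assms)

fun const_expr :: "tree \<Rightarrow> expr" where
  "const_expr Leaf = LeafE"
| "const_expr (Node l r) = NodeE (const_expr l) (const_expr r)"

lemma eval_const_expr [simp]: "eval_expr (const_expr t) s = t"
  by (induction t) auto

lemma cost_const_expr: "cost (const_expr t) s = cost (const_expr t) (\<lambda>_. Leaf)"
  by (induction t) auto

lemma poly_time_const: "poly_time e e' (\<lambda>_. c)"
  by (rule poly_time_expr[where a = "\<lambda>_. const_expr (e' c)"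
        and T = "\<lambda>_. cost (const_expr (e' c)) (\<lambda>_. Leaf)"])
     (auto intro: eq_imp_le cost_const_expr poly_bounded_const)

lemma poly_time_id: "poly_time e e (\<lambda>x. x)"
  by (rule poly_time_expr[where a = Var and T = "\<lambda>x. tree_size (e x)"]) (auto intro: poly_bounded_size)

lemma runs_seq:
  assumes "runs c1 b s y T1" "\<And>s'. s' b = y \<Longrightarrow> \<forall>z<b. s' z = s z \<Longrightarrow> runs c2 b s' y' T2"
  shows "runs (Seq c1 c2) b s y' (T1 + T2)"
proof -
  from assms(1) obtain t1 s1 where 1: "exec c1 s t1 s1" "s1 b = y" "\<forall>z<b. s1 z = s z" "t1 \<le> T1"
    unfolding runs_def by blast
  from assms(2)[OF 1(2,3)] obtain t2 s2 where
    2: "exec c2 s1 t2 s2" "s2 b = y'" "\<forall>z<b. s2 z = s1 z" "t2 \<le> T2"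
    unfolding runs_def by blast
  show ?thesis unfolding runs_def
    using exec.Seq[OF 1(1) 2(1)] 1 2 by (metis add_mono)
qed

lemma poly_time_compose:
  assumes "poly_time e2 e3 f" "poly_time e1 e2 g"
  shows "poly_time e1 e3 (\<lambda>x. f (g x))"
proof -
  obtain T1 c1 where 1: "poly_bounded e1 T1"
    "\<And>b s x. s b = e1 x \<Longrightarrow> runs (c1 b) b s (e2 (g x)) (T1 x)"
    by (rule poly_timeE[OF assms(2)]) blast
  obtain T2 c2 where 2: "poly_bounded e2 T2"
    "\<And>b s x. s b = e2 x \<Longrightarrow> runs (c2 b) b s (e3 (f x)) (T2 x)"
    by (rule poly_timeE[OF assms(1)]) blast
  note size = poly_time_size[OF assms(2)]
  show ?thesis
  proof (rule poly_timeI)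
    show "poly_bounded e1 (\<lambda>x. tree_size (e3 (f (g x))))"
      by (rule poly_bounded_compose[OF poly_time_size[OF assms(1)] size])
    show "poly_bounded e1 (\<lambda>x. T1 x + T2 (g x))"
      by (intro poly_bounded_add 1(1) poly_bounded_compose[OF 2(1) size])
    show "\<exists>c. \<forall>s x. s b = e1 x \<longrightarrow> runs c b s (e3 (f (g x))) (T1 x + T2 (g x))" for b
      by (rule exI[of _ "Seq (c1 b) (c2 b)"]) (blast intro: runs_seq 1 2)
  qed
qed

definition enc_pair :: "('a \<Rightarrow> tree) \<Rightarrow> ('b \<Rightarrow> tree) \<Rightarrow> 'a \<times> 'b \<Rightarrow> tree" (infixr "\<otimes>" 75) where
  "enc_pair e1 e2 p = Node (e1 (fst p)) (e2 (snd p))"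

lemma enc_pair_simp [simp]: "enc_pair e1 e2 (x, y) = Node (e1 x) (e2 y)"
  by (simp add: enc_pair_def)

text \<open>\<open>poly_time\<close> sees a function only through the codes of its values. So
  \<open>#\<close> is computed by pairing, a finite \<open>enat\<close> is a pair with
  \<open>Leaf\<close>, and a number can be reread as the list of its bits.\<close>

lemma poly_time_retype:
  "poly_time e e1 f \<Longrightarrow> (\<And>x. e1 (f x) = e2 (g x)) \<Longrightarrow> poly_time e e2 g"
  unfolding poly_time_def by simp

lemma poly_time_fst:
  assumes "poly_time e (e1 \<otimes> e2) f"
  shows "poly_time e e1 (\<lambda>x. fst (f x))"
proof (rule poly_time_compose[OF _ assms])
  show "poly_time (e1 \<otimes> e2) e1 fst"
  proof (rule poly_time_expr[where a = "\<lambda>b. Hd (Var b)" and T = "\<lambda>x. 2 * tree_size ((e1 \<otimes> e2) x)"])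
    show "poly_bounded (e1 \<otimes> e2) (\<lambda>x. 2 * tree_size ((e1 \<otimes> e2) x))"
      by (intro poly_bounded_intros)
    show "poly_bounded (e1 \<otimes> e2) (\<lambda>x. tree_size (e1 (fst x)))"
      by (rule poly_bounded_mono[OF poly_bounded_size]) (simp add: enc_pair_def)
  qed (simp add: enc_pair_def)
qed

lemma poly_time_snd:
  assumes "poly_time e (e1 \<otimes> e2) f"
  shows "poly_time e e2 (\<lambda>x. snd (f x))"
proof (rule poly_time_compose[OF _ assms])
  show "poly_time (e1 \<otimes> e2) e2 snd"
  proof (rule poly_time_expr[where a = "\<lambda>b. Tl (Var b)" and T = "\<lambda>x. 2 * tree_size ((e1 \<otimes> e2) x)"])
    show "poly_bounded (e1 \<otimes> e2) (\<lambda>x. 2 * tree_size ((e1 \<otimes> e2) x))"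
      by (intro poly_bounded_intros)
    show "poly_bounded (e1 \<otimes> e2) (\<lambda>x. tree_size (e2 (snd x)))"
      by (rule poly_bounded_mono[OF poly_bounded_size]) (simp add: enc_pair_def)
  qed (simp add: enc_pair_def)
qed

lemma poly_time_pair:
  assumes "poly_time e e1 f" "poly_time e e2 g"
  shows "poly_time e (e1 \<otimes> e2) (\<lambda>x. (f x, g x))"
proof -
  obtain T1 c1 where 1: "poly_bounded e T1"
    "\<And>b s x. s b = e x \<Longrightarrow> runs (c1 b) b s (e1 (f x)) (T1 x)"
    by (rule poly_timeE[OF assms(1)]) blast
  obtain T2 c2 where 2: "poly_bounded e T2"
    "\<And>b s x. s b = e x \<Longrightarrow> runs (c2 b) b s (e2 (g x)) (T2 x)"
    by (rule poly_timeE[OF assms(2)]) blast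
  note size = poly_time_size[OF assms(1)] poly_time_size[OF assms(2)]
  define T where "T = (\<lambda>x. (1 + tree_size (e x)) + T1 x + (1 + tree_size (e x)) + T2 x +
     (1 + (tree_size (e1 (f x)) + tree_size (e2 (g x)) + (1 + tree_size (e1 (f x)) + tree_size (e2 (g x))))))"
  show ?thesis
  proof (rule poly_timeI)
    show "poly_bounded e (\<lambda>x. tree_size ((e1 \<otimes> e2) (f x, g x)))"
      unfolding enc_pair_simp tree_size.simps by (intro poly_bounded_intros size)
    show "poly_bounded e T" unfolding T_def
      by (intro poly_bounded_intros 1(1) 2(1) size)
    fix b
    \<comment> \<open>The first result waits in \<open>Suc b\<close>, which the second program, run
      from base \<open>b + 2\<close>, has to preserve. The argument stays in \<open>b\<close> until
      the last assignment.\<close>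
    let ?c = "Seq (Seq (Seq (Seq (Assign (Suc b) (Var b)) (c1 (Suc b)))
       (Assign (b + 2) (Var b))) (c2 (b + 2))) (Assign b (NodeE (Var (Suc b)) (Var (b + 2))))"
    show "\<exists>c. \<forall>s x. s b = e x \<longrightarrow> runs c b s ((e1 \<otimes> e2) (f x, g x)) (T x)"
    proof (rule exI[of _ ?c], intro allI impI)
      fix s x assume s: "s b = e x"
      have x1: "exec (Assign (Suc b) (Var b)) s (1 + tree_size (e x)) (s(Suc b := e x))"
        using exec.Assign[of "Suc b" "Var b" s] s by simp
      from 1(2)[of "s(Suc b := e x)" "Suc b" x] obtain t1 s1 where
        y1: "exec (c1 (Suc b)) (s(Suc b := e x)) t1 s1" "s1 (Suc b) = e1 (f x)"
           "\<forall>z<Suc b. s1 z = s z" "t1 \<le> T1 x"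
        unfolding runs_def by auto
      have x2: "exec (Assign (b+2) (Var b)) s1 (1 + tree_size (e x)) (s1(b + 2 := e x))"
        using exec.Assign[of "b+2" "Var b" s1] s y1(3) by simp
      from 2(2)[of "s1(b+2 := e x)" "b+2" x] obtain t2 s2 where
        y2: "exec (c2 (b+2)) (s1(b+2 := e x)) t2 s2" "s2 (b+2) = e2 (g x)"
           "\<forall>z<b+2. s2 z = s1 z" "t2 \<le> T2 x"
        unfolding runs_def by auto
      have x3: "exec (Assign b (NodeE (Var (Suc b)) (Var (b + 2)))) s2
          (1 + (tree_size (e1 (f x)) + tree_size (e2 (g x)) + (1 + tree_size (e1 (f x)) + tree_size (e2 (g x)))))
          (s2(b := Node (e1 (f x)) (e2 (g x))))"
        using exec.Assign[of b "NodeE (Var (Suc b)) (Var (b + 2))" s2] y2 y1(2) by simp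
      show "runs ?c b s ((e1 \<otimes> e2) (f x, g x)) (T x)"
        unfolding runs_def
        by (intro exI conjI, rule exec.Seq[OF exec.Seq[OF exec.Seq[OF exec.Seq[OF x1 y1(1)] x2] y2(1)] x3])
           (use y1 y2 in \<open>auto simp: T_def\<close>)
    qed
  qed
qed

lemma poly_time_if:
  assumes "poly_time e enc_bool p" "poly_time e e' f" "poly_time e e' g"
  shows "poly_time e e' (\<lambda>x. if p x then f x else g x)"
proof -
  obtain T0 c0 where 0: "poly_bounded e T0"
    "\<And>b s x. s b = e x \<Longrightarrow> runs (c0 b) b s (enc_bool (p x)) (T0 x)"
    by (rule poly_timeE[OF assms(1)]) blast
  obtain T1 c1 where 1: "poly_bounded e T1"
    "\<And>b s x. s b = e x \<Longrightarrow> runs (c1 b) b s (e' (f x)) (T1 x)"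
    by (rule poly_timeE[OF assms(2)]) blast
  obtain T2 c2 where 2: "poly_bounded e T2"
    "\<And>b s x. s b = e x \<Longrightarrow> runs (c2 b) b s (e' (g x)) (T2 x)"
    by (rule poly_timeE[OF assms(3)]) blast
  define T where "T = (\<lambda>x. (1 + tree_size (e x)) + T0 x + (1 + 3 + (T1 x + T2 x)))"
  show ?thesis
  proof (rule poly_timeI)
    show "poly_bounded e (\<lambda>x. tree_size (e' (if p x then f x else g x)))"
      by (rule poly_bounded_mono[OF
            poly_bounded_add[OF poly_time_size[OF assms(2)] poly_time_size[OF assms(3)]]]) auto
    show "poly_bounded e T" unfolding T_def
      by (intro poly_bounded_intros 0(1) 1(1) 2(1))
    fix b
    let ?c = "Seq (Seq (Assign (Suc b) (Var b)) (c0 (Suc b))) (If (Var (Suc b)) (c1 b) (c2 b))"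
    show "\<exists>c. \<forall>s x. s b = e x \<longrightarrow> runs c b s (e' (if p x then f x else g x)) (T x)"
    proof (rule exI[of _ ?c], intro allI impI)
      fix s x assume s: "s b = e x"
      have x0: "exec (Assign (Suc b) (Var b)) s (1 + tree_size (e x)) (s(Suc b := e x))"
        using exec.Assign[of "Suc b" "Var b" s] s by simp
      from 0(2)[of "s(Suc b := e x)" "Suc b" x] obtain t0 s0 where
        y0: "exec (c0 (Suc b)) (s(Suc b := e x)) t0 s0" "s0 (Suc b) = enc_bool (p x)"
           "\<forall>z<Suc b. s0 z = s z" "t0 \<le> T0 x"
        unfolding runs_def by auto
      have "s0 b = e x" using y0 s by simp
      note 1 = 1(2)[of s0 b x, OF this] and 2 = 2(2)[of s0 b x, OF this]
      show "runs ?c b s (e' (if p x then f x else g x)) (T x)"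
      proof (cases "p x")
        case True
        from 1 obtain t1 s1 where y1: "exec (c1 b) s0 t1 s1" "s1 b = e' (f x)"
           "\<forall>z<b. s1 z = s0 z" "t1 \<le> T1 x"
          unfolding runs_def by auto
        show ?thesis unfolding runs_def
          by (intro exI conjI, rule exec.Seq[OF exec.Seq[OF x0 y0(1)] exec.IfTrue[OF _ y1(1)]])
             (use y0 y1 True in \<open>auto simp: T_def enc_bool_def\<close>)
      next
        case False
        from 2 obtain t1 s1 where y1: "exec (c2 b) s0 t1 s1" "s1 b = e' (g x)"
           "\<forall>z<b. s1 z = s0 z" "t1 \<le> T2 x"
          unfolding runs_def by auto
        show ?thesis unfolding runs_def
          by (intro exI conjI, rule exec.Seq[OF exec.Seq[OF x0 y0(1)] exec.IfFalse[OF _ y1(1)]])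
             (use y0 y1 False in \<open>auto simp: T_def enc_bool_def\<close>)
      qed
    qed
  qed
qed

lemma poly_time_eq:
  assumes "poly_time e e1 f" "poly_time e e1 g" "inj e1"
  shows "poly_time e enc_bool (\<lambda>x. f x = g x)"
proof -
  have "poly_time (e1 \<otimes> e1) enc_bool (\<lambda>p. fst p = snd p)"
  proof (rule poly_time_expr[where a = "\<lambda>b. EqE (Hd (Var b)) (Tl (Var b))"
        and T = "\<lambda>x. 4 * tree_size ((e1 \<otimes> e1) x) + 3"])
    show "poly_bounded (e1 \<otimes> e1) (\<lambda>x. tree_size (enc_bool (fst x = snd x)))"
      by (rule poly_bounded_mono[OF poly_bounded_const[of _ 3]]) (auto simp: enc_bool_def)
    show "poly_bounded (e1 \<otimes> e1) (\<lambda>x. 4 * tree_size ((e1 \<otimes> e1) x) + 3)"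
      by (intro poly_bounded_add poly_bounded_mult poly_bounded_const poly_bounded_size)
  qed (auto simp: enc_pair_def enc_bool_def inj_eq[OF assms(3)])
  from poly_time_compose[OF this poly_time_pair[OF assms(1,2)]] show ?thesis by simp
qed

section \<open>Lists and bounded recursion along them\<close>

lemma enc_list_simps [simp]:
  "enc_list e [] = Leaf" "enc_list e (x # xs) = Node (e x) (enc_list e xs)"
  by (simp_all add: enc_list_def)

lemma tree_size_enc_list:
  "tree_size (enc_list e xs) = 1 + (\<Sum>x\<leftarrow>xs. 1 + tree_size (e x))"
  by (induction xs) auto

lemma length_le_enc_list: "length xs + 1 \<le> tree_size (enc_list e xs)"
  by (induction xs) auto

lemma elem_le_enc_list: "y \<in> set ys \<Longrightarrow> 1 + tree_size (e y) \<le> tree_size (enc_list e ys)"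
  by (induction ys) auto

lemma poly_time_cons:
  assumes "poly_time e e1 f" "poly_time e (enc_list e1) g"
  shows "poly_time e (enc_list e1) (\<lambda>x. f x # g x)"
  by (rule poly_time_retype[OF poly_time_pair[OF assms]]) simp

lemma poly_time_tl:
  assumes "poly_time e (enc_list e1) g"
  shows "poly_time e (enc_list e1) (\<lambda>x. tl (g x))"
proof (rule poly_time_compose[OF _ assms],
       rule poly_time_expr[where a = "\<lambda>b. Tl (Var b)" and T = "\<lambda>x. 2 * tree_size (enc_list e1 x)"])
  show "eval_expr (Tl (Var b)) s = enc_list e1 (tl x) \<and>
     cost (Tl (Var b)) s \<le> 2 * tree_size (enc_list e1 x)" if "s b = enc_list e1 x" for s b x
    using that by (cases x) auto
  show "poly_bounded (enc_list e1) (\<lambda>x. tree_size (enc_list e1 (tl x)))"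
    by (rule poly_bounded_mono[OF poly_bounded_size]) (case_tac x; simp)
qed (intro poly_bounded_intros)

text \<open>Registers \<open>b\<close>, \<open>b + 1\<close> and \<open>b + 2\<close> hold the
  parameter, the unread rest of the list and the accumulator; the body works from
  \<open>b + 3\<close> upwards. The bounds \<open>M\<close> and \<open>K\<close> are required at
  every prefix of the list, as accumulators may shrink again later. One round costs at most
  \<open>10 * M + 4 + K\<close>; the numbers 20 are generous.\<close>

lemma foldl_loop:
  assumes step: "\<And>s a y. s (b + 3) = (e \<otimes> e1 \<otimes> e0) (x, y, a) \<Longrightarrow>
      runs c (b + 3) s (e0 (f a y)) (T (x, y, a))"
    and M: "\<And>i y. y \<in> set ys \<Longrightarrow>
      tree_size ((e \<otimes> e1 \<otimes> e0) (x, y, foldl f a (take i ys))) \<le> M \<and>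
      T (x, y, foldl f a (take i ys)) \<le> K"
    and M': "tree_size (enc_list e1 ys) \<le> M" "\<And>i. tree_size (e0 (foldl f a (take i ys))) \<le> M"
    and s: "s b = e x" "s (b + 1) = enc_list e1 ys" "s (b + 2) = e0 a"
  shows "\<exists>t s'. exec (While (Var (b + 1))
      (Seq (Seq (Seq (Assign (b + 3) (NodeE (Var b) (NodeE (Hd (Var (b + 1))) (Var (b + 2))))) c)
        (Assign (b + 2) (Var (b + 3)))) (Assign (b + 1) (Tl (Var (b + 1)))))) s t s' \<and>
      s' (b + 2) = e0 (foldl f a ys) \<and> (\<forall>z<b. s' z = s z) \<and>
      t \<le> (length ys + 1) * (20 * M + 20 + K)"
  using M M' s
proof (induction ys arbitrary: a s)
  case Nil
  have "exec (While (Var (b + 1)) d) s (1 + 1) s" for d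
    using exec.WhileFalse[of "Var (b + 1)" s d] Nil by simp
  with Nil(6) show ?case by (intro exI[of _ "1 + 1"] exI[of _ s]) simp
next
  case (Cons y ys)
  let ?n = "NodeE (Var b) (NodeE (Hd (Var (b + 1))) (Var (b + 2)))"
  let ?z = "Node (e x) (Node (e1 y) (e0 a))"
  have z: "tree_size ?z \<le> M" "T (x, y, a) \<le> K"
    using Cons.prems(1)[of y 0] by simp_all
  have sz: "tree_size (Node (e1 y) (enc_list e1 ys)) \<le> M"
    using Cons.prems(2) by simp
  have ev: "eval_expr ?n s = ?z" using Cons.prems by simp
  have x1: "exec (Assign (b + 3) ?n) s (1 + cost ?n s) (s(b + 3 := ?z))"
    using exec.Assign[of "b + 3" ?n s] unfolding ev .
  have c1: "cost ?n s \<le> 6 * M"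
    using z(1) sz Cons.prems by simp
  from step[of "s(b + 3 := ?z)" y a] obtain t1 s1 where
    y1: "exec c (s(b + 3 := ?z)) t1 s1" "s1 (b + 3) = e0 (f a y)" "\<forall>z<b + 3. s1 z = s z"
      "t1 \<le> T (x, y, a)"
    unfolding runs_def by auto
  have x2: "exec (Assign (b + 2) (Var (b + 3))) s1 (1 + tree_size (e0 (f a y))) (s1(b + 2 := e0 (f a y)))"
    using exec.Assign[of "b + 2" "Var (b + 3)" s1] y1(2) by simp
  have c2: "tree_size (e0 (f a y)) \<le> M"
    using Cons.prems(3)[of 1] by simp
  let ?s2 = "s1(b + 2 := e0 (f a y))"
  have s2: "?s2 (b + 1) = Node (e1 y) (enc_list e1 ys)"
    using y1(3) Cons.prems by simp
  have x3: "exec (Assign (b + 1) (Tl (Var (b + 1)))) ?s2 (1 + cost (Tl (Var (b + 1))) ?s2)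
     (?s2(b + 1 := enc_list e1 ys))"
    using exec.Assign[of "b + 1" "Tl (Var (b + 1))" ?s2] s2 by simp
  have c3: "cost (Tl (Var (b + 1))) ?s2 \<le> 2 * M"
    using s2 sz by simp
  let ?s3 = "?s2(b + 1 := enc_list e1 ys)"
  have "\<exists>t s'. exec (While (Var (b + 1))
      (Seq (Seq (Seq (Assign (b + 3) ?n) c)
        (Assign (b + 2) (Var (b + 3)))) (Assign (b + 1) (Tl (Var (b + 1)))))) ?s3 t s' \<and>
      s' (b + 2) = e0 (foldl f (f a y) ys) \<and> (\<forall>z<b. s' z = ?s3 z) \<and>
      t \<le> (length ys + 1) * (20 * M + 20 + K)"
  proof (rule Cons.IH)
    show "tree_size ((e \<otimes> e1 \<otimes> e0) (x, y', foldl f (f a y) (take i ys))) \<le> M \<and>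
      T (x, y', foldl f (f a y) (take i ys)) \<le> K" if "y' \<in> set ys" for i y'
      using Cons.prems(1)[of y' "Suc i"] that by simp
    show "tree_size (e0 (foldl f (f a y) (take i ys))) \<le> M" for i
      using Cons.prems(3)[of "Suc i"] by simp
  qed (use sz y1(3) Cons.prems in auto)
  then obtain t4 s4 where
    y4: "exec (While (Var (b + 1))
      (Seq (Seq (Seq (Assign (b + 3) ?n) c)
        (Assign (b + 2) (Var (b + 3)))) (Assign (b + 1) (Tl (Var (b + 1)))))) ?s3 t4 s4"
      "s4 (b + 2) = e0 (foldl f (f a y) ys)" "\<forall>z<b. s4 z = ?s3 z"
      "t4 \<le> (length ys + 1) * (20 * M + 20 + K)"
    by blast
  have nl: "eval_expr (Var (b + 1)) s \<noteq> Leaf" using Cons.prems by simp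
  have c0: "cost (Var (b + 1)) s \<le> M" using Cons.prems by simp
  note ex = exec.WhileTrue[OF nl exec.Seq[OF exec.Seq[OF exec.Seq[OF x1 y1(1)] x2] x3] y4(1)]
  define Q where "Q = 20 * M + 20 + K"
  have Q: "(length (y # ys) + 1) * Q = (length ys + 1) * Q + Q" by simp
  show ?case
  proof (intro exI conjI, rule ex)
    show "s4 (b + 2) = e0 (foldl f a (y # ys))" using y4 by simp
    show "\<forall>z<b. s4 z = s z" using y4(3) y1(3) by simp
    show "1 + cost (Var (b + 1)) s +
       (1 + cost ?n s + t1 + (1 + tree_size (e0 (f a y))) + (1 + cost (Tl (Var (b + 1))) ?s2)) + t4
      \<le> (length (y # ys) + 1) * (20 * M + 20 + K)"
      using c0 c1 c2 c3 y1(4) z(2) y4(4) unfolding Q_def[symmetric] Q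
      unfolding Q_def by linarith
  qed
qed

text \<open>The bound \<open>S\<close> on all intermediate accumulators does not follow from
  \<open>step\<close>: doubling the accumulator is a polynomial step, but its iteration is
  exponential. This is the limited recursion of Cobham's characterisation of polynomial
  time.\<close>

lemma poly_time_foldl:
  assumes xs: "poly_time e (enc_list e1) xs" and init: "poly_time e e0 a0"
    and step: "poly_time (e \<otimes> e1 \<otimes> e0) e0 (\<lambda>z. f (fst z) (snd (snd z)) (fst (snd z)))"
    and S: "poly_bounded e S" "\<And>x i. tree_size (e0 (foldl (f x) (a0 x) (take i (xs x)))) \<le> S x"
  shows "poly_time e e0 (\<lambda>x. foldl (f x) (a0 x) (xs x))"
proof -
  obtain T1 c1 where 1: "poly_bounded e T1"
    "\<And>b s x. s b = e x \<Longrightarrow> runs (c1 b) b s (enc_list e1 (xs x)) (T1 x)"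
    by (rule poly_timeE[OF xs]) blast
  obtain T2 c2 where 2: "poly_bounded e T2"
    "\<And>b s x. s b = e x \<Longrightarrow> runs (c2 b) b s (e0 (a0 x)) (T2 x)"
    by (rule poly_timeE[OF init]) blast
  obtain T3 c3 where 3: "poly_bounded (e \<otimes> e1 \<otimes> e0) T3"
    "\<And>b s x. s b = (e \<otimes> e1 \<otimes> e0) x \<Longrightarrow>
       runs (c3 b) b s (e0 (f (fst x) (snd (snd x)) (fst (snd x)))) (T3 x)"
    by (rule poly_timeE[OF step]) blast
  obtain C k where C: "\<And>z. T3 z \<le> C * tree_size ((e \<otimes> e1 \<otimes> e0) z) ^ k"
    using 3(1) unfolding poly_bounded_def by blast
  \<comment> \<open>The summand 2 pays for the two \<open>Node\<close> constructors of the triple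
    that is handed to the loop body.\<close>
  define M where "M = (\<lambda>x. 2 + tree_size (e x) + tree_size (enc_list e1 (xs x)) + S x)"
  define K where "K = (\<lambda>x. C * M x ^ k)"
  define T where "T = (\<lambda>x. (1 + tree_size (e x)) + T1 x + (1 + tree_size (e x)) + T2 x +
     tree_size (enc_list e1 (xs x)) * (20 * M x + 20 + K x) + (1 + S x))"
  have pM: "poly_bounded e M" unfolding M_def
    by (intro poly_bounded_intros S(1) poly_time_size[OF xs])
  show ?thesis
  proof (rule poly_timeI)
    show "poly_bounded e (\<lambda>x. tree_size (e0 (foldl (f x) (a0 x) (xs x))))"
    proof (rule poly_bounded_mono[OF S(1)])
      show "tree_size (e0 (foldl (f x) (a0 x) (xs x))) \<le> S x" for x
        using S(2)[of x "length (xs x)"] by simp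
    qed
    show "poly_bounded e T" unfolding T_def K_def
      by (intro poly_bounded_intros S(1) pM 1(1) 2(1) poly_time_size[OF xs])
    fix b
    let ?w = "While (Var (b + 1))
      (Seq (Seq (Seq (Assign (b + 3) (NodeE (Var b) (NodeE (Hd (Var (b + 1))) (Var (b + 2))))) (c3 (b + 3)))
        (Assign (b + 2) (Var (b + 3)))) (Assign (b + 1) (Tl (Var (b + 1)))))"
    let ?c = "Seq (Seq (Seq (Seq (Seq (Assign (b + 1) (Var b)) (c1 (b + 1)))
       (Assign (b + 2) (Var b))) (c2 (b + 2))) ?w) (Assign b (Var (b + 2)))"
    show "\<exists>c. \<forall>s x. s b = e x \<longrightarrow> runs c b s (e0 (foldl (f x) (a0 x) (xs x))) (T x)"
    proof (rule exI[of _ ?c], intro allI impI)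
      fix s x assume s: "s b = e x"
      have x1: "exec (Assign (b + 1) (Var b)) s (1 + tree_size (e x)) (s(b + 1 := e x))"
        using exec.Assign[of "b + 1" "Var b" s] s by simp
      from 1(2)[of "s(b + 1 := e x)" "b + 1" x] obtain t1 s1 where
        y1: "exec (c1 (b + 1)) (s(b + 1 := e x)) t1 s1" "s1 (b + 1) = enc_list e1 (xs x)"
           "\<forall>z<b+1. s1 z = s z" "t1 \<le> T1 x"
        unfolding runs_def by auto
      have x2: "exec (Assign (b+2) (Var b)) s1 (1 + tree_size (e x)) (s1(b + 2 := e x))"
        using exec.Assign[of "b+2" "Var b" s1] s y1(3) by simp
      from 2(2)[of "s1(b+2 := e x)" "b+2" x] obtain t2 s2 where
        y2: "exec (c2 (b+2)) (s1(b+2 := e x)) t2 s2" "s2 (b+2) = e0 (a0 x)"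
           "\<forall>z<b+2. s2 z = s1 z" "t2 \<le> T2 x"
        unfolding runs_def by auto
      have b1: "tree_size ((e \<otimes> e1 \<otimes> e0) (x, y, foldl (f x) (a0 x) (take i (xs x)))) \<le> M x"
        if "y \<in> set (xs x)" for i y
      proof -
        have "1 + tree_size (e1 y) \<le> tree_size (enc_list e1 (xs x))"
          using that by (rule elem_le_enc_list)
        with S(2)[of x i] show ?thesis by (simp add: M_def)
      qed
      have "\<exists>t s'. exec ?w s2 t s' \<and> s' (b + 2) = e0 (foldl (f x) (a0 x) (xs x)) \<and>
          (\<forall>z<b. s' z = s2 z) \<and> t \<le> (length (xs x) + 1) * (20 * M x + 20 + K x)"
      proof (rule foldl_loop[where T = T3 and e = e and x = x])
        show "runs (c3 (b + 3)) (b + 3) s (e0 (f x a y)) (T3 (x, y, a))"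
          if "s (b + 3) = (e \<otimes> e1 \<otimes> e0) (x, y, a)" for s a y
          using 3(2)[of s "b + 3" "(x, y, a)", OF that] by simp
        show "tree_size ((e \<otimes> e1 \<otimes> e0) (x, y, foldl (f x) (a0 x) (take i (xs x)))) \<le> M x \<and>
           T3 (x, y, foldl (f x) (a0 x) (take i (xs x))) \<le> K x" if "y \<in> set (xs x)" for i y
        proof (rule conjI[OF b1[OF that]])
          let ?z = "(x, y, foldl (f x) (a0 x) (take i (xs x)))"
          have "tree_size ((e \<otimes> e1 \<otimes> e0) ?z) ^ k \<le> M x ^ k"
            by (rule power_mono[OF b1[OF that]]) simp
          then have "C * tree_size ((e \<otimes> e1 \<otimes> e0) ?z) ^ k \<le> K x" unfolding K_def
            by (rule mult_le_mono2)
          with C[of ?z] show "T3 ?z \<le> K x" by (rule le_trans)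
        qed
        show "tree_size (e0 (foldl (f x) (a0 x) (take i (xs x)))) \<le> M x" for i
          using S(2)[of x i] by (simp add: M_def)
      qed (use y1 y2 s in \<open>auto simp: M_def\<close>)
      then obtain t3 s3 where y3: "exec ?w s2 t3 s3"
        "s3 (b + 2) = e0 (foldl (f x) (a0 x) (xs x))"
        "\<forall>z<b. s3 z = s2 z" "t3 \<le> (length (xs x) + 1) * (20 * M x + 20 + K x)"
        by blast
      have x4: "exec (Assign b (Var (b+2))) s3 (1 + tree_size (s3 (b+2))) (s3(b := s3 (b+2)))"
        using exec.Assign[of b "Var (b+2)" s3] by simp
      have c4: "tree_size (s3 (b+2)) \<le> S x" using y3(2) S(2)[of x "length (xs x)"] by simp
      have "length (xs x) + 1 \<le> tree_size (enc_list e1 (xs x))"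
        by (rule length_le_enc_list)
      then have "(length (xs x) + 1) * (20 * M x + 20 + K x) \<le>
          tree_size (enc_list e1 (xs x)) * (20 * M x + 20 + K x)"
        by (rule mult_le_mono1)
      with y3(4) have c3: "t3 \<le> tree_size (enc_list e1 (xs x)) * (20 * M x + 20 + K x)" by simp
      show "runs ?c b s (e0 (foldl (f x) (a0 x) (xs x))) (T x)"
        unfolding runs_def
      proof (intro exI conjI, rule exec.Seq[OF exec.Seq[OF exec.Seq[OF exec.Seq[OF exec.Seq[OF
              x1 y1(1)] x2] y2(1)] y3(1)] x4])
        show "1 + tree_size (e x) + t1 + (1 + tree_size (e x)) + t2 + t3 + (1 + tree_size (s3 (b + 2))) \<le> T x"
          using c3 c4 y1(4) y2(4) unfolding T_def by linarith
      qed (use y1 y2 y3 in auto)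
    qed
  qed
qed

text \<open>A right fold is a left fold over the reversed list, whose prefixes are the reversed
  suffixes. \<open>rev\<close> appears as a hypothesis because it is itself obtained from
  \<open>poly_time_foldl\<close> further below; \<open>poly_time_foldr'\<close> discharges
  it.\<close>

lemma poly_time_foldr:
  assumes xs: "poly_time e (enc_list e1) xs" and init: "poly_time e e0 a0"
    and step: "poly_time (e \<otimes> e1 \<otimes> e0) e0 (\<lambda>z. f (fst z) (fst (snd z)) (snd (snd z)))"
    and S: "poly_bounded e S" "\<And>x i. tree_size (e0 (foldr (f x) (drop i (xs x)) (a0 x))) \<le> S x"
    and rev: "poly_time (enc_list e1) (enc_list e1) rev"
  shows "poly_time e e0 (\<lambda>x. foldr (f x) (xs x) (a0 x))"
  unfolding foldr_conv_foldl
proof (rule poly_time_foldl[where S = S, OF poly_time_compose[OF rev xs] init step S(1)])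
  show "tree_size (e0 (foldl (\<lambda>a y. f x y a) (a0 x) (take i (rev (xs x))))) \<le> S x" for x i
    using S(2)[where x = x and i = "length (xs x) - i"] by (simp add: foldr_conv_foldl take_rev)
qed

lemma tree_size_enc_list_append:
  "tree_size (enc_list e (xs @ ys)) + 1 = tree_size (enc_list e xs) + tree_size (enc_list e ys)"
  by (simp add: tree_size_enc_list)

lemma tree_size_enc_list_take: "tree_size (enc_list e (take i xs)) \<le> tree_size (enc_list e xs)"
  using tree_size_enc_list_append[of e "take i xs" "drop i xs"] tree_size_ge_1[of "enc_list e (drop i xs)"]
  by simp

lemma tree_size_enc_list_drop: "tree_size (enc_list e (drop i xs)) \<le> tree_size (enc_list e xs)"
  using tree_size_enc_list_append[of e "take i xs" "drop i xs"] tree_size_ge_1[of "enc_list e (take i xs)"]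
  by simp

lemma tree_size_enc_list_rev: "tree_size (enc_list e (rev xs)) = tree_size (enc_list e xs)"
  by (simp add: tree_size_enc_list flip: rev_map)

lemma tree_size_enc_list_filter: "tree_size (enc_list e (filter p xs)) \<le> tree_size (enc_list e xs)"
  by (induction xs) auto

lemma tree_size_enc_list_takeWhile:
  "tree_size (enc_list e (takeWhile p xs)) \<le> tree_size (enc_list e xs)"
  by (induction xs) auto

lemma tree_size_enc_list_concat:
  "tree_size (enc_list e (concat xss)) \<le> tree_size (enc_list (enc_list e) xss)"
proof (induction xss)
  case (Cons xs xss)
  then show ?case using tree_size_enc_list_append[of e xs "concat xss"] by simp
qed simp

lemma tree_size_enc_list_le:
  assumes "\<And>x. x \<in> set xs \<Longrightarrow> tree_size (e x) \<le> M"
  shows "tree_size (enc_list e xs) \<le> 1 + length xs * (1 + M)"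
  using assms by (induction xs) (fastforce intro: add_mono)+

lemma foldl_Cons_eq_rev: "foldl (\<lambda>a y. y # a) [] xs = rev xs"
  by (induction xs rule: rev_induct) auto

lemma poly_time_rev:
  assumes "poly_time e (enc_list e1) xs"
  shows "poly_time e (enc_list e1) (\<lambda>x. rev (xs x))"
proof -
  have "poly_time (enc_list e1) (enc_list e1) (\<lambda>xs. foldl (\<lambda>a y. y # a) [] xs)"
    by (rule poly_time_foldl[OF poly_time_id poly_time_const _ poly_bounded_size])
      (intro poly_time_cons poly_time_fst[OF poly_time_snd[OF poly_time_id]]
         poly_time_snd[OF poly_time_snd[OF poly_time_id]],
       simp add: foldl_Cons_eq_rev tree_size_enc_list_rev tree_size_enc_list_take)
  from poly_time_compose[OF this assms] show ?thesis by (simp add: foldl_Cons_eq_rev)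
qed

lemmas poly_time_foldr' = poly_time_foldr[OF _ _ _ _ _ poly_time_rev[OF poly_time_id]]

text \<open>A function of several arguments is analysed once, on tuples. With \<open>f\<close>
  instantiated to that constant, this lemma becomes an introduction rule for its curried
  applications, which unification can select by the head symbol.\<close>

lemma poly_time_app2:
  assumes "poly_time (e1 \<otimes> e2) e3 (\<lambda>z. f (fst z) (snd z))"
    "poly_time e e1 g1" "poly_time e e2 g2"
  shows "poly_time e e3 (\<lambda>x. f (g1 x) (g2 x))"
  using poly_time_compose[OF assms(1) poly_time_pair[OF assms(2,3)]] by simp

lemma poly_time_app3:
  assumes "poly_time (e1 \<otimes> e2 \<otimes> e3) e4 (\<lambda>z. f (fst z) (fst (snd z)) (snd (snd z)))"
    "poly_time e e1 g1" "poly_time e e2 g2" "poly_time e e3 g3"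
  shows "poly_time e e4 (\<lambda>x. f (g1 x) (g2 x) (g3 x))"
  using poly_time_compose[OF assms(1) poly_time_pair[OF assms(2) poly_time_pair[OF assms(3,4)]]]
  by simp

lemmas poly_time_proj = poly_time_id poly_time_fst poly_time_snd

lemma foldr_Cons_eq_map: "foldr (\<lambda>y a. g y # a) xs [] = map g xs"
  by (induction xs) auto

lemma poly_time_map:
  assumes xs: "poly_time e (enc_list e1) xs"
    and g: "poly_time (e \<otimes> e1) e2 (\<lambda>z. g (fst z) (snd z))"
  shows "poly_time e (enc_list e2) (\<lambda>x. map (g x) (xs x))"
proof -
  obtain C k where C: "\<And>z. tree_size (e2 (g (fst z) (snd z))) \<le> C * tree_size ((e \<otimes> e1) z) ^ k"
    using poly_time_size[OF g] unfolding poly_bounded_def by blast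
  define D where "D = (\<lambda>x. C * (1 + tree_size (e x) + tree_size (enc_list e1 (xs x))) ^ k)"
  define S where "S = (\<lambda>x. 1 + tree_size (enc_list e1 (xs x)) * (1 + D x))"
  have S: "poly_bounded e S"
    unfolding S_def D_def by (intro poly_bounded_intros poly_time_size[OF xs])
  have "poly_time e (enc_list e2) (\<lambda>x. foldr (\<lambda>y a. g x y # a) (xs x) [])"
  proof (rule poly_time_foldr'[OF xs poly_time_const _ S])
    show "poly_time (e \<otimes> e1 \<otimes> enc_list e2) (enc_list e2)
       (\<lambda>z. g (fst z) (fst (snd z)) # snd (snd z))"
      by (rule poly_time_cons, rule poly_time_app2[OF g]) (rule poly_time_proj)+
    fix x i
    have "tree_size (enc_list e2 (map (g x) (drop i (xs x)))) \<le> tree_size (enc_list e2 (map (g x) (xs x)))"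
      by (simp add: tree_size_enc_list_drop flip: drop_map)
    also have "\<dots> \<le> 1 + length (map (g x) (xs x)) * (1 + D x)"
    proof (rule tree_size_enc_list_le)
      fix w assume "w \<in> set (map (g x) (xs x))"
      then obtain y where y: "y \<in> set (xs x)" "w = g x y" by auto
      have "tree_size (e2 w) \<le> C * tree_size ((e \<otimes> e1) (x, y)) ^ k"
        using C[of "(x, y)"] y by simp
      also have "\<dots> \<le> D x" unfolding D_def
        using elem_le_enc_list[OF y(1), of e1] by (intro mult_le_mono2 power_mono) auto
      finally show "tree_size (e2 w) \<le> D x" .
    qed
    also have "\<dots> \<le> S x" unfolding S_def length_map
      using length_le_enc_list[of "xs x" e1] by (intro add_left_mono mult_le_mono1) simp
    finally show "tree_size (enc_list e2 (foldr (\<lambda>y a. g x y # a) (drop i (xs x)) [])) \<le> S x"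
      unfolding foldr_Cons_eq_map .
  qed
  then show ?thesis unfolding foldr_Cons_eq_map .
qed

lemma foldr_Cons_eq_append: "foldr (#) xs ys = xs @ ys"
  by (induction xs) auto

lemma poly_time_append:
  assumes f: "poly_time e (enc_list e1) f" and g: "poly_time e (enc_list e1) g"
  shows "poly_time e (enc_list e1) (\<lambda>x. f x @ g x)"
proof -
  define S where "S = (\<lambda>x. tree_size (enc_list e1 (f x)) + tree_size (enc_list e1 (g x)))"
  have S: "poly_bounded e S" unfolding S_def by (intro poly_bounded_intros poly_time_size f g)
  have "poly_time e (enc_list e1) (\<lambda>x. foldr (#) (f x) (g x))"
  proof (rule poly_time_foldr'[OF f g _ S])
    show "poly_time (e \<otimes> e1 \<otimes> enc_list e1) (enc_list e1) (\<lambda>z. fst (snd z) # snd (snd z))"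
      by (intro poly_time_cons) (rule poly_time_proj)+
    show "tree_size (enc_list e1 (foldr (#) (drop i (f x)) (g x))) \<le> S x" for x i
      using tree_size_enc_list_append[of e1 "drop i (f x)" "g x"] tree_size_enc_list_drop[of e1 i "f x"]
      by (simp add: foldr_Cons_eq_append S_def)
  qed
  then show ?thesis by (simp add: foldr_Cons_eq_append)
qed

lemma poly_time_concat:
  assumes f: "poly_time e (enc_list (enc_list e1)) f"
  shows "poly_time e (enc_list e1) (\<lambda>x. concat (f x))"
proof -
  have "poly_time e (enc_list e1) (\<lambda>x. foldr (@) (f x) [])"
  proof (rule poly_time_foldr'[OF f poly_time_const _ poly_time_size[OF f]])
    show "poly_time (e \<otimes> enc_list e1 \<otimes> enc_list e1) (enc_list e1) (\<lambda>z. fst (snd z) @ snd (snd z))"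
      by (intro poly_time_append) (rule poly_time_proj)+
    show "tree_size (enc_list e1 (foldr (@) (drop i (f x)) [])) \<le> tree_size (enc_list (enc_list e1) (f x))" for x i
      by (metis concat_conv_foldr le_trans tree_size_enc_list_concat tree_size_enc_list_drop)
  qed
  then show ?thesis by (simp add: concat_conv_foldr)
qed

lemma poly_time_filter:
  assumes xs: "poly_time e (enc_list e1) xs"
    and p: "poly_time (e \<otimes> e1) enc_bool (\<lambda>z. p (fst z) (snd z))"
  shows "poly_time e (enc_list e1) (\<lambda>x. filter (p x) (xs x))"
proof -
  have eq: "foldr (\<lambda>y a. if p x y then y # a else a) ys [] = filter (p x) ys" for x ys
    by (induction ys) auto
  have "poly_time e (enc_list e1) (\<lambda>x. foldr (\<lambda>y a. if p x y then y # a else a) (xs x) [])"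
  proof (rule poly_time_foldr'[OF xs poly_time_const _ poly_time_size[OF xs]])
    show "poly_time (e \<otimes> e1 \<otimes> enc_list e1) (enc_list e1)
      (\<lambda>z. if p (fst z) (fst (snd z)) then fst (snd z) # snd (snd z) else snd (snd z))"
      by (rule poly_time_if, rule poly_time_app2[OF p]) (rule poly_time_proj poly_time_cons)+
  qed (metis eq le_trans tree_size_enc_list_drop tree_size_enc_list_filter)
  then show ?thesis by (simp add: eq)
qed

lemma poly_time_takeWhile:
  assumes xs: "poly_time e (enc_list e1) xs"
    and p: "poly_time (e \<otimes> e1) enc_bool (\<lambda>z. p (fst z) (snd z))"
  shows "poly_time e (enc_list e1) (\<lambda>x. takeWhile (p x) (xs x))"
proof -
  have eq: "foldr (\<lambda>y a. if p x y then y # a else []) ys [] = takeWhile (p x) ys" for x ys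
    by (induction ys) auto
  have "poly_time e (enc_list e1) (\<lambda>x. foldr (\<lambda>y a. if p x y then y # a else []) (xs x) [])"
  proof (rule poly_time_foldr'[OF xs poly_time_const _ poly_time_size[OF xs]])
    show "poly_time (e \<otimes> e1 \<otimes> enc_list e1) (enc_list e1)
      (\<lambda>z. if p (fst z) (fst (snd z)) then fst (snd z) # snd (snd z) else [])"
      by (rule poly_time_if, rule poly_time_app2[OF p]) (rule poly_time_proj poly_time_cons poly_time_const)+
  qed (metis eq le_trans tree_size_enc_list_drop tree_size_enc_list_takeWhile)
  then show ?thesis by (simp add: eq)
qed

lemma poly_time_not:
  assumes "poly_time e enc_bool p"
  shows "poly_time e enc_bool (\<lambda>x. \<not> p x)"
proof -
  have "(if p x then False else True) = (\<not> p x)" for x by simp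
  with poly_time_if[OF assms poly_time_const[of e enc_bool False] poly_time_const[of e enc_bool True]]
  show ?thesis by presburger
qed

lemma poly_time_member:
  assumes y: "poly_time e e1 y" and xs: "poly_time e (enc_list e1) xs" and inj: "inj e1"
  shows "poly_time e enc_bool (\<lambda>x. y x \<in> set (xs x))"
proof -
  have eq: "foldr (\<lambda>w a. if y x = w then True else a) ws False \<longleftrightarrow> y x \<in> set ws" for x ws
    by (induction ws) auto
  have "poly_time e enc_bool (\<lambda>x. foldr (\<lambda>w a. if y x = w then True else a) (xs x) False)"
  proof (rule poly_time_foldr'[OF xs poly_time_const _ poly_bounded_const[of _ 3]])
    show "poly_time (e \<otimes> e1 \<otimes> enc_bool) enc_bool
      (\<lambda>z. if y (fst z) = fst (snd z) then True else snd (snd z))"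
      by (rule poly_time_if, rule poly_time_eq[OF _ _ inj], rule poly_time_compose[OF y])
         (rule poly_time_proj poly_time_const)+
  qed (simp add: enc_bool_def)
  then show ?thesis unfolding eq .
qed

subsection \<open>Binary numbers\<close>

text \<open>A binary number has the same code as the list of its bits, so arithmetic becomes a fold
  over lists.\<close>

fun bits :: "nat \<Rightarrow> bool list" where
  "bits n = (if n = 0 then [] else odd n # bits (n div 2))"

declare bits.simps [simp del]

lemma enc_list_bits: "enc_list enc_bool (bits n) = enc_nat n"
  by (induction n rule: bits.induct) (simp add: bits.simps enc_nat.simps)

lemma tree_size_enc_bool: "tree_size (enc_bool b) \<le> 3"
  by (simp add: enc_bool_def)

lemma inj_enc_bool: "inj enc_bool"
  by (auto simp: inj_def enc_bool_def split: if_splits)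

lemma inj_enc_nat: "inj enc_nat"
proof (rule injI)
  show "enc_nat x = enc_nat y \<Longrightarrow> x = y" for x y
  proof (induction x arbitrary: y rule: less_induct)
    case (less x)
    show ?case
    proof (cases "x = 0 \<or> y = 0")
      case True
      with less.prems show ?thesis
        by (subst (asm) (1 2) enc_nat.simps) (auto split: if_splits)
    next
      case False
      with less.prems have "enc_bool (odd x) = enc_bool (odd y)" "enc_nat (x div 2) = enc_nat (y div 2)"
        by (subst (asm) (1 2) enc_nat.simps; simp)+
      with less.IH[of "x div 2" "y div 2"] False have "odd x = odd y" "x div 2 = y div 2"
        using inj_enc_bool by (auto simp: inj_eq)
      then show ?thesis by (metis even_two_times_div_two odd_two_times_div_two_succ)
    qed
  qed
qed

lemma inj_enc_list: "inj e \<Longrightarrow> inj (enc_list e)"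
proof (rule injI)
  show "inj e \<Longrightarrow> enc_list e xs = enc_list e ys \<Longrightarrow> xs = ys" for xs ys
  proof (induction xs arbitrary: ys)
    case Nil
    then show ?case by (cases ys) auto
  next
    case (Cons x xs)
    then show ?case by (cases ys) (auto simp: inj_eq)
  qed
qed

lemma inj_enc_pair: "inj e \<Longrightarrow> inj e' \<Longrightarrow> inj (e \<otimes> e')"
  by (auto simp: inj_def enc_pair_def)

lemma tree_size_enc_nat: "tree_size (enc_nat n) \<le> 4 * n + 1"
proof (induction n rule: less_induct)
  case (less n)
  show ?case
  proof (cases "n = 0")
    case False
    then have "n div 2 + 1 \<le> n" by linarith
    with False less[of "n div 2"] tree_size_enc_bool[of "odd n"] show ?thesis
      by (subst enc_nat.simps) simp
  qed (simp add: enc_nat.simps)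
qed

fun add_carry :: "bool \<Rightarrow> bool list \<Rightarrow> bool list" where
  "add_carry c [] = (if c then [True] else [])"
| "add_carry c (b # bs) = (c \<noteq> b) # add_carry (c \<and> b) bs"

lemma add_carry_False: "add_carry False bs = bs"
  by (induction bs) auto

lemma add_carry_bits: "add_carry True (bits n) = bits (Suc n)"
proof (induction n rule: bits.induct)
  case (1 n)
  show ?case
  proof (cases "n = 0")
    case False
    show ?thesis
    proof (cases "odd n")
      case True
      with 1 False show ?thesis
        by (subst (1 2) bits.simps) simp
    next
      case even: False
      with False show ?thesis
        by (subst (1 2) bits.simps) (simp add: add_carry_False)
    qed
  qed (simp add: bits.simps)
qed

text \<open>The state is the carry together with the reversed output so far. Conjunction and
  exclusive or are spelled with \<open>if\<close> and negation, the connectives for which the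
  calculus has rules.\<close>

definition carry_step :: "bool \<times> bool list \<Rightarrow> bool \<Rightarrow> bool \<times> bool list" where
  "carry_step a b = (if fst a then b else False, (if fst a then \<not> b else b) # snd a)"

lemma carry_step_loop:
  "rev (let a = foldl carry_step (c, out) bs in if fst a then True # snd a else snd a) =
     rev out @ add_carry c bs"
  by (induction bs arbitrary: c out) (auto simp: carry_step_def Let_def)

lemma length_carry_step: "length (snd (foldl carry_step a bs)) = length (snd a) + length bs"
  by (induction bs arbitrary: a) (auto simp: carry_step_def)

lemma poly_time_Suc:
  assumes "poly_time e enc_nat f"
  shows "poly_time e enc_nat (\<lambda>x. Suc (f x))"
proof -
  \<comment> \<open>A bit takes at most 3 and its list cell 1 more, hence the factor 4; the 5 is the
    pair node, the carry and the final \<open>Leaf\<close>.\<close>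
  define S where "S = (\<lambda>bs. 5 + tree_size (enc_list enc_bool bs) * 4)"
  have S: "poly_bounded (enc_list enc_bool) S" unfolding S_def by (intro poly_bounded_intros)
  have 1: "poly_time (enc_list enc_bool) (enc_bool \<otimes> enc_list enc_bool) (\<lambda>bs. foldl carry_step (True, []) bs)"
  proof (rule poly_time_foldl[OF poly_time_id poly_time_const _ S])
    show "poly_time (enc_list enc_bool \<otimes> enc_bool \<otimes> enc_bool \<otimes> enc_list enc_bool)
     (enc_bool \<otimes> enc_list enc_bool) (\<lambda>z. carry_step (snd (snd z)) (fst (snd z)))"
      unfolding carry_step_def
      by (rule poly_time_pair poly_time_if poly_time_cons poly_time_not poly_time_proj poly_time_const)+
    fix bs :: "bool list" and i
    let ?a = "foldl carry_step (True, []) (take i bs)"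
    have "tree_size (enc_list enc_bool (snd ?a)) \<le> 1 + length (snd ?a) * (1 + 3)"
      by (rule tree_size_enc_list_le) (rule tree_size_enc_bool)
    also have "length (snd ?a) \<le> tree_size (enc_list enc_bool bs)"
      using length_le_enc_list[of bs enc_bool] by (simp add: length_carry_step)
    finally show "tree_size ((enc_bool \<otimes> enc_list enc_bool) ?a) \<le> S bs"
      using tree_size_enc_bool[of "fst ?a"] by (simp add: enc_pair_def S_def)
  qed
  have "poly_time (enc_list enc_bool) (enc_list enc_bool)
     (\<lambda>bs. rev (if fst (foldl carry_step (True, []) bs) then True # snd (foldl carry_step (True, []) bs)
         else snd (foldl carry_step (True, []) bs)))"
    by (intro poly_time_rev poly_time_if poly_time_cons poly_time_const poly_time_fst[OF 1] poly_time_snd[OF 1])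
  then have "poly_time (enc_list enc_bool) (enc_list enc_bool) (add_carry True)"
    using carry_step_loop[of True "[]"] by (simp add: Let_def)
  from poly_time_compose[OF this poly_time_retype[OF assms]]
  have "poly_time e (enc_list enc_bool) (\<lambda>x. add_carry True (bits (f x)))"
    by (simp add: enc_list_bits)
  then show ?thesis
    by (rule poly_time_retype) (simp add: add_carry_bits enc_list_bits)
qed

lemma foldl_Suc: "foldl (\<lambda>a y. Suc a) n xs = n + length xs"
  by (induction xs arbitrary: n) auto

text \<open>Counting up with \<open>Suc\<close> is affordable because the counter never exceeds the
  length of the list. Apart from constants, all numbers in the output of the reduction arise as
  lengths or as entries of some \<open>[0..<length xs]\<close>, which replaces arithmetic.\<close>

lemma poly_time_length:
  assumes f: "poly_time e (enc_list e1) f"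
  shows "poly_time e enc_nat (\<lambda>x. length (f x))"
proof -
  define S where "S = (\<lambda>x. 4 * tree_size (enc_list e1 (f x)) + 1)"
  have S: "poly_bounded e S" unfolding S_def by (intro poly_bounded_intros poly_time_size[OF f])
  have "poly_time e enc_nat (\<lambda>x. foldl (\<lambda>a y. Suc a) 0 (f x))"
  proof (rule poly_time_foldl[OF f poly_time_const _ S])
    show "tree_size (enc_nat (foldl (\<lambda>a y. Suc a) 0 (take i (f x)))) \<le> S x" for i x
      using tree_size_enc_nat[of "length (take i (f x))"] length_le_enc_list[of "f x" e1]
      by (simp add: foldl_Suc S_def min_def split: if_splits)
  qed (rule poly_time_Suc poly_time_proj)+
  then show ?thesis by (simp add: foldl_Suc)
qed

lemma foldl_enumerate: "foldl (\<lambda>a y. (length a, y) # a) [] xs = rev (List.enumerate 0 xs)"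
  by (induction xs rule: rev_induct) (auto simp: enumerate_append_eq)

lemma poly_time_enumerate:
  assumes f: "poly_time e (enc_list e1) f"
  shows "poly_time e (enc_list (enc_nat \<otimes> e1)) (\<lambda>x. List.enumerate 0 (f x))"
proof -
  define N where "N = (\<lambda>x. tree_size (enc_list e1 (f x)))"
  define S where "S = (\<lambda>x. 1 + N x * (1 + (2 + 5 * N x)))"
  have S: "poly_bounded e S" unfolding S_def N_def
    by (intro poly_bounded_intros poly_time_size[OF f])
  have "poly_time e (enc_list (enc_nat \<otimes> e1)) (\<lambda>x. foldl (\<lambda>a y. (length a, y) # a) [] (f x))"
  proof (rule poly_time_foldl[OF f poly_time_const _ S])
    fix x i
    let ?E = "List.enumerate 0 (take i (f x))"
    have len: "length (f x) + 1 \<le> N x" unfolding N_def by (rule length_le_enc_list)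
    have "tree_size (enc_list (enc_nat \<otimes> e1) ?E) \<le> 1 + length ?E * (1 + (2 + 5 * N x))"
    proof (rule tree_size_enc_list_le)
      fix p assume "p \<in> set ?E"
      moreover obtain j y where jy: "p = (j, y)" by (cases p)
      ultimately have p: "p = (j, y)" "j < length (f x)" "y \<in> set (f x)"
        by (auto simp: in_set_enumerate_eq)
      have "tree_size (e1 y) \<le> N x" using elem_le_enc_list[OF p(3), of e1] by (simp add: N_def)
      with tree_size_enc_nat[of j] p(1,2) len show "tree_size ((enc_nat \<otimes> e1) p) \<le> 2 + 5 * N x"
        by simp
    qed
    also have "\<dots> \<le> S x" unfolding S_def
      using len by (intro add_left_mono mult_le_mono1) (simp add: min_def)
    finally show "tree_size (enc_list (enc_nat \<otimes> e1) (foldl (\<lambda>a y. (length a, y) # a) [] (take i (f x)))) \<le> S x"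
      by (simp add: foldl_enumerate tree_size_enc_list_rev)
  qed (rule poly_time_cons poly_time_pair poly_time_length poly_time_proj)+
  from poly_time_rev[OF this] show ?thesis by (simp add: foldl_enumerate)
qed

lemma poly_time_upt:
  assumes f: "poly_time e (enc_list e1) f"
  shows "poly_time e (enc_list enc_nat) (\<lambda>x. [0..<length (f x)])"
proof -
  have "poly_time e (enc_list enc_nat) (\<lambda>x. map (\<lambda>z. fst z) (List.enumerate 0 (f x)))"
    by (rule poly_time_map[OF poly_time_enumerate[OF f]]) (rule poly_time_proj)+
  then show ?thesis by simp
qed

lemmas poly_time_intros = poly_time_fst poly_time_snd poly_time_id poly_time_pair
  poly_time_cons poly_time_tl poly_time_append poly_time_concat poly_time_map poly_time_filter
  poly_time_rev poly_time_takeWhile poly_time_length poly_time_upt poly_time_enumerate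
  poly_time_member poly_time_if poly_time_not poly_time_eq poly_time_Suc poly_time_const
  inj_enc_nat inj_enc_list inj_enc_pair

section \<open>The election\<close>

lemma pos_nth:
  assumes "distinct v" "i < length v"
  shows "pos v (v ! i) = i + 1"
proof -
  have "(THE j. j < length v \<and> v ! j = v ! i) = i"
    using assms by (intro the_equality) (auto simp: nth_eq_iff_index_eq)
  then show ?thesis by (simp add: pos_def)
qed

lemma pos_append_less:
  assumes "distinct (us @ ws)" "a \<in> set us" "b \<in> set ws"
  shows "pos (us @ ws) a < pos (us @ ws) b"
proof -
  obtain i j where i: "i < length us" "us ! i = a" and j: "j < length ws" "ws ! j = b"
    using assms(2,3) by (auto simp: in_set_conv_nth)
  then have "pos (us @ ws) a = i + 1" "pos (us @ ws) b = length us + j + 1"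
    using pos_nth[OF assms(1), of i] pos_nth[OF assms(1), of "length us + j"]
    by (auto simp: nth_append)
  with i show ?thesis by simp
qed

lemma pos_inj:
  assumes "distinct v" "a \<in> set v" "b \<in> set v" "pos v a = pos v b"
  shows "a = b"
proof -
  obtain i j where "i < length v" "v ! i = a" "j < length v" "v ! j = b"
    using assms(2,3) by (auto simp: in_set_conv_nth)
  then show ?thesis using pos_nth[OF assms(1), of i] pos_nth[OF assms(1), of j] assms(4) by auto
qed

lemma pos_Cons_middle:
  assumes "distinct (us @ d # ws)"
  shows "pos (us @ d # ws) d = length us + 1"
  using pos_nth[OF assms, of "length us"] by simp

lemma shift_back_middle:
  assumes "distinct (us @ d # ws)"
  shows "shift_back d t (us @ d # ws) = us @ take t ws @ d # drop t ws"
  unfolding shift_back_def pos_Cons_middle[OF assms] by simp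

text \<open>Counting along the list instead of over indices makes the count additive over the groups
  of voters.\<close>

definition cnt :: "'c ranking list \<Rightarrow> 'c \<Rightarrow> 'c \<Rightarrow> nat" where
  "cnt V a b = length (filter (\<lambda>v. pos v a < pos v b) V)"

lemma num_prefer_eq_cnt: "num_prefer (C, V) a b = cnt V a b"
  by (simp add: num_prefer_def cnt_def length_filter_conv_card)

lemma cnt_append: "cnt (V @ W) a b = cnt V a b + cnt W a b"
  by (simp add: cnt_def)

lemma cnt_all: "(\<And>v. v \<in> set V \<Longrightarrow> pos v a < pos v b) \<Longrightarrow> cnt V a b = length V"
  by (simp add: cnt_def filter_id_conv)

lemma cnt_add:
  assumes "\<And>v. v \<in> set V \<Longrightarrow> distinct v \<and> a \<in> set v \<and> b \<in> set v" "a \<noteq> b"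
  shows "cnt V a b + cnt V b a = length V"
  using assms(1)
proof (induction V)
  case (Cons v V)
  have "pos v a \<noteq> pos v b" using Cons.prems[of v] pos_inj[of v a b] assms(2) by auto
  with Cons show ?case by (auto simp: cnt_def)
qed (simp add: cnt_def)

text \<open>A vote is given by the lists of the candidates before and after \<open>d\<close>.\<close>

definition ins :: "'c \<Rightarrow> nat \<Rightarrow> 'c list \<times> 'c list \<Rightarrow> 'c ranking" where
  "ins d \<tau> x = fst x @ take \<tau> (snd x) @ d # drop \<tau> (snd x)"

lemma set_ins: "set (ins d \<tau> x) = insert d (set (fst x @ snd x))"
proof -
  have "set (snd x) = set (take \<tau> (snd x)) \<union> set (drop \<tau> (snd x))"
    by (metis append_take_drop_id set_append)
  then show ?thesis by (auto simp: ins_def)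
qed

lemma distinct_ins: "distinct (ins d \<tau> x) \<longleftrightarrow> distinct (fst x @ d # snd x)"
proof -
  have "distinct (fst x @ us @ d # ws) \<longleftrightarrow> distinct (fst x @ d # us @ ws)" for us ws by auto
  from this[of "take \<tau> (snd x)" "drop \<tau> (snd x)"] show ?thesis by (simp add: ins_def)
qed

lemma ins_before_d:
  assumes "distinct (fst x @ d # snd x)" "a \<in> set (fst x) \<union> set (take \<tau> (snd x))"
  shows "pos (ins d \<tau> x) a < pos (ins d \<tau> x) d"
  using pos_append_less[of "fst x @ take \<tau> (snd x)" "d # drop \<tau> (snd x)" a d] assms distinct_ins[of d \<tau> x]
  by (auto simp: ins_def)

lemma ins_after_d:
  assumes "distinct (fst x @ d # snd x)" "a \<in> set (drop \<tau> (snd x))"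
  shows "pos (ins d \<tau> x) d < pos (ins d \<tau> x) a"
  using pos_append_less[of "fst x @ take \<tau> (snd x) @ [d]" "drop \<tau> (snd x)" d a] assms distinct_ins[of d \<tau> x]
  by (auto simp: ins_def)

lemma ins_unreached:
  assumes "distinct (fst x @ d # snd x)" "snd x = us @ ws" "\<tau> \<le> length us" "a \<in> set ws"
  shows "pos (ins d \<tau> x) d < pos (ins d \<tau> x) a"
  by (rule ins_after_d) (use assms in auto)

lemma filter_eq_appendE:
  assumes "filter p v = us @ ws"
  obtains us' ws' where "v = us' @ ws'" "filter p us' = us" "filter p ws' = ws"
  using assms
proof (induction v arbitrary: us thesis)
  case (Cons x v)
  show ?case
  proof (cases "p x \<and> us = []")
    case True
    with Cons.prems(2) show ?thesis by (intro Cons.prems(1)[of "[]" "x # v"]) auto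
  next
    case False
    define us0 where "us0 = (if p x then tl us else us)"
    from False Cons.prems(2) have us0: "filter p v = us0 @ ws" "us = (if p x then x # us0 else us0)"
      by (cases us; auto simp: us0_def)+
    from Cons.IH[OF _ us0(1)] obtain us' ws' where
      "v = us' @ ws'" "filter p us' = us0" "filter p ws' = ws" by blast
    with us0(2) show ?thesis by (intro Cons.prems(1)[of "x # us'" ws']) auto
  qed
qed simp

text \<open>Deleting \<open>d\<close> turns all shifted versions of a vote into the same list, so
  the order of two other candidates can be read off there. \<open>filter_eq_appendE\<close> lifts a
  split of this list back to a split of the vote.\<close>

lemma ins_other:
  assumes "distinct (fst x @ d # snd x)" "fst x @ snd x = us @ ws" "a \<in> set us" "b \<in> set ws"
  shows "pos (ins d \<tau> x) a < pos (ins d \<tau> x) b"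
proof -
  have *: "filter (\<lambda>c. c \<noteq> d) us = us" if "d \<notin> set us" for us
    using that by (intro filter_True) blast
  have "d \<notin> set (fst x)" "d \<notin> set (take \<tau> (snd x))" "d \<notin> set (drop \<tau> (snd x))"
    using assms(1) by (auto dest: in_set_takeD in_set_dropD)
  then have "filter (\<lambda>c. c \<noteq> d) (ins d \<tau> x) = fst x @ snd x"
    by (simp add: ins_def *)
  with assms(2) have "filter (\<lambda>c. c \<noteq> d) (ins d \<tau> x) = us @ ws" by simp
  then obtain us' ws' where s: "ins d \<tau> x = us' @ ws'"
    "filter (\<lambda>c. c \<noteq> d) us' = us" "filter (\<lambda>c. c \<noteq> d) ws' = ws"
    by (meson filter_eq_appendE)
  have "a \<in> set us'" "b \<in> set ws'" using s assms(3,4) by auto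
  with pos_append_less[of us' ws' a b] distinct_ins[of d \<tau> x] assms(1) s(1) show ?thesis by simp
qed

section \<open>The profile as a function of the lists of candidates\<close>

locale bribery_profile =
  fixes d :: 'c and P Q S Y Zs Rs :: "'c list" and sqs :: "'c list list"
begin

text \<open>A voter \<open>vA\<close> exists for every list to be passed. The numbers of the other voters are such that
  every challenger precedes \<open>d\<close> in \<open>s + 11\<close> (if relevant) or \<open>s + 12\<close> of the \<open>2 s + 23\<close> votes, and that every
  guard is reached by \<open>d\<close> or precedes \<open>d\<close> in at most \<open>s + 11\<close> votes. The \<open>vL\<close> compensate for the at most
  four \<open>vA\<close> and the \<open>vU\<close> in which a challenger precedes the guards.\<close>

definition rest where "rest sq = filter (\<lambda>y. y \<notin> set sq) Y"

definition vA where "vA sq = ([], sq @ P @ Q @ S @ rest sq)"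
definition vF where "vF = (Y, Q @ S @ P)"
definition vU where "vU = (Zs, P @ Q @ S @ Rs)"
definition vD where "vD = ([] :: 'c list, P @ Q @ S @ Y)"
definition vE where "vE = ([] :: 'c list, S @ P @ Q @ Y)"
definition vL where "vL = (P @ Q @ S @ Y, [] :: 'c list)"

lemmas v_defs = vA_def vF_def vU_def vD_def vE_def vL_def

abbreviation "s \<equiv> length sqs"

definition profile where
  "profile = map vA sqs @ replicate (s + 6) vF @ replicate 1 vU @ replicate 5 vD @ replicate 6 vE @
     replicate 5 vL"

end

text \<open>\<open>B \<le> w\<close> makes every list of guards a barrier that no affordable shift
  crosses. The 4 in \<open>few\<close> fits the intended lists: a \<open>Con\<close> candidate
  belongs to two colours, and the sequence of each colour occurs forwards and backwards.\<close>

locale bribery_election = bribery_profile +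
  fixes w B :: nat
  assumes dist: "distinct (d # P @ Q @ S @ Y)"
    and len: "length P = w" "length Q = w" "length S = w" "length Y = w + 1"
    and b: "1 \<le> w" "B \<le> w"
    and ZR: "distinct (Zs @ Rs)" "set Zs \<union> set Rs = set Y"
    and sqs': "\<And>sq. sq \<in> set sqs \<Longrightarrow> distinct sq" "\<And>sq. sq \<in> set sqs \<Longrightarrow> set sq \<subseteq> set Y"
    and few: "\<And>y. y \<in> set Y \<Longrightarrow> length (filter (\<lambda>sq. y \<in> set sq) sqs) \<le> 4"
begin

abbreviation "C \<equiv> insert d (set P \<union> set Q \<union> set S \<union> set Y)"

lemma sqs:
  assumes "sq \<in> set sqs"
  shows "distinct (sq @ rest sq)" "set sq \<union> set (rest sq) = set Y"
  using sqs'[OF assms] dist by (auto simp: rest_def)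

lemma length_profile: "length profile = 2 * s + 23"
  by (simp add: profile_def)

lemma disj:
  "distinct P" "distinct Q" "distinct S" "distinct Y"
  "d \<notin> set P" "d \<notin> set Q" "d \<notin> set S" "d \<notin> set Y"
  "set P \<inter> set Q = {}" "set P \<inter> set S = {}" "set P \<inter> set Y = {}"
  "set Q \<inter> set S = {}" "set Q \<inter> set Y = {}" "set S \<inter> set Y = {}"
  using dist unfolding distinct.simps distinct_append set_append by blast+

lemma ok_vA:
  assumes "sq \<in> set sqs"
  shows "distinct (fst (vA sq) @ d # snd (vA sq)) \<and> set (fst (vA sq) @ d # snd (vA sq)) = C"
  using sqs[OF assms] disj unfolding vA_def distinct_append distinct.simps set_append fst_conv snd_conv
    append_Nil list.set
  by blast

lemma ok_others:
  assumes "x \<in> {vF, vU, vD, vE, vL}"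
  shows "distinct (fst x @ d # snd x) \<and> set (fst x @ d # snd x) = C"
proof -
  have Z: "distinct Zs" "distinct Rs" "set Zs \<inter> set Rs = {}" "set Y = set Zs \<union> set Rs"
    using ZR by auto
  consider "x = vF" | "x = vU" | "x = vD" | "x = vE" | "x = vL" using assms by blast
  then show ?thesis
  proof cases
    case 2
    have "set P \<inter> set Zs = {}" "set Q \<inter> set Zs = {}" "set S \<inter> set Zs = {}"
      "set P \<inter> set Rs = {}" "set Q \<inter> set Rs = {}" "set S \<inter> set Rs = {}"
      "d \<notin> set Zs" "d \<notin> set Rs"
      using disj(8,11,13,14) unfolding Z(4) by blast+
    with disj(1-7,9,10,12) Z(1-3) show ?thesis
      unfolding 2 vU_def Z(4) distinct_append distinct.simps set_append fst_conv snd_conv list.set Int_Un_distrib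
        Int_Un_distrib2 Int_insert_right Int_insert_left Un_iff
      by (simp add: Int_commute Un_ac)
  qed (use disj in \<open>simp_all add: v_defs Int_Un_distrib Int_Un_distrib2 Int_commute Un_ac\<close>)
qed

lemma profile_ok:
  assumes "x \<in> set profile"
  shows "distinct (fst x @ d # snd x) \<and> set (fst x @ d # snd x) = C"
proof -
  from assms have "(\<exists>sq\<in>set sqs. x = vA sq) \<or> x \<in> {vF, vU, vD, vE, vL}"
    unfolding profile_def by (auto split: if_splits)
  then show ?thesis using ok_vA ok_others by blast
qed

end

section \<open>The majority relation after an affordable bribery\<close>

locale shifted_election = bribery_election +
  fixes t :: "nat \<Rightarrow> nat"
  assumes t: "\<And>i. i < length profile \<Longrightarrow> t i \<le> B"
begin

text \<open>Shift amounts are indexed by the voters of the whole profile; for a group of voters,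
  \<open>off\<close> is the index of its first member.\<close>

definition sh where "sh off xs = map (\<lambda>i. ins d (t (off + i)) (xs ! i)) [0..<length xs]"

abbreviation "V \<equiv> sh 0 profile"

lemma sh_append: "sh off (xs @ ys) = sh off xs @ sh (off + length xs) ys"
  unfolding sh_def by (rule nth_equalityI) (auto simp: nth_append add.assoc)

lemma length_sh [simp]: "length (sh off xs) = length xs"
  by (simp add: sh_def)

lemma V_eq:
  "V = sh 0 (map vA sqs) @ sh s (replicate (s + 6) vF) @ sh (2 * s + 6) (replicate 1 vU) @
     sh (2 * s + 7) (replicate 5 vD) @ sh (2 * s + 12) (replicate 6 vE) @ sh (2 * s + 18) (replicate 5 vL)"
proof -
  have "0 + length (map vA sqs) = s" "s + length (replicate (s + 6) vF) = 2 * s + 6"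
    "2 * s + 6 + length (replicate 1 vU) = 2 * s + 7" "2 * s + 7 + length (replicate 5 vD) = 2 * s + 12"
    "2 * s + 12 + length (replicate 6 vE) = 2 * s + 18"
    by simp_all
  note offsets = this
  show ?thesis unfolding profile_def sh_append offsets by (rule refl)
qed

lemma cnt_V: "cnt V a b = cnt (sh 0 (map vA sqs)) a b + cnt (sh s (replicate (s + 6) vF)) a b +
   cnt (sh (2 * s + 6) (replicate 1 vU)) a b + cnt (sh (2 * s + 7) (replicate 5 vD)) a b +
   cnt (sh (2 * s + 12) (replicate 6 vE)) a b + cnt (sh (2 * s + 18) (replicate 5 vL)) a b"
  unfolding V_eq cnt_append by (simp only: add.assoc)

lemma cnt_replicate:
  assumes "\<And>\<tau>. \<tau> \<le> B \<Longrightarrow> pos (ins d \<tau> x) a < pos (ins d \<tau> x) b" "off + n \<le> 2 * s + 23"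
  shows "cnt (sh off (replicate n x)) a b = n"
proof -
  have "cnt (sh off (replicate n x)) a b = length (sh off (replicate n x))"
    by (rule cnt_all) (use assms t in \<open>auto simp: sh_def length_profile\<close>)
  then show ?thesis by simp
qed

lemma cnt_vA:
  assumes "\<And>\<tau> sq. \<tau> \<le> B \<Longrightarrow> sq \<in> set sqs \<Longrightarrow> pos (ins d \<tau> (vA sq)) a < pos (ins d \<tau> (vA sq)) b"
  shows "cnt (sh 0 (map vA sqs)) a b = s"
proof -
  have "cnt (sh 0 (map vA sqs)) a b = length (sh 0 (map vA sqs))"
    by (rule cnt_all) (use assms t in \<open>auto simp: sh_def length_profile\<close>)
  then show ?thesis by simp
qed

lemma V_ok: "v \<in> set V \<Longrightarrow> distinct v \<and> set v = C"
proof -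
  assume "v \<in> set V"
  then obtain i where "i < length profile" and v: "v = ins d (t i) (profile ! i)"
    by (auto simp: sh_def)
  then have i: "profile ! i \<in> set profile" by simp
  from profile_ok[OF i] show ?thesis unfolding v distinct_ins set_ins by auto
qed

text \<open>A strict majority of the \<open>2 * s + 23\<close> votes.\<close>

definition beats where "beats a b \<longleftrightarrow> s + 12 \<le> cnt V a b"

lemma cnt_V_add: "a \<in> C \<Longrightarrow> b \<in> C \<Longrightarrow> a \<noteq> b \<Longrightarrow> cnt V a b + cnt V b a = 2 * s + 23"
  using cnt_add[of V a b] V_ok by (simp add: length_profile)

lemma beats_iff: "a \<in> C \<Longrightarrow> b \<in> C \<Longrightarrow> a \<noteq> b \<Longrightarrow> beats a b \<longleftrightarrow> cnt V b a < cnt V a b"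
  using cnt_V_add[of a b] by (auto simp: beats_def)

lemma beats_antisym: "a \<in> C \<Longrightarrow> b \<in> C \<Longrightarrow> a \<noteq> b \<Longrightarrow> beats a b \<longleftrightarrow> \<not> beats b a"
  using cnt_V_add[of a b] by (auto simp: beats_def)

lemma copeland_score_eq:
  assumes "c \<in> C"
  shows "copeland_score \<alpha> (C, V) c = of_nat (card {c' \<in> C - {c}. beats c c'})"
proof -
  have 1: "{c' \<in> C - {c}. num_prefer (C, V) c c' > num_prefer (C, V) c' c} = {c' \<in> C - {c}. beats c c'}"
    using assms beats_iff[of c] by (auto simp: num_prefer_eq_cnt)
  have 2: "{c' \<in> C - {c}. num_prefer (C, V) c c' = num_prefer (C, V) c' c} = {}"
  proof -
    have "cnt V c c' \<noteq> cnt V c' c" if "c' \<in> C - {c}" for c'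
    proof
      assume "cnt V c c' = cnt V c' c"
      with cnt_V_add[of c c'] that assms have "2 * cnt V c c' = 2 * s + 23" by auto
      then show False by presburger
    qed
    then show ?thesis by (auto simp: num_prefer_eq_cnt)
  qed
  show ?thesis unfolding copeland_score_def fst_conv 1 2 by simp
qed

lemma cnt_replicate_other:
  assumes "x \<in> {vF, vU, vD, vE, vL}" "off + n \<le> 2 * s + 23"
    "fst x @ snd x = us @ ws" "a \<in> set us" "b \<in> set ws"
  shows "cnt (sh off (replicate n x)) a b = n"
  by (rule cnt_replicate[OF ins_other[OF _ assms(3-5)] assms(2)]) (use ok_others[OF assms(1)] in blast)

lemma cnt_replicate_unreached:
  assumes "x \<in> {vF, vU, vD, vE, vL}" "off + n \<le> 2 * s + 23"
    "snd x = us @ ws" "B \<le> length us" "a \<in> set ws"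
  shows "cnt (sh off (replicate n x)) d a = n"
  by (rule cnt_replicate[OF ins_unreached[OF _ assms(3) _ assms(5)] assms(2)])
     (use ok_others[OF assms(1)] assms(4) in auto)

lemma cnt_replicate_before:
  assumes "x \<in> {vF, vU, vD, vE, vL}" "off + n \<le> 2 * s + 23" "a \<in> set (fst x)"
  shows "cnt (sh off (replicate n x)) a d = n"
  by (rule cnt_replicate[OF ins_before_d assms(2)]) (use ok_others[OF assms(1)] assms(3) in auto)

lemma cnt_vA_other:
  assumes "\<And>sq. sq @ P @ Q @ S @ rest sq = us sq @ ws sq" "\<And>sq. a \<in> set (us sq)" "\<And>sq. b \<in> set (ws sq)"
  shows "cnt (sh 0 (map vA sqs)) a b = s"
  by (rule cnt_vA, rule ins_other[OF _ _ assms(2,3)]) (use ok_vA assms(1) in \<open>auto simp: vA_def\<close>)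

lemma cnt_vA_unreached:
  assumes "\<And>sq. sq @ P @ Q @ S @ rest sq = us sq @ ws sq" "\<And>sq. B \<le> length (us sq)" "\<And>sq. a \<in> set (ws sq)"
  shows "cnt (sh 0 (map vA sqs)) d a = s"
proof (rule cnt_vA)
  fix \<tau> sq assume "\<tau> \<le> B" "sq \<in> set sqs"
  with ok_vA[of sq] assms(1)[of sq] assms(2)[of sq] assms(3)[of sq]
  show "pos (ins d \<tau> (vA sq)) d < pos (ins d \<tau> (vA sq)) a"
    by (intro ins_unreached[of _ _ "us sq" "ws sq"]) (auto simp: vA_def)
qed

lemma cnt_sh_vA: "cnt (sh 0 (map vA sqs)) a b =
    card {i. i < s \<and> pos (ins d (t i) (vA (sqs ! i))) a < pos (ins d (t i) (vA (sqs ! i))) b}"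
  unfolding cnt_def length_filter_conv_card by (rule arg_cong[of _ _ card]) (auto simp: sh_def)

text \<open>The three lists form a Condorcet cycle, as every vote orders them by a rotation of P, Q,
  S: only \<open>vF\<close> puts Q before P, only \<open>vE\<close> puts S before Q, and these two
  groups together have \<open>s + 12\<close> members, exactly the majority by which S beats
  P.\<close>

lemma beats_PQ:
  assumes "p \<in> set P" "q \<in> set Q"
  shows "beats p q"
proof -
  have "cnt (sh 0 (map vA sqs)) p q = s"
    by (rule cnt_vA_other[of "\<lambda>sq. sq @ P" "\<lambda>sq. Q @ S @ rest sq"]) (use assms in auto)
  moreover have "cnt (sh (2 * s + 6) (replicate 1 vU)) p q = 1"
    by (rule cnt_replicate_other[of _ _ _ "Zs @ P" "Q @ S @ Rs"]) (use assms in \<open>auto simp: vU_def\<close>)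
  moreover have "cnt (sh (2 * s + 7) (replicate 5 vD)) p q = 5"
    by (rule cnt_replicate_other[of _ _ _ P "Q @ S @ Y"]) (use assms in \<open>auto simp: vD_def\<close>)
  moreover have "cnt (sh (2 * s + 12) (replicate 6 vE)) p q = 6"
    by (rule cnt_replicate_other[of _ _ _ "S @ P" "Q @ Y"]) (use assms in \<open>auto simp: vE_def\<close>)
  ultimately show ?thesis unfolding beats_def cnt_V by linarith
qed

lemma beats_QS:
  assumes "p \<in> set Q" "q \<in> set S"
  shows "beats p q"
proof -
  have "cnt (sh 0 (map vA sqs)) p q = s"
    by (rule cnt_vA_other[of "\<lambda>sq. sq @ P @ Q" "\<lambda>sq. S @ rest sq"]) (use assms in auto)
  moreover have "cnt (sh s (replicate (s + 6) vF)) p q = s + 6"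
    by (rule cnt_replicate_other[of _ _ _ "Y @ Q" "S @ P"]) (use assms in \<open>auto simp: vF_def\<close>)
  moreover have "cnt (sh (2 * s + 6) (replicate 1 vU)) p q = 1"
    by (rule cnt_replicate_other[of _ _ _ "Zs @ P @ Q" "S @ Rs"]) (use assms in \<open>auto simp: vU_def\<close>)
  moreover have "cnt (sh (2 * s + 7) (replicate 5 vD)) p q = 5"
    by (rule cnt_replicate_other[of _ _ _ "P @ Q" "S @ Y"]) (use assms in \<open>auto simp: vD_def\<close>)
  ultimately show ?thesis unfolding beats_def cnt_V by linarith
qed

lemma beats_SP:
  assumes "p \<in> set S" "q \<in> set P"
  shows "beats p q"
proof -
  have "cnt (sh s (replicate (s + 6) vF)) p q = s + 6"
    by (rule cnt_replicate_other[of _ _ _ "Y @ Q @ S" "P"]) (use assms in \<open>auto simp: vF_def\<close>)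
  moreover have "cnt (sh (2 * s + 12) (replicate 6 vE)) p q = 6"
    by (rule cnt_replicate_other[of _ _ _ "S" "P @ Q @ Y"]) (use assms in \<open>auto simp: vE_def\<close>)
  ultimately show ?thesis unfolding beats_def cnt_V by linarith
qed

text \<open>All votes agree on the order inside \<open>P\<close>; this gives its first guard the
  \<open>w - 1\<close> victories that are required in \<open>score_top\<close>.\<close>

lemma beats_top:
  assumes "P = p # P'" "q \<in> set P'"
  shows "beats p q"
proof -
  have P: "P @ xs = [p] @ P' @ xs" for xs using assms(1) by simp
  have "cnt (sh 0 (map vA sqs)) p q = s"
    by (rule cnt_vA_other[of "\<lambda>sq. sq @ [p]" "\<lambda>sq. P' @ Q @ S @ rest sq"]) (use assms(2) in \<open>simp_all add: P\<close>)
  moreover have "cnt (sh (2 * s + 6) (replicate 1 vU)) p q = 1"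
    by (rule cnt_replicate_other[of _ _ _ "Zs @ [p]" "P' @ Q @ S @ Rs"]) (use assms(2) in \<open>simp_all add: vU_def P\<close>)
  moreover have "cnt (sh (2 * s + 7) (replicate 5 vD)) p q = 5"
    by (rule cnt_replicate_other[of _ _ _ "[p]" "P' @ Q @ S @ Y"]) (use assms(2) in \<open>simp_all add: vD_def P\<close>)
  moreover have "cnt (sh (2 * s + 12) (replicate 6 vE)) p q = 6"
    by (rule cnt_replicate_other[of _ _ _ "S @ [p]" "P' @ Q @ Y"]) (use assms(2) in \<open>simp_all add: vE_def P\<close>)
  ultimately show ?thesis unfolding beats_def cnt_V by linarith
qed

text \<open>A challenger can precede guards only in \<open>vF\<close>, in \<open>vU\<close>, and in
  the at most four \<open>vA\<close> whose list contains it. The other \<open>s - 4\<close> of the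
  \<open>vA\<close> and the 16 voters \<open>vD\<close>, \<open>vE\<close>, \<open>vL\<close> make
  up exactly \<open>s + 12\<close>.\<close>

lemma beats_Y:
  assumes "p \<in> set P \<union> set Q \<union> set S" "y \<in> set Y"
  shows "beats p y"
proof -
  have "s = card {i. i < s \<and> y \<in> set (sqs ! i)} + card {i. i < s \<and> y \<notin> set (sqs ! i)}"
  proof -
    have "{..<s} = {i. i < s \<and> y \<in> set (sqs ! i)} \<union> {i. i < s \<and> y \<notin> set (sqs ! i)}" by auto
    then have "card {..<s} = card {i. i < s \<and> y \<in> set (sqs ! i)} + card {i. i < s \<and> y \<notin> set (sqs ! i)}"
      by (simp only:) (rule card_Un_disjoint; auto)
    then show ?thesis by simp
  qed
  moreover have "card {i. i < s \<and> y \<in> set (sqs ! i)} \<le> 4"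
    using few[OF assms(2)] by (simp add: length_filter_conv_card)
  moreover have "card {i. i < s \<and> y \<notin> set (sqs ! i)} \<le> cnt (sh 0 (map vA sqs)) p y"
    unfolding cnt_sh_vA
  proof (rule card_mono[OF _ Collect_mono]; (intro impI conjI)?)
    fix i assume "i < s \<and> y \<notin> set (sqs ! i)"
    then have i: "i < s" "y \<notin> set (sqs ! i)" by auto
    then show "i < s" by simp
    then have sq: "sqs ! i \<in> set sqs" by simp
    show "pos (ins d (t i) (vA (sqs ! i))) p < pos (ins d (t i) (vA (sqs ! i))) y"
      by (rule ins_other[of _ _ "sqs ! i @ P @ Q @ S" "rest (sqs ! i)"])
        (use ok_vA[OF sq] sqs(2)[OF sq] i(2) assms in \<open>auto simp: vA_def\<close>)
  qed simp
  moreover have "cnt (sh (2 * s + 7) (replicate 5 vD)) p y = 5"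
    by (rule cnt_replicate_other[of _ _ _ "P @ Q @ S" Y]) (use assms in \<open>auto simp: vD_def\<close>)
  moreover have "cnt (sh (2 * s + 12) (replicate 6 vE)) p y = 6"
    by (rule cnt_replicate_other[of _ _ _ "S @ P @ Q" Y]) (use assms in \<open>auto simp: vE_def\<close>)
  moreover have "cnt (sh (2 * s + 18) (replicate 5 vL)) p y = 5"
    by (rule cnt_replicate_other[of _ _ _ "P @ Q @ S" Y]) (use assms in \<open>auto simp: vL_def\<close>)
  ultimately show ?thesis unfolding beats_def cnt_V by linarith
qed

text \<open>In \<open>vF\<close> and in \<open>vE\<close> the list S stands between \<open>d\<close>
  and P, so P is out of reach there, and these are \<open>s + 12\<close> votes. In the next two
  lemmas the barrier is P or S for the guards in Q, and P or Q for those in S.\<close>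

lemma d_beats_P:
  assumes "p \<in> set P"
  shows "beats d p"
proof -
  have "cnt (sh s (replicate (s + 6) vF)) d p = s + 6"
    by (rule cnt_replicate_unreached[of _ _ _ "Q @ S" P]) (use assms len b in \<open>auto simp: vF_def\<close>)
  moreover have "cnt (sh (2 * s + 12) (replicate 6 vE)) d p = 6"
    by (rule cnt_replicate_unreached[of _ _ _ S "P @ Q @ Y"]) (use assms len b in \<open>auto simp: vE_def\<close>)
  ultimately show ?thesis unfolding beats_def cnt_V by linarith
qed

lemma d_beats_Q:
  assumes "p \<in> set Q"
  shows "beats d p"
proof -
  have "cnt (sh 0 (map vA sqs)) d p = s"
    by (rule cnt_vA_unreached[of "\<lambda>sq. sq @ P" "\<lambda>sq. Q @ S @ rest sq"]) (use assms len b in auto)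
  moreover have "cnt (sh (2 * s + 6) (replicate 1 vU)) d p = 1"
    by (rule cnt_replicate_unreached[of _ _ _ P "Q @ S @ Rs"]) (use assms len b in \<open>auto simp: vU_def\<close>)
  moreover have "cnt (sh (2 * s + 7) (replicate 5 vD)) d p = 5"
    by (rule cnt_replicate_unreached[of _ _ _ P "Q @ S @ Y"]) (use assms len b in \<open>auto simp: vD_def\<close>)
  moreover have "cnt (sh (2 * s + 12) (replicate 6 vE)) d p = 6"
    by (rule cnt_replicate_unreached[of _ _ _ "S @ P" "Q @ Y"]) (use assms len b in \<open>auto simp: vE_def\<close>)
  ultimately show ?thesis unfolding beats_def cnt_V by linarith
qed

lemma d_beats_S:
  assumes "p \<in> set S"
  shows "beats d p"
proof -
  have "cnt (sh 0 (map vA sqs)) d p = s"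
    by (rule cnt_vA_unreached[of "\<lambda>sq. sq @ P @ Q" "\<lambda>sq. S @ rest sq"]) (use assms len b in auto)
  moreover have "cnt (sh s (replicate (s + 6) vF)) d p = s + 6"
    by (rule cnt_replicate_unreached[of _ _ _ Q "S @ P"]) (use assms len b in \<open>auto simp: vF_def\<close>)
  moreover have "cnt (sh (2 * s + 6) (replicate 1 vU)) d p = 1"
    by (rule cnt_replicate_unreached[of _ _ _ "P @ Q" "S @ Rs"]) (use assms len b in \<open>auto simp: vU_def\<close>)
  moreover have "cnt (sh (2 * s + 7) (replicate 5 vD)) d p = 5"
    by (rule cnt_replicate_unreached[of _ _ _ "P @ Q" "S @ Y"]) (use assms len b in \<open>auto simp: vD_def\<close>)
  ultimately show ?thesis unfolding beats_def cnt_V by linarith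
qed

lemma Z_beats_d:
  assumes "y \<in> set Zs"
  shows "beats y d"
proof -
  have y: "y \<in> set Y" using assms ZR by auto
  have "cnt (sh s (replicate (s + 6) vF)) y d = s + 6"
    by (rule cnt_replicate_before) (use y in \<open>auto simp: vF_def\<close>)
  moreover have "cnt (sh (2 * s + 6) (replicate 1 vU)) y d = 1"
    by (rule cnt_replicate_before) (use assms in \<open>auto simp: vU_def\<close>)
  moreover have "cnt (sh (2 * s + 18) (replicate 5 vL)) y d = 5"
    by (rule cnt_replicate_before) (use y in \<open>auto simp: vL_def\<close>)
  ultimately show ?thesis unfolding beats_def cnt_V by linarith
qed

lemma R_beats_d:
  assumes "y \<in> set Rs" "i < s" "y \<in> set (take (t i) (sqs ! i))"
  shows "beats y d"
proof -
  have y: "y \<in> set Y" using assms ZR by auto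
  have sq: "sqs ! i \<in> set sqs" using assms by simp
  have "cnt (sh s (replicate (s + 6) vF)) y d = s + 6"
    by (rule cnt_replicate_before) (use y in \<open>auto simp: vF_def\<close>)
  moreover have "cnt (sh (2 * s + 18) (replicate 5 vL)) y d = 5"
    by (rule cnt_replicate_before) (use y in \<open>auto simp: vL_def\<close>)
  \<comment> \<open>Voter \<open>i\<close> alone supplies the vote that \<open>vF\<close> and
    \<open>vL\<close>, with \<open>s + 11\<close> members, leave missing.\<close>
  moreover have "card {i} \<le> cnt (sh 0 (map vA sqs)) y d"
    unfolding cnt_sh_vA
    by (rule card_mono; simp; intro conjI ins_before_d)
      (use ok_vA[OF sq] assms in \<open>auto simp: vA_def\<close>)
  ultimately show ?thesis unfolding beats_def cnt_V by simp
qed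

lemma d_beats_R:
  assumes "y \<in> set Rs" "\<And>i. i < s \<Longrightarrow> y \<notin> set (take (t i) (sqs ! i))"
  shows "beats d y"
proof -
  have y: "y \<in> set Y" using assms ZR by auto
  have "{i. i < s \<and> pos (ins d (t i) (vA (sqs ! i))) d < pos (ins d (t i) (vA (sqs ! i))) y} = {i. i < s}"
  proof (rule Collect_cong, rule iffI, erule conjunct1, rule conjI)
    fix i assume i: "i < s"
    then have sq: "sqs ! i \<in> set sqs" by simp
    have ti: "t i \<le> B" using t[of i] i by (simp add: length_profile)
    have "y \<in> set (sqs ! i @ rest (sqs ! i))" using sqs(2)[OF sq] y by simp
    then have "y \<in> set (drop (t i) (snd (vA (sqs ! i))))"
    proof -
      have "y \<in> set (drop (t i) (sqs ! i))" if "y \<in> set (sqs ! i)"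
        using that assms(2)[of i] i set_append[of "take (t i) (sqs ! i)" "drop (t i) (sqs ! i)"] by simp
      \<comment> \<open>A shift may run past the end of \<open>sqs ! i\<close>, but not through the
        \<open>3 * w\<close> guards behind it, so it never enters \<open>rest\<close>.\<close>
      moreover have "t i - length (sqs ! i) - w - w - w = 0" using ti b by simp
      ultimately show ?thesis using \<open>y \<in> set (sqs ! i @ rest (sqs ! i))\<close> by (auto simp: vA_def len)
    qed
    with ok_vA[OF sq] show "pos (ins d (t i) (vA (sqs ! i))) d < pos (ins d (t i) (vA (sqs ! i))) y"
      by (intro ins_after_d) auto
  qed
  then have "cnt (sh 0 (map vA sqs)) d y = s" unfolding cnt_sh_vA by simp
  moreover have "cnt (sh (2 * s + 6) (replicate 1 vU)) d y = 1"
    by (rule cnt_replicate_unreached[of _ _ _ "P @ Q @ S" Rs]) (use assms len b in \<open>auto simp: vU_def\<close>)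
  moreover have "cnt (sh (2 * s + 7) (replicate 5 vD)) d y = 5"
    by (rule cnt_replicate_unreached[of _ _ _ "P @ Q @ S" Y]) (use y len b in \<open>auto simp: vD_def\<close>)
  moreover have "cnt (sh (2 * s + 12) (replicate 6 vE)) d y = 6"
    by (rule cnt_replicate_unreached[of _ _ _ "S @ P @ Q" Y]) (use y len b in \<open>auto simp: vE_def\<close>)
  ultimately show ?thesis unfolding beats_def cnt_V by linarith
qed

section \<open>Copeland scores\<close>

abbreviation "score c \<equiv> card {c' \<in> C - {c}. beats c c'}"

lemma cards: "card (set P) = w" "card (set Q) = w" "card (set S) = w" "card (set Y) = w + 1"
  using disj len by (simp_all add: distinct_card)

lemma card_C: "card C = 4 * w + 2"
  using distinct_card[OF dist] len by (simp add: Un_assoc)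

lemma score_le_card_diff:
  assumes "D \<subseteq> C" "\<And>x. x \<in> D \<Longrightarrow> x = c \<or> \<not> beats c x"
  shows "score c \<le> 4 * w + 2 - card D"
proof -
  have "score c \<le> card (C - D)" by (rule card_mono) (use assms(2) in auto)
  also have "\<dots> = card C - card D" by (rule card_Diff_subset) (use assms(1) finite_subset in auto)
  finally show ?thesis using card_C by simp
qed

text \<open>The victories are \<open>w - 1\<close> inside P, \<open>w\<close> over Q and
  \<open>w + 1\<close> over the challengers. The surplus challenger makes up for the guard
  itself.\<close>

lemma score_top:
  assumes "P = p # P'"
  shows "3 * w \<le> score p"
proof -
  have "card (set P' \<union> set Q \<union> set Y) \<le> score p"
    by (rule card_mono) (use assms disj beats_top[OF assms] beats_PQ beats_Y in auto)
  moreover have "card (set P' \<union> set Q \<union> set Y) = card (set P') + card (set Q) + card (set Y)"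
    by (subst card_Un_disjoint; (subst card_Un_disjoint)?) (use assms disj in auto)
  moreover have "card (set P') + 1 = w" using assms cards(1) disj(1) by simp
  ultimately show ?thesis using cards by simp
qed

text \<open>Of the \<open>4 * w + 2\<close> candidates a guard fails to beat itself,
  \<open>d\<close> and the \<open>w\<close> guards of the preceding list in the cycle. A challenger
  loses already to all of P and Q, so passing it by \<open>d\<close> cannot make it
  dangerous.\<close>

lemma score_others:
  assumes "c \<in> C" "c \<noteq> d"
  shows "score c \<le> 3 * w"
proof -
  note anti = beats_antisym[of c]
  consider "c \<in> set P" | "c \<in> set Q" | "c \<in> set S" | "c \<in> set Y" using assms by blast
  then show ?thesis
  proof cases
    case 1
    have "score c \<le> 4 * w + 2 - card (insert c (insert d (set S)))"
      by (rule score_le_card_diff) (use 1 disj anti beats_SP d_beats_P assms in auto)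
    moreover have "card (insert c (insert d (set S))) = w + 2"
      using 1 disj cards by (subst card_insert_disjoint; auto)
    ultimately show ?thesis by simp
  next
    case 2
    have "score c \<le> 4 * w + 2 - card (insert c (insert d (set P)))"
      by (rule score_le_card_diff) (use 2 disj anti beats_PQ d_beats_Q assms in auto)
    moreover have "card (insert c (insert d (set P))) = w + 2"
      using 2 disj cards by (subst card_insert_disjoint; auto)
    ultimately show ?thesis by simp
  next
    case 3
    have "score c \<le> 4 * w + 2 - card (insert c (insert d (set Q)))"
      by (rule score_le_card_diff) (use 3 disj anti beats_QS d_beats_S assms in auto)
    moreover have "card (insert c (insert d (set Q))) = w + 2"
      using 3 disj cards by (subst card_insert_disjoint; auto)
    ultimately show ?thesis by simp
  next
    case 4
    have "score c \<le> 4 * w + 2 - card (insert c (set P \<union> set Q))"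
      by (rule score_le_card_diff) (use 4 disj anti beats_Y assms in auto)
    moreover have "card (insert c (set P \<union> set Q)) = 2 * w + 1"
    proof -
      have "card (set P \<union> set Q) = 2 * w" using card_Un_disjoint[of "set P" "set Q"] disj cards by simp
      moreover have "c \<notin> set P \<union> set Q" using 4 disj by auto
      ultimately show ?thesis by simp
    qed
    \<comment> \<open>A challenger has at most \<open>2 * w + 1\<close> victories; here
      \<open>1 \<le> w\<close> enters.\<close>
    ultimately show ?thesis using b by simp
  qed
qed

lemma score_d: "score d = 3 * w + card {y \<in> set Y. beats d y}"
proof -
  have "{c' \<in> C - {d}. beats d c'} = (set P \<union> set Q \<union> set S) \<union> {y \<in> set Y. beats d y}"
    using disj d_beats_P d_beats_Q d_beats_S by auto
  moreover have "card ((set P \<union> set Q \<union> set S) \<union> {y \<in> set Y. beats d y}) =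
      card (set P \<union> set Q \<union> set S) + card {y \<in> set Y. beats d y}"
    by (rule card_Un_disjoint) (use disj in auto)
  moreover have "card (set P \<union> set Q \<union> set S) = 3 * w"
    by (subst card_Un_disjoint; (subst card_Un_disjoint)?) (use disj cards in auto)
  ultimately show ?thesis by simp
qed

lemma winner_iff:
  "copeland \<alpha> (C, V) \<noteq> {d} \<longleftrightarrow> (\<forall>y\<in>set Rs. \<exists>i<s. y \<in> set (take (t i) (sqs ! i)))"
proof
  assume R: "\<forall>y\<in>set Rs. \<exists>i<s. y \<in> set (take (t i) (sqs ! i))"
  have "beats y d" if "y \<in> set Y" for y
    using that ZR Z_beats_d[of y] R R_beats_d[of y] by blast
  then have "{y \<in> set Y. beats d y} = {}" using beats_antisym[of _ d] disj by auto
  then have d: "score d = 3 * w" using score_d by simp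
  \<comment> \<open>The first guard of P is the winner that keeps \<open>d\<close> from being the
    only one: both have the score \<open>3 * w\<close>.\<close>
  obtain p P' where p: "P = p # P'" using b len(1) by (cases P) auto
  have "copeland_score \<alpha> (C, V) c \<le> copeland_score \<alpha> (C, V) p" if "c \<in> C" for c
  proof -
    have "score c \<le> score p"
      using score_others[OF that] d score_top[OF p] by (cases "c = d") auto
    then show ?thesis using copeland_score_eq[OF that] copeland_score_eq[of p] p by simp
  qed
  then have "p \<in> copeland \<alpha> (C, V)" using p by (auto simp: copeland_def)
  moreover have "p \<noteq> d" using p disj by auto
  ultimately show "copeland \<alpha> (C, V) \<noteq> {d}" by blast
next
  assume neq: "copeland \<alpha> (C, V) \<noteq> {d}"
  show "\<forall>y\<in>set Rs. \<exists>i<s. y \<in> set (take (t i) (sqs ! i))"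
  proof (rule ccontr)
    assume "\<not> ?thesis"
    then obtain y where y: "y \<in> set Rs" "\<And>i. i < s \<Longrightarrow> y \<notin> set (take (t i) (sqs ! i))" by auto
    then have "y \<in> {y \<in> set Y. beats d y}" using d_beats_R ZR by auto
    then have "0 < card {y \<in> set Y. beats d y}" by (auto simp: card_gt_0_iff)
    then have d: "3 * w < score d" using score_d by simp
    have less: "copeland_score \<alpha> (C, V) c < copeland_score \<alpha> (C, V) d" if "c \<in> C" "c \<noteq> d" for c
      using score_others[OF that] d copeland_score_eq[OF that(1)] copeland_score_eq[of d] by simp
    have "copeland \<alpha> (C, V) = {d}"
    proof safe
      show "c = d" if "c \<in> copeland \<alpha> (C, V)" for c
        using that less[of c] by (force simp: copeland_def)
      show "d \<in> copeland \<alpha> (C, V)"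
        using less by (force simp: copeland_def)
    qed
    with neq show False by simp
  qed
qed

end

section \<open>From shift amounts to unit prices\<close>

definition unit_price :: "'c list \<times> 'c list \<Rightarrow> nat \<Rightarrow> enat" where
  "unit_price x \<tau> = (if \<tau> \<le> length (snd x) then enat \<tau> else \<infinity>)"

lemma sum_enat: "(\<Sum>i<N. enat (t i)) = enat (\<Sum>i<N. t i)" for N :: nat
  by (induction N) (auto simp: zero_enat_def)

lemma sum_unit_price_le:
  fixes N :: nat
  assumes "(\<Sum>i<N. unit_price (f i) (t i)) \<le> enat B"
  shows "(\<Sum>i<N. t i) \<le> B"
proof -
  have fin: "t i \<le> length (snd (f i))" if "i < N" for i
  proof (rule ccontr)
    assume "\<not> ?thesis"
    then have inf: "unit_price (f i) (t i) = \<infinity>" by (simp add: unit_price_def)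
    have "unit_price (f i) (t i) \<le> (\<Sum>i<N. unit_price (f i) (t i))"
      using that by (intro member_le_sum) auto
    with inf assms show False by simp
  qed
  then have "(\<Sum>i<N. unit_price (f i) (t i)) = (\<Sum>i<N. enat (t i))"
    by (intro sum.cong) (auto simp: unit_price_def)
  then show ?thesis using assms sum_enat by simp
qed

lemma (in bribery_election) bribery_iff:
  fixes \<alpha> :: rat
  shows "(\<exists>t. (\<Sum>i<length profile. unit_price (profile ! i) (t i)) \<le> enat B \<and>
     copeland \<alpha> (C, map (\<lambda>i. shift_back d (t i) (fst (profile ! i) @ d # snd (profile ! i)))
        [0..<length profile]) \<noteq> {d}) \<longleftrightarrow>
   (\<exists>t. (\<Sum>i<s. t i) \<le> B \<and> (\<forall>y\<in>set Rs. \<exists>i<s. y \<in> set (take (t i) (sqs ! i))))"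
    (is "(\<exists>t. ?cost t \<and> copeland \<alpha> (C, ?V t) \<noteq> {d}) \<longleftrightarrow> ?R")
proof -
  have V: "copeland \<alpha> (C, ?V t) \<noteq> {d} \<longleftrightarrow> (\<forall>y\<in>set Rs. \<exists>i<s. y \<in> set (take (t i) (sqs ! i)))"
    if "(\<Sum>i<length profile. t i) \<le> B" for t
  proof -
    have "t i \<le> B" if "i < length profile" for i
      using member_le_sum[of i "{..<length profile}" t] that \<open>(\<Sum>i<length profile. t i) \<le> B\<close> by simp
    then interpret shifted_election d P Q S Y Zs Rs sqs w B t by unfold_locales
    have "shift_back d (t i) (fst (profile ! i) @ d # snd (profile ! i)) = ins d (t i) (profile ! i)"
      if "i < length profile" for i
      using shift_back_middle[of "fst (profile ! i)" d "snd (profile ! i)"] profile_ok[of "profile ! i"] that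
      by (simp add: ins_def)
    then have "?V t = sh 0 profile" by (simp add: sh_def)
    then show ?thesis using winner_iff by simp
  qed
  have s_le: "s \<le> length profile" by (simp add: length_profile)
  show ?thesis
  proof
    assume "\<exists>t. ?cost t \<and> copeland \<alpha> (C, ?V t) \<noteq> {d}"
    then obtain t where t: "?cost t" "copeland \<alpha> (C, ?V t) \<noteq> {d}" by blast
    have sum: "(\<Sum>i<length profile. t i) \<le> B" by (rule sum_unit_price_le[OF t(1)])
    have "(\<Sum>i<s. t i) \<le> (\<Sum>i<length profile. t i)"
      using s_le by (intro sum_mono2) auto
    with sum t(2) V[OF sum] show ?R by (intro exI[of _ t]) simp
  next
    assume ?R
    then obtain t where t: "(\<Sum>i<s. t i) \<le> B" "\<forall>y\<in>set Rs. \<exists>i<s. y \<in> set (take (t i) (sqs ! i))"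
      by blast
    \<comment> \<open>Moving beyond the end of \<open>sqs ! i\<close> passes none of its members, so
      shifts are capped there, and all voters other than the \<open>vA\<close> are left alone. This
      keeps every price finite without changing the prefixes.\<close>
    define t' where "t' i = (if i < s then min (t i) (length (sqs ! i)) else 0)" for i
    have "(\<Sum>i<length profile. t' i) = (\<Sum>i<s. t' i)"
      using s_le by (intro sum.mono_neutral_right) (auto simp: t'_def)
    also have "\<dots> \<le> (\<Sum>i<s. t i)" by (intro sum_mono) (auto simp: t'_def)
    finally have sum: "(\<Sum>i<length profile. t' i) \<le> B" using t(1) by simp
    have "t' i \<le> length (snd (profile ! i))" for i
      by (auto simp: t'_def profile_def nth_append vA_def)
    then have "(\<Sum>i<length profile. unit_price (profile ! i) (t' i)) = (\<Sum>i<length profile. enat (t' i))"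
      by (intro sum.cong) (auto simp: unit_price_def)
    then have "?cost t'" using sum sum_enat by simp
    moreover have "take (t' i) (sqs ! i) = take (t i) (sqs ! i)" if "i < s" for i
      using that by (simp add: t'_def min_def)
    then have "copeland \<alpha> (C, ?V t') \<noteq> {d}"
      unfolding V[OF sum] using t(2) by metis
    ultimately show "\<exists>t. ?cost t \<and> copeland \<alpha> (C, ?V t) \<noteq> {d}" by blast
  qed
qed

section \<open>Cliques and prefix covers\<close>

definition block_seq :: "(nat \<Rightarrow> 'c list) \<Rightarrow> (nat \<Rightarrow> 'c) \<Rightarrow> nat list \<Rightarrow> 'c list" where
  "block_seq blk y us = concat (map (\<lambda>u. blk u @ [y u]) us)"

lemma length_block_seq:
  "(\<And>u. u \<in> set us \<Longrightarrow> length (blk u) = L) \<Longrightarrow> length (block_seq blk y us) = length us * (L + 1)"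
  by (induction us) (auto simp: block_seq_def)

lemma block_seq_split:
  assumes "u < n"
  shows "block_seq blk y [0..<n] = block_seq blk y [0..<u] @ blk u @ [y u] @ block_seq blk y [Suc u..<n]"
proof -
  have "[0..<n] = [0..<u] @ [u] @ [Suc u..<n]"
    using assms upt_add_eq_append[of 0 u "n - u"] by (simp add: upt_conv_Cons)
  then show ?thesis by (simp add: block_seq_def)
qed

context
  fixes blk :: "nat \<Rightarrow> 'c list" and y :: "nat \<Rightarrow> 'c" and n L :: nat
  assumes L: "\<And>u. u < n \<Longrightarrow> length (blk u) = L"
    and dist: "distinct (block_seq blk y [0..<n])"
begin

abbreviation (input) "whole \<equiv> block_seq blk y [0..<n]"

lemma length_before: "u < n \<Longrightarrow> length (block_seq blk y [0..<u]) = u * (L + 1)"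
  by (subst length_block_seq[where L = L]) (auto intro: L)

lemma length_after: "u < n \<Longrightarrow> length (block_seq blk y [Suc u..<n]) = (n - 1 - u) * (L + 1)"
  by (subst length_block_seq[where L = L]) (auto intro: L)

lemma in_takeD:
  assumes "distinct (us @ x # ws)" "x \<in> set (take a (us @ x # ws))"
  shows "length us < a"
proof (rule ccontr)
  assume "\<not> ?thesis"
  then have "take a (us @ x # ws) = take a us" by simp
  with assms show False by (auto dest: in_set_takeD)
qed

lemma forward_sep:
  assumes "u < n" "y u \<in> set (take a whole)"
  shows "(u + 1) * (L + 1) \<le> a"
proof -
  have "whole = (block_seq blk y [0..<u] @ blk u) @ y u # block_seq blk y [Suc u..<n]"
    using block_seq_split[OF assms(1)] by simp
  with in_takeD[of "block_seq blk y [0..<u] @ blk u" "y u"] dist assms(2)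
  have "length (block_seq blk y [0..<u] @ blk u) < a" by metis
  then show ?thesis using length_before[OF assms(1)] L[OF assms(1)] by simp
qed

text \<open>Separators stand behind their blocks, so the reversed list meets \<open>y u\<close>
  before block \<open>u\<close>, whereas in \<open>forward_sep\<close> block \<open>u\<close> has to
  be paid for. Due to this asymmetry one block can be left out although all separators are
  passed.\<close>

lemma backward_sep:
  assumes "u < n" "y u \<in> set (take a (rev whole))"
  shows "(n - 1 - u) * (L + 1) + 1 \<le> a"
proof -
  have "rev whole = rev (block_seq blk y [Suc u..<n]) @ y u # rev (blk u) @ rev (block_seq blk y [0..<u])"
    using block_seq_split[OF assms(1), of blk y] by simp
  with in_takeD[of "rev (block_seq blk y [Suc u..<n])" "y u"] dist assms(2)
  have "length (rev (block_seq blk y [Suc u..<n])) < a" by (metis distinct_rev)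
  then show ?thesis using length_after[OF assms(1)] by simp
qed

text \<open>Let \<open>u\<close> be the first separator missing in the prefix. Then the prefix pays
  for all earlier blocks and the suffix for all later ones and for \<open>y u\<close>. If the sum is
  tight, both have exactly these lengths and stop at the two ends of block \<open>u\<close>.\<close>

lemma cover_lower:
  assumes n: "1 \<le> n" and cov: "\<And>u. u < n \<Longrightarrow> y u \<in> set (take a whole) \<union> set (take b (rev whole))"
  shows "(n - 1) * (L + 1) + 1 \<le> a + b"
    and "a + b = (n - 1) * (L + 1) + 1 \<Longrightarrow>
      \<exists>u<n. set (blk u) \<inter> (set (take a whole) \<union> set (take b (rev whole))) = {}"
proof -
  have "(n - 1) * (L + 1) + 1 \<le> a + b \<and> (a + b = (n - 1) * (L + 1) + 1 \<longrightarrow>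
      (\<exists>u<n. set (blk u) \<inter> (set (take a whole) \<union> set (take b (rev whole))) = {}))"
  proof (cases "\<forall>u<n. y u \<in> set (take a whole)")
    case True
    with n forward_sep[of "n - 1" a] have a: "n * (L + 1) \<le> a" by simp
    have e: "n * (L + 1) = (n - 1) * (L + 1) + L + 1" using n by (cases n) auto
    \<comment> \<open>A prefix with all separators costs \<open>n * (L + 1)\<close>, which fits the
      tight sum only for empty blocks; then the claim is trivial.\<close>
    have "L = 0" if "a + b = (n - 1) * (L + 1) + 1"
      using that a e by linarith
    then have "blk 0 = []" if "a + b = (n - 1) * (L + 1) + 1"
      using that L[of 0] n by simp
    then show ?thesis using a e n by (intro conjI impI exI[of _ 0]) auto
  next
    case False
    \<comment> \<open>The first separator beyond the prefix marks the block that becomes the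
      gap.\<close>
    then obtain u where u: "u < n" "y u \<notin> set (take a whole)" "\<And>v. v < u \<Longrightarrow> y v \<in> set (take a whole)"
      using exists_least_iff[of "\<lambda>u. u < n \<and> y u \<notin> set (take a whole)"] by (metis order.strict_trans)
    have b: "(n - 1 - u) * (L + 1) + 1 \<le> b" using backward_sep[OF u(1)] cov[OF u(1)] u(2) by blast
    have a: "u * (L + 1) \<le> a"
      using forward_sep[of "u - 1" a] u(1) u(3)[of "u - 1"] by (cases u) auto
    have e: "(n - 1) * (L + 1) = u * (L + 1) + (n - 1 - u) * (L + 1)"
      unfolding add_mult_distrib[symmetric] using u(1) by simp
    have "set (blk u) \<inter> (set (take a whole) \<union> set (take b (rev whole))) = {}"
      if "a + b = (n - 1) * (L + 1) + 1"
    proof -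
      have "a = length (block_seq blk y [0..<u])"
        using that a b e length_before[OF u(1)] by linarith
      then have 1: "take a whole = block_seq blk y [0..<u]"
        using block_seq_split[OF u(1), of blk y] by simp
      have "b = length (rev (block_seq blk y [Suc u..<n]) @ [y u])"
        using that a b e length_after[OF u(1)] by simp
      moreover have "rev whole = (rev (block_seq blk y [Suc u..<n]) @ [y u]) @ rev (blk u) @ rev (block_seq blk y [0..<u])"
        using block_seq_split[OF u(1), of blk y] by simp
      ultimately have 2: "take b (rev whole) = rev (block_seq blk y [Suc u..<n]) @ [y u]"
        by (metis append_eq_conv_conj)
      have "set (blk u) \<inter> (set (block_seq blk y [0..<u]) \<union>
          set (rev (block_seq blk y [Suc u..<n]) @ [y u])) = {}"
        using dist unfolding block_seq_split[OF u(1)] by auto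
      then show ?thesis unfolding 1 2 .
    qed
    with a b e u(1) show ?thesis by auto
  qed
  then show "(n - 1) * (L + 1) + 1 \<le> a + b"
    "a + b = (n - 1) * (L + 1) + 1 \<Longrightarrow>
      \<exists>u<n. set (blk u) \<inter> (set (take a whole) \<union> set (take b (rev whole))) = {}"
    by blast+
qed

text \<open>The bound of \<open>cover_lower\<close> is attained with any block as the gap: the
  prefix stops just before block \<open>u\<close>, and the reversed prefix ends with the separator
  of \<open>u\<close>.\<close>

lemma cover_upper:
  assumes u: "u < n"
  shows "\<And>v. v < n \<Longrightarrow> y v \<in> set (take (u * (L + 1)) whole) \<union> set (take ((n - 1 - u) * (L + 1) + 1) (rev whole))"
    and "\<And>v. v < n \<Longrightarrow> v \<noteq> u \<Longrightarrow>
      set (blk v) \<subseteq> set (take (u * (L + 1)) whole) \<union> set (take ((n - 1 - u) * (L + 1) + 1) (rev whole))"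
proof -
  have 1: "take (u * (L + 1)) whole = block_seq blk y [0..<u]"
    using block_seq_split[OF u, of blk y] length_before[OF u] by simp
  have "(n - 1 - u) * (L + 1) + 1 = length (rev (block_seq blk y [Suc u..<n]) @ [y u])"
    using length_after[OF u] by simp
  moreover have "rev whole = (rev (block_seq blk y [Suc u..<n]) @ [y u]) @ rev (blk u) @ rev (block_seq blk y [0..<u])"
    using block_seq_split[OF u, of blk y] by simp
  ultimately have 2: "take ((n - 1 - u) * (L + 1) + 1) (rev whole) = rev (block_seq blk y [Suc u..<n]) @ [y u]"
    by (metis append_eq_conv_conj)
  show "y v \<in> set (take (u * (L + 1)) whole) \<union> set (take ((n - 1 - u) * (L + 1) + 1) (rev whole))" if "v < n" for v
    unfolding 1 2 using that by (cases v u rule: linorder_cases) (auto simp: block_seq_def)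
  show "set (blk v) \<subseteq> set (take (u * (L + 1)) whole) \<union> set (take ((n - 1 - u) * (L + 1) + 1) (rev whole))"
    if "v < n" "v \<noteq> u" for v
    unfolding 1 2 using that by (cases v u rule: linorder_cases) (auto simp: block_seq_def)
qed

end

text \<open>Candidates are lists of numbers, the head tells the kind.\<close>

definition Sep :: "nat \<Rightarrow> nat \<Rightarrow> nat list" where "Sep i u = [1, i, u]"
definition Con :: "nat \<Rightarrow> nat \<Rightarrow> nat \<Rightarrow> nat \<Rightarrow> nat list" where "Con i u j v = [2, i, u, j, v]"

section \<open>Sequences of challengers and the budget\<close>

definition slots :: "nat list \<Rightarrow> nat list \<Rightarrow> (nat \<times> nat) list" where
  "slots cs vs = concat (map (\<lambda>i. map (\<lambda>u. (i, u)) vs) cs)"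

text \<open>A slot \<open>(j, v)\<close> stands for choosing vertex \<open>v\<close> for colour
  \<open>j\<close>. Both orientations of a pair of slots are included, whether or not the vertices
  are adjacent, so that a candidate \<open>Con\<close> lies in the blocks of both of its slots and
  all blocks of a colour have the same length.\<close>

definition block :: "nat list \<Rightarrow> nat list \<Rightarrow> nat \<Rightarrow> nat \<Rightarrow> nat list list" where
  "block cs vs i u = concat (map (\<lambda>s. [Con i u (fst s) (snd s), Con (fst s) (snd s) i u])
     (filter (\<lambda>s. fst s \<noteq> i) (slots cs vs)))"

definition seq :: "nat list \<Rightarrow> nat list \<Rightarrow> nat \<Rightarrow> nat list list" where
  "seq cs vs i = concat (map (\<lambda>u. block cs vs i u @ [Sep i u]) vs)"

definition seqs :: "nat list \<Rightarrow> nat list \<Rightarrow> nat list list list" where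
  "seqs cs vs = concat (map (\<lambda>i. [seq cs vs i, rev (seq cs vs i)]) cs)"

text \<open>The sum over the colours of \<open>(n - 1) * (L + 1) + 1\<close>, the minimum in
  \<open>cover_lower\<close>, written as the length of a list because lengths are what the calculus
  computes. \<open>tl vs\<close> gives the factor \<open>n - 1\<close>, and the additional
  \<open>[]\<close> gives the 1.\<close>

definition cover_budget :: "nat list \<Rightarrow> nat list \<Rightarrow> nat" where
  "cover_budget cs vs =
     length (concat (map (\<lambda>i. [] # concat (map (\<lambda>u. block cs vs i u @ [Sep i u]) (tl vs))) cs))"

lemma set_slots: "set (slots cs vs) = set cs \<times> set vs"
  by (auto simp: slots_def)

lemma distinct_concat_map:
  assumes "distinct xs" "\<And>x. x \<in> set xs \<Longrightarrow> distinct (f x)"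
    "\<And>x x'. x \<in> set xs \<Longrightarrow> x' \<in> set xs \<Longrightarrow> x \<noteq> x' \<Longrightarrow> set (f x) \<inter> set (f x') = {}"
  shows "distinct (concat (map f xs))"
  using assms by (induction xs) fastforce+

lemma distinct_slots: "distinct cs \<Longrightarrow> distinct vs \<Longrightarrow> distinct (slots cs vs)"
  unfolding slots_def by (rule distinct_concat_map) (auto simp: distinct_map inj_on_def)

lemma set_block:
  "x \<in> set (block cs vs i u) \<longleftrightarrow>
     (\<exists>j v. j \<in> set cs \<and> v \<in> set vs \<and> j \<noteq> i \<and> (x = Con i u j v \<or> x = Con j v i u))"
  by (force simp: block_def set_slots)

lemma set_seq: "x \<in> set (seq cs vs i) \<longleftrightarrow> (\<exists>u\<in>set vs. x = Sep i u \<or> x \<in> set (block cs vs i u))"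
  by (auto simp: seq_def)

lemma distinct_block: "distinct cs \<Longrightarrow> distinct vs \<Longrightarrow> distinct (block cs vs i u)"
  unfolding block_def
  by (rule distinct_concat_map) (auto simp: distinct_slots Con_def prod_eq_iff)

lemma distinct_seq: "distinct cs \<Longrightarrow> distinct vs \<Longrightarrow> distinct (seq cs vs i)"
  unfolding seq_def
proof (rule distinct_concat_map)
  assume "distinct cs" "distinct vs"
  then show "distinct (block cs vs i u @ [Sep i u])" for u
    using distinct_block[of cs vs i u] by (auto simp: set_block Sep_def Con_def)
  show "set (block cs vs i u @ [Sep i u]) \<inter> set (block cs vs i v @ [Sep i v]) = {}" if "u \<noteq> v" for u v
    using that by (auto simp: set_block Sep_def Con_def)
qed

lemma seq_block_seq: "seq cs [0..<n] i = block_seq (block cs [0..<n] i) (Sep i) [0..<n]"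
  by (simp add: seq_def block_seq_def)

lemma length_block: "length (block cs vs i u) = 2 * length (filter (\<lambda>s. fst s \<noteq> i) (slots cs vs))"
  by (simp add: block_def length_concat comp_def sum_list_triv)

lemma nth_concat_pairs:
  assumes "i < c"
  shows "concat (map (\<lambda>i. [f i, g i]) [0..<c]) ! (2 * i) = f i \<and>
     concat (map (\<lambda>i. [f i, g i]) [0..<c]) ! (2 * i + 1) = g i"
  using assms
proof (induction c)
  case (Suc c)
  have len: "length (concat (map (\<lambda>i. [f i, g i]) [0..<c])) = 2 * c"
    by (simp add: length_concat comp_def sum_list_triv)
  show ?case
  proof (cases "i = c")
    case True
    then show ?thesis using len by (simp add: nth_append)
  next
    case False
    with Suc.prems have "i < c" by simp
    with Suc.IH len show ?thesis by (simp add: nth_append)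
  qed
qed simp

lemma seqs_nth:
  assumes "i < c"
  shows "seqs [0..<c] vs ! (2 * i) = seq [0..<c] vs i" "seqs [0..<c] vs ! (2 * i + 1) = rev (seq [0..<c] vs i)"
  unfolding seqs_def by (rule nth_concat_pairs[OF assms, THEN conjunct1] nth_concat_pairs[OF assms, THEN conjunct2])+

lemma length_seqs: "length (seqs cs vs) = 2 * length cs"
  by (simp add: seqs_def length_concat comp_def sum_list_triv)

lemma ex_less_double: "(\<exists>j<2 * c. p j) \<longleftrightarrow> (\<exists>i<c. p (2 * i) \<or> p (2 * i + 1))" for c :: nat
proof
  assume "\<exists>j<2 * c. p j"
  then obtain j where "j < 2 * c" "p j" by blast
  then show "\<exists>i<c. p (2 * i) \<or> p (2 * i + 1)"
    by (intro exI[of _ "j div 2"]) (cases "even j"; auto)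
next
  assume "\<exists>i<c. p (2 * i) \<or> p (2 * i + 1)"
  then obtain i where "i < c" "p (2 * i) \<or> p (2 * i + 1)" by blast
  then show "\<exists>j<2 * c. p j" by (auto intro: exI[of _ "2 * i"] exI[of _ "2 * i + 1"])
qed

lemma sum_double: "(\<Sum>j<2 * c. f j) = (\<Sum>i<c. f (2 * i) + f (2 * i + 1))" for f :: "nat \<Rightarrow> nat"
  by (induction c) auto

text \<open>The budget is the sum of the least costs \<open>H i\<close>, so every colour spends
  exactly \<open>H i\<close> and keeps one block \<open>\<phi> i\<close> unpassed. A relevant
  \<open>Con\<close> is missed exactly if both of its slots are chosen, whence chosen vertices must
  be adjacent.\<close>

theorem cover_iff:
  assumes n: "1 \<le> n"
    and R: "\<And>x. x \<in> R \<longleftrightarrow> (\<exists>i u. i < c \<and> u < n \<and> x = Sep i u) \<or>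
      (\<exists>i u j v. i < c \<and> j < c \<and> i \<noteq> j \<and> u < n \<and> v < n \<and> \<not> adj u v \<and> x = Con i u j v)"
  shows "(\<exists>t. (\<Sum>j<2 * c. t j) \<le> cover_budget [0..<c] [0..<n] \<and>
      (\<forall>x\<in>R. \<exists>j<2 * c. x \<in> set (take (t j) (seqs [0..<c] [0..<n] ! j)))) \<longleftrightarrow>
    (\<exists>\<phi>. (\<forall>i<c. \<phi> i < n) \<and> (\<forall>i<c. \<forall>j<c. i \<noteq> j \<longrightarrow> adj (\<phi> i) (\<phi> j)))"
proof -
  let ?blk = "block [0..<c] [0..<n]" and ?sq = "seq [0..<c] [0..<n]"
  define L where "L i = 2 * length (filter (\<lambda>s. fst s \<noteq> i) (slots [0..<c] [0..<n]))" for i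
  define H where "H i = (n - 1) * (L i + 1) + 1" for i
  have L: "length (?blk i u) = L i" for i u by (simp add: L_def length_block)
  note dist = distinct_seq[of "[0..<c]" "[0..<n]", simplified, unfolded seq_block_seq]
  have B: "cover_budget [0..<c] [0..<n] = (\<Sum>i<c. H i)"
    by (simp add: cover_budget_def length_concat comp_def L H_def sum_list_triv interv_sum_list_conv_sum_set_nat
          atLeast0LessThan)
  define cov where "cov t i = set (take (t (2 * i)) (?sq i)) \<union> set (take (t (2 * i + 1)) (rev (?sq i)))"
    for t :: "nat \<Rightarrow> nat" and i
  have cov: "(\<exists>j<2 * c. x \<in> set (take (t j) (seqs [0..<c] [0..<n] ! j))) \<longleftrightarrow> (\<exists>i<c. x \<in> cov t i)" for x t
    unfolding ex_less_double cov_def using seqs_nth by auto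
  have cov_seq: "x \<in> cov t i \<Longrightarrow> x \<in> set (?sq i)" for x t i
    unfolding cov_def by (auto dest: in_set_takeD)
  show ?thesis unfolding cov B sum_double
  proof
    assume "\<exists>t. (\<Sum>i<c. t (2 * i) + t (2 * i + 1)) \<le> sum H {..<c} \<and> (\<forall>x\<in>R. \<exists>i<c. x \<in> cov t i)"
    then obtain t where t: "(\<Sum>i<c. t (2 * i) + t (2 * i + 1)) \<le> sum H {..<c}"
      "\<And>x. x \<in> R \<Longrightarrow> \<exists>i<c. x \<in> cov t i" by blast
    have sep: "Sep i u \<in> cov t i" if "i < c" "u < n" for i u
    proof -
      have "Sep i u \<in> R" unfolding R using that by blast
      then obtain i' where i': "i' < c" "Sep i u \<in> cov t i'" using t(2) by blast
      with cov_seq have "Sep i u \<in> set (?sq i')" by blast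
      \<comment> \<open>A separator occurs only in the sequence of its own colour, so shifts for
        other colours cannot pass it.\<close>
      then have "i' = i" by (auto simp: set_seq set_block Sep_def Con_def)
      with i' show ?thesis by simp
    qed
    have low: "H i \<le> t (2 * i) + t (2 * i + 1)" if "i < c" for i
      unfolding H_def
      by (rule cover_lower(1)[OF L dist n]) (use sep that in \<open>auto simp: cov_def seq_block_seq\<close>)
    have eq: "t (2 * i) + t (2 * i + 1) = H i" if "i < c" for i
    proof (rule ccontr)
      assume "\<not> ?thesis"
      with low that have "sum H {..<c} < (\<Sum>i<c. t (2 * i) + t (2 * i + 1))"
        by (intro sum_strict_mono_ex1 bexI[of _ i]) (auto simp: order.strict_iff_order)
      with t(1) show False by simp
    qed
    have "\<exists>u<n. set (?blk i u) \<inter> cov t i = {}" if "i < c" for i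
      unfolding cov_def seq_block_seq
      by (rule cover_lower(2)[OF L dist n]) (use sep eq that in \<open>auto simp: cov_def seq_block_seq H_def\<close>)
    then obtain \<phi> where \<phi>: "\<And>i. i < c \<Longrightarrow> \<phi> i < n" "\<And>i. i < c \<Longrightarrow> set (?blk i (\<phi> i)) \<inter> cov t i = {}"
      by metis
    have "adj (\<phi> i) (\<phi> j)" if ij: "i < c" "j < c" "i \<noteq> j" for i j
    proof (rule ccontr)
      assume "\<not> adj (\<phi> i) (\<phi> j)"
      with ij \<phi>(1) have "Con i (\<phi> i) j (\<phi> j) \<in> R" unfolding R by blast
      then obtain h where h: "h < c" "Con i (\<phi> i) j (\<phi> j) \<in> cov t h" using t(2) by blast
      then have "Con i (\<phi> i) j (\<phi> j) \<in> set (?sq h)" using cov_seq by blast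
      \<comment> \<open>Only the two colours named in a \<open>Con\<close> can pass it, and here it
        lies in the gap of either.\<close>
      then have "h = i \<or> h = j" by (auto simp: set_seq set_block Sep_def Con_def)
      moreover have "Con i (\<phi> i) j (\<phi> j) \<in> set (?blk i (\<phi> i))" "Con i (\<phi> i) j (\<phi> j) \<in> set (?blk j (\<phi> j))"
        using ij \<phi>(1) by (auto simp: set_block)
      ultimately show False using h \<phi>(2) ij by blast
    qed
    with \<phi>(1) show "\<exists>\<phi>. (\<forall>i<c. \<phi> i < n) \<and> (\<forall>i<c. \<forall>j<c. i \<noteq> j \<longrightarrow> adj (\<phi> i) (\<phi> j))" by blast
  next
    assume "\<exists>\<phi>. (\<forall>i<c. \<phi> i < n) \<and> (\<forall>i<c. \<forall>j<c. i \<noteq> j \<longrightarrow> adj (\<phi> i) (\<phi> j))"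
    then obtain \<phi> where \<phi>: "\<And>i. i < c \<Longrightarrow> \<phi> i < n" "\<And>i j. i < c \<Longrightarrow> j < c \<Longrightarrow> i \<noteq> j \<Longrightarrow> adj (\<phi> i) (\<phi> j)"
      by blast
    \<comment> \<open>The lengths from \<open>cover_upper\<close> with gap \<open>\<phi> i\<close>:
      even indices are the forward votes, odd ones the backward votes.\<close>
    define t where "t j = (if even j then \<phi> (j div 2) * (L (j div 2) + 1)
       else (n - 1 - \<phi> (j div 2)) * (L (j div 2) + 1) + 1)" for j
    have t: "t (2 * i) = \<phi> i * (L i + 1)" "t (2 * i + 1) = (n - 1 - \<phi> i) * (L i + 1) + 1" for i
      by (simp_all add: t_def)
    have "t (2 * i) + t (2 * i + 1) = H i" if "i < c" for i
      unfolding t H_def add.assoc[symmetric] add_mult_distrib[symmetric] using \<phi>(1)[OF that] by simp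
    then have "(\<Sum>i<c. t (2 * i) + t (2 * i + 1)) \<le> sum H {..<c}" by simp
    moreover have "\<exists>i<c. x \<in> cov t i" if "x \<in> R" for x
      using that unfolding R
    proof (elim disjE exE conjE)
      fix i u assume x: "i < c" "u < n" "x = Sep i u"
      have "x \<in> cov t i" unfolding cov_def t seq_block_seq x(3)
        by (rule cover_upper(1)[OF L dist \<phi>(1)[OF x(1)] x(2)])
      with x show ?thesis by blast
    next
      fix i u j v assume x: "i < c" "j < c" "i \<noteq> j" "u < n" "v < n" "\<not> adj u v" "x = Con i u j v"
      have sub: "set (?blk i u) \<subseteq> cov t i" if "i < c" "u < n" "u \<noteq> \<phi> i" for i u
        unfolding cov_def t seq_block_seq
        by (rule cover_upper(2)[OF L dist \<phi>(1)[OF that(1)] that(2,3)])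
      have "x \<in> set (?blk i u)" "x \<in> set (?blk j v)" using x by (auto simp: set_block)
      moreover have "u \<noteq> \<phi> i \<or> v \<noteq> \<phi> j" using \<phi>(2)[OF x(1-3)] x(6) by blast
      ultimately show ?thesis using sub x by blast
    qed
    ultimately show "\<exists>t. (\<Sum>i<c. t (2 * i) + t (2 * i + 1)) \<le> sum H {..<c} \<and> (\<forall>x\<in>R. \<exists>i<c. x \<in> cov t i)"
      by blast
  qed
qed

text \<open>Edges have two elements, so equal vertices are never adjacent and \<open>\<phi>\<close>
  is injective. If \<open>k > n\<close>, the \<open>n + 1\<close> colours that remain after the
  cut-off still cannot be mapped injectively to the vertices.\<close>

lemma clique_iff:
  assumes E: "\<forall>e\<in>E. e \<subseteq> {..<n} \<and> card e = 2"
  shows "(\<exists>\<phi>. (\<forall>i<min k (n + 1). \<phi> i < n) \<and>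
      (\<forall>i<min k (n + 1). \<forall>j<min k (n + 1). i \<noteq> j \<longrightarrow> {\<phi> i, \<phi> j} \<in> E)) \<longleftrightarrow>
    (\<exists>S \<subseteq> {..<n}. card S = k \<and> (\<forall>u\<in>S. \<forall>v\<in>S. u \<noteq> v \<longrightarrow> {u, v} \<in> E))"
    (is "?L \<longleftrightarrow> ?R")
proof
  assume ?L
  then obtain \<phi> where \<phi>: "\<And>i. i < min k (n + 1) \<Longrightarrow> \<phi> i < n"
    "\<And>i j. i < min k (n + 1) \<Longrightarrow> j < min k (n + 1) \<Longrightarrow> i \<noteq> j \<Longrightarrow> {\<phi> i, \<phi> j} \<in> E" by blast
  have inj: "inj_on \<phi> {..<min k (n + 1)}"
  proof (rule inj_onI, rule ccontr)
    fix i j assume "i \<in> {..<min k (n + 1)}" "j \<in> {..<min k (n + 1)}" "\<phi> i = \<phi> j" "i \<noteq> j"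
    with \<phi>(2)[of i j] E have "card {\<phi> i} = 2" by fastforce
    then show False by simp
  qed
  have sub: "\<phi> ` {..<min k (n + 1)} \<subseteq> {..<n}" using \<phi>(1) by auto
  have card: "card (\<phi> ` {..<min k (n + 1)}) = min k (n + 1)" using card_image[OF inj] by simp
  with card_mono[OF _ sub] have "min k (n + 1) \<le> n" by simp
  then have "min k (n + 1) = k" by simp
  with sub card \<phi>(2) show ?R
    by (intro exI[of _ "\<phi> ` {..<min k (n + 1)}"]) auto
next
  assume ?R
  then obtain S where S: "S \<subseteq> {..<n}" "card S = k" "\<forall>u\<in>S. \<forall>v\<in>S. u \<noteq> v \<longrightarrow> {u, v} \<in> E" by blast
  have "k \<le> n" using card_mono[OF _ S(1)] S(2) by simp
  then have k: "min k (n + 1) = k" by simp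
  have "finite S" using S(1) finite_subset by blast
  then obtain \<phi> where \<phi>: "bij_betw \<phi> {..<k} S"
    using S(2) ex_bij_betw_nat_finite[of S] by (auto simp: atLeast0LessThan)
  then have "\<phi> i \<in> S" if "i < k" for i using that by (auto simp: bij_betw_def)
  moreover have "\<phi> i \<noteq> \<phi> j" if "i < k" "j < k" "i \<noteq> j" for i j
    using \<phi> that by (auto simp: bij_betw_def inj_on_def)
  ultimately show ?L unfolding k using S by (intro exI[of _ \<phi>]) auto
qed

section \<open>The reduction\<close>

definition edges :: "bool list list \<Rightarrow> (nat \<times> nat) list" where
  "edges M = concat (map (\<lambda>p. map (\<lambda>q. (fst p, fst q)) (filter (\<lambda>q. snd q) (List.enumerate 0 (snd p))))
     (List.enumerate 0 M))"

text \<open>There is no clique with more than \<open>n\<close> vertices, so \<open>k\<close> is cut off at \<open>n + 1\<close>. This keeps the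
  output polynomial in the size of the graph although \<open>k\<close> is given in binary.\<close>

definition colours :: "bool list list \<Rightarrow> nat \<Rightarrow> nat list" where
  "colours M k = takeWhile (\<lambda>i. i \<noteq> k) [0..<length ([] # M)]"

definition slot_pairs :: "nat list \<Rightarrow> nat list \<Rightarrow> ((nat \<times> nat) \<times> nat \<times> nat) list" where
  "slot_pairs cs vs = concat (map (\<lambda>s. map (\<lambda>s'. (s, s')) (filter (\<lambda>s'. fst s' \<noteq> fst s) (slots cs vs)))
     (slots cs vs))"

definition con :: "(nat \<times> nat) \<times> nat \<times> nat \<Rightarrow> nat list" where
  "con p = Con (fst (fst p)) (snd (fst p)) (fst (snd p)) (snd (snd p))"

definition relevant :: "nat list \<Rightarrow> nat list \<Rightarrow> (nat \<times> nat) list \<Rightarrow> nat list list" where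
  "relevant cs vs G = map (\<lambda>s. Sep (fst s) (snd s)) (slots cs vs) @
     map con (filter (\<lambda>p. (snd (fst p), snd (snd p)) \<notin> set G) (slot_pairs cs vs))"

text \<open>The candidates that beat \<open>d\<close> anyway; those with head 3 only make the budget small compared
  with the number of guards.\<close>

definition irrelevant :: "nat list \<Rightarrow> nat list \<Rightarrow> (nat \<times> nat) list \<Rightarrow> nat list list" where
  "irrelevant cs vs G = [0, 0] # [0, 1] #
     map con (filter (\<lambda>p. (snd (fst p), snd (snd p)) \<in> set G) (slot_pairs cs vs)) @
     concat (map (\<lambda>i. map (\<lambda>x. 3 # i # x) (seq cs vs i)) cs)"

definition challengers :: "nat list \<Rightarrow> nat list \<Rightarrow> (nat \<times> nat) list \<Rightarrow> nat list list" where
  "challengers cs vs G = irrelevant cs vs G @ relevant cs vs G"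

text \<open>Copying all challengers except the first yields \<open>w\<close> guards for
  \<open>w + 1\<close> challengers without computing any number.\<close>

definition guards :: "nat \<Rightarrow> nat list \<Rightarrow> nat list \<Rightarrow> (nat \<times> nat) list \<Rightarrow> nat list list" where
  "guards j cs vs G = map (\<lambda>x. j # x) (tl (challengers cs vs G))"

definition all_cands :: "nat list \<Rightarrow> nat list \<Rightarrow> (nat \<times> nat) list \<Rightarrow> nat list list" where
  "all_cands cs vs G = [] # guards 4 cs vs G @ guards 5 cs vs G @ guards 6 cs vs G @ challengers cs vs G"

text \<open>Candidates of an instance are numbers, so lists are replaced by their index in
  \<open>all_cands\<close>; since \<open>[]\<close> comes first there, \<open>d\<close> gets the
  name 0.\<close>

definition name :: "nat list list \<Rightarrow> nat list \<Rightarrow> nat" where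
  "name xs x = length (takeWhile (\<lambda>y. y \<noteq> x) xs)"

definition names :: "nat list \<Rightarrow> nat list \<Rightarrow> (nat \<times> nat) list \<Rightarrow> nat list list \<Rightarrow> nat list" where
  "names cs vs G ys = map (\<lambda>y. name (all_cands cs vs G) y) ys"

text \<open>\<open>bribery_profile\<close> has no assumptions, so its \<open>profile\<close> is a
  total function of the lists that can be analysed in the calculus; the assumptions of
  \<open>bribery_election\<close> enter with the correctness proof.\<close>

definition reduction_profile :: "nat list \<Rightarrow> nat list \<Rightarrow> (nat \<times> nat) list \<Rightarrow> (nat list \<times> nat list) list" where
  "reduction_profile cs vs G = bribery_profile.profile
     (names cs vs G (guards 4 cs vs G)) (names cs vs G (guards 5 cs vs G)) (names cs vs G (guards 6 cs vs G))
     (names cs vs G (challengers cs vs G)) (names cs vs G (irrelevant cs vs G))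
     (names cs vs G (relevant cs vs G)) (map (\<lambda>sq. names cs vs G sq) (seqs cs vs))"

definition reduction_instance :: "nat list \<Rightarrow> nat list \<Rightarrow> (nat \<times> nat) list \<Rightarrow> dsb_instance" where
  "reduction_instance cs vs G =
     \<lparr>cands = {..<length (all_cands cs vs G)},
      votes = map (\<lambda>x. fst x @ 0 # snd x) (reduction_profile cs vs G),
      despised = 0,
      budget = cover_budget cs vs,
      prices = map unit_price (reduction_profile cs vs G)\<rparr>"

text \<open>An instance contains a set and functions. This tuple of lists is a concrete form of the
  same data with the same code, see \<open>enc_dsb_reduction\<close>, and is what the program
  produces. The tables of prices have one entry for each shift from 0 to
  \<open>length (snd x)\<close>.\<close>

definition reduction_output ::
  "nat list \<Rightarrow> nat list \<Rightarrow> (nat \<times> nat) list \<Rightarrow> nat list \<times> nat list list \<times> nat \<times> nat \<times> enat list list" where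
  "reduction_output cs vs G =
     ([0..<length (all_cands cs vs G)],
      map (\<lambda>x. fst x @ 0 # snd x) (reduction_profile cs vs G), 0, cover_budget cs vs,
      map (\<lambda>x. map (\<lambda>\<tau>. enat \<tau>) [0..<length (0 # snd x)]) (reduction_profile cs vs G))"

subsection \<open>Running time\<close>

abbreviation "enc_nats \<equiv> enc_list enc_nat"
abbreviation "enc_graph \<equiv> enc_list (enc_nat \<otimes> enc_nat)"

lemma poly_time_enat:
  assumes "poly_time e enc_nat f"
  shows "poly_time e enc_enat (\<lambda>x. enat (f x))"
  by (rule poly_time_retype[OF poly_time_pair[OF poly_time_const[where c = "()" and e' = "\<lambda>_. Leaf"] assms]])
     (simp add: enc_enat_def)

lemma poly_time_app4:
  assumes "poly_time (e1 \<otimes> e2 \<otimes> e3 \<otimes> e4) e5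
      (\<lambda>z. f (fst z) (fst (snd z)) (fst (snd (snd z))) (snd (snd (snd z))))"
    "poly_time e e1 g1" "poly_time e e2 g2" "poly_time e e3 g3" "poly_time e e4 g4"
  shows "poly_time e e5 (\<lambda>x. f (g1 x) (g2 x) (g3 x) (g4 x))"
  using poly_time_compose[OF assms(1) poly_time_pair[OF assms(2) poly_time_pair[OF assms(3)
      poly_time_pair[OF assms(4,5)]]]]
  by simp

lemmas poly_time_rules = poly_time_const poly_time_intros inj_enc_bool poly_time_enat

lemma poly_time_edges:
  "poly_time e (enc_list (enc_list enc_bool)) f \<Longrightarrow> poly_time e enc_graph (\<lambda>x. edges (f x))"
  by (rule poly_time_compose[where f = edges], unfold edges_def) (rule poly_time_rules)+

lemma poly_time_colours':
  "poly_time (enc_list (enc_list enc_bool) \<otimes> enc_nat) enc_nats (\<lambda>z. colours (fst z) (snd z))"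
  unfolding colours_def by (rule poly_time_rules)+

lemmas poly_time_colours = poly_time_app2[where f = colours, OF poly_time_colours']

lemma poly_time_slots':
  "poly_time (enc_nats \<otimes> enc_nats) (enc_list (enc_nat \<otimes> enc_nat)) (\<lambda>z. slots (fst z) (snd z))"
  unfolding slots_def by (rule poly_time_rules)+

lemmas poly_time_slots = poly_time_app2[where f = slots, OF poly_time_slots']

lemma poly_time_slot_pairs':
  "poly_time (enc_nats \<otimes> enc_nats) (enc_list ((enc_nat \<otimes> enc_nat) \<otimes> (enc_nat \<otimes> enc_nat)))
     (\<lambda>z. slot_pairs (fst z) (snd z))"
  unfolding slot_pairs_def by (rule poly_time_rules poly_time_slots)+

lemmas poly_time_slot_pairs = poly_time_app2[where f = slot_pairs, OF poly_time_slot_pairs']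

lemma poly_time_block':
  "poly_time (enc_nats \<otimes> enc_nats \<otimes> enc_nat \<otimes> enc_nat) (enc_list enc_nats)
     (\<lambda>z. block (fst z) (fst (snd z)) (fst (snd (snd z))) (snd (snd (snd z))))"
  unfolding block_def Con_def by (rule poly_time_rules poly_time_slots)+

lemmas poly_time_block = poly_time_app4[where f = block, OF poly_time_block']

lemma poly_time_seq':
  "poly_time (enc_nats \<otimes> enc_nats \<otimes> enc_nat) (enc_list enc_nats)
     (\<lambda>z. seq (fst z) (fst (snd z)) (snd (snd z)))"
  unfolding seq_def Sep_def by (rule poly_time_rules poly_time_block)+

lemmas poly_time_seq = poly_time_app3[where f = seq, OF poly_time_seq']

lemma poly_time_seqs':
  "poly_time (enc_nats \<otimes> enc_nats) (enc_list (enc_list enc_nats)) (\<lambda>z. seqs (fst z) (snd z))"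
  unfolding seqs_def by (rule poly_time_rules poly_time_seq)+

lemmas poly_time_seqs = poly_time_app2[where f = seqs, OF poly_time_seqs']

lemma poly_time_cover_budget':
  "poly_time (enc_nats \<otimes> enc_nats) enc_nat (\<lambda>z. cover_budget (fst z) (snd z))"
proof -
  have "poly_time (enc_nats \<otimes> enc_nats) (enc_list enc_nats) (\<lambda>z. concat (map (\<lambda>i. [] #
     concat (map (\<lambda>u. block (fst z) (snd z) i u @ [Sep i u]) (tl (snd z)))) (fst z)))"
    unfolding Sep_def by (rule poly_time_rules poly_time_block)+
  then show ?thesis unfolding cover_budget_def by (rule poly_time_length)
qed

lemmas poly_time_cover_budget = poly_time_app2[where f = cover_budget, OF poly_time_cover_budget']

abbreviation "enc_args \<equiv> enc_nats \<otimes> enc_nats \<otimes> enc_graph"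

lemma poly_time_relevant':
  "poly_time enc_args (enc_list enc_nats) (\<lambda>z. relevant (fst z) (fst (snd z)) (snd (snd z)))"
  unfolding relevant_def Sep_def con_def Con_def
  by (rule poly_time_rules poly_time_slots poly_time_slot_pairs)+

lemmas poly_time_relevant = poly_time_app3[where f = relevant, OF poly_time_relevant']

lemma poly_time_irrelevant':
  "poly_time enc_args (enc_list enc_nats) (\<lambda>z. irrelevant (fst z) (fst (snd z)) (snd (snd z)))"
  unfolding irrelevant_def con_def Con_def
  by (rule poly_time_rules poly_time_seq poly_time_slot_pairs)+

lemmas poly_time_irrelevant = poly_time_app3[where f = irrelevant, OF poly_time_irrelevant']

lemma poly_time_challengers':
  "poly_time enc_args (enc_list enc_nats) (\<lambda>z. challengers (fst z) (fst (snd z)) (snd (snd z)))"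
  unfolding challengers_def by (rule poly_time_rules poly_time_relevant poly_time_irrelevant)+

lemmas poly_time_challengers = poly_time_app3[where f = challengers, OF poly_time_challengers']

lemma poly_time_guards':
  "poly_time enc_args (enc_list enc_nats) (\<lambda>z. guards j (fst z) (fst (snd z)) (snd (snd z)))"
  unfolding guards_def by (rule poly_time_rules poly_time_challengers)+

lemmas poly_time_guards = poly_time_app3[where f = "guards j" for j, OF poly_time_guards']

lemma poly_time_all_cands':
  "poly_time enc_args (enc_list enc_nats) (\<lambda>z. all_cands (fst z) (fst (snd z)) (snd (snd z)))"
  unfolding all_cands_def by (rule poly_time_rules poly_time_challengers poly_time_guards)+

lemmas poly_time_all_cands = poly_time_app3[where f = all_cands, OF poly_time_all_cands']

lemma poly_time_names':
  "poly_time (enc_nats \<otimes> enc_nats \<otimes> enc_graph \<otimes> enc_list enc_nats) enc_nats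
     (\<lambda>z. names (fst z) (fst (snd z)) (fst (snd (snd z))) (snd (snd (snd z))))"
  unfolding names_def name_def by (rule poly_time_rules poly_time_all_cands)+

lemmas poly_time_names = poly_time_app4[where f = names, OF poly_time_names']

lemma poly_time_reduction_profile':
  "poly_time enc_args (enc_list (enc_nats \<otimes> enc_nats))
     (\<lambda>z. reduction_profile (fst z) (fst (snd z)) (snd (snd z)))"
proof -
  \<comment> \<open>Fixed multiplicities are unrolled, and \<open>s\<close> copies become a
    \<open>map\<close> over the \<open>s\<close> sequences, so that only operations with rules
    remain.\<close>
  have "replicate 5 x = [x, x, x, x, x]" "replicate 6 x = [x, x, x, x, x, x]" "replicate 1 x = [x]"
    "replicate (length xs) x = map (\<lambda>_. x) xs" for x :: 'x and xs :: "'y list"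
    by (simp_all add: numeral_eq_Suc map_replicate_const)
  note rep = this replicate_add
  show ?thesis
    unfolding reduction_profile_def bribery_profile.profile_def bribery_profile.v_defs
      bribery_profile.rest_def rep length_map
    by (rule poly_time_rules poly_time_names poly_time_guards poly_time_challengers poly_time_relevant
        poly_time_irrelevant poly_time_seqs)+
qed

lemmas poly_time_reduction_profile =
  poly_time_app3[where f = reduction_profile, OF poly_time_reduction_profile']

abbreviation "enc_output \<equiv> enc_nats \<otimes> enc_list enc_nats \<otimes> enc_nat \<otimes> enc_nat \<otimes> enc_list (enc_list enc_enat)"

lemma poly_time_reduction_output':
  "poly_time enc_args enc_output (\<lambda>z. reduction_output (fst z) (fst (snd z)) (snd (snd z)))"
  unfolding reduction_output_def
  by (rule poly_time_rules poly_time_reduction_profile poly_time_all_cands poly_time_cover_budget)+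

lemmas poly_time_reduction_output =
  poly_time_app3[where f = reduction_output, OF poly_time_reduction_output']

text \<open>Every colour needs a vertex to choose. So the empty graph is replaced by a single vertex, and a
  positive clique size then by 2.\<close>

definition normalize_graph :: "bool list list \<Rightarrow> bool list list" where
  "normalize_graph M = (if M = [] then [[False]] else M)"

definition normalize_size :: "bool list list \<Rightarrow> nat \<Rightarrow> nat" where
  "normalize_size M k = (if M = [] then if k = 0 then 0 else 2 else k)"

definition clique_output where
  "clique_output M k = reduction_output (colours (normalize_graph M) (normalize_size M k))
     [0..<length (normalize_graph M)] (edges (normalize_graph M))"

lemma poly_time_clique_output:
  "poly_time (enc_list (enc_list enc_bool) \<otimes> enc_nat) enc_output (\<lambda>z. clique_output (fst z) (snd z))"
  unfolding clique_output_def normalize_graph_def normalize_size_def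
  by (rule poly_time_rules poly_time_reduction_output poly_time_colours poly_time_edges)+

subsection \<open>Correctness\<close>

lemma name_nth:
  assumes "distinct xs" "i < length xs"
  shows "name xs (xs ! i) = i"
proof -
  have "takeWhile (\<lambda>y. y \<noteq> xs ! i) xs = take i xs"
    by (rule takeWhile_eq_take_P_nth) (use assms in \<open>auto simp: nth_eq_iff_index_eq\<close>)
  with assms(2) show ?thesis by (simp add: name_def)
qed

lemma map_name: "distinct xs \<Longrightarrow> map (name xs) xs = [0..<length xs]"
  by (rule nth_equalityI) (auto simp: name_nth)

lemma inj_on_name: "distinct xs \<Longrightarrow> inj_on (name xs) (set xs)"
  by (rule inj_onI) (metis in_set_conv_nth name_nth)

lemma set_slot_pairs:
  "p \<in> set (slot_pairs cs vs) \<longleftrightarrow>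
     fst p \<in> set (slots cs vs) \<and> snd p \<in> set (slots cs vs) \<and> fst (snd p) \<noteq> fst (fst p)"
  by (cases p) (auto simp: slot_pairs_def image_iff)

lemma distinct_slot_pairs: "distinct cs \<Longrightarrow> distinct vs \<Longrightarrow> distinct (slot_pairs cs vs)"
  unfolding slot_pairs_def
  by (rule distinct_concat_map) (auto simp: distinct_slots distinct_map inj_on_def)

lemma inj_con: "inj con"
  by (auto simp: inj_def con_def Con_def)

lemma set_map_con:
  "x \<in> set (map con (filter q (slot_pairs cs vs))) \<longleftrightarrow>
     (\<exists>i\<in>set cs. \<exists>j\<in>set cs. \<exists>u\<in>set vs. \<exists>v\<in>set vs. i \<noteq> j \<and> q ((i, u), (j, v)) \<and> x = Con i u j v)"
proof
  assume "x \<in> set (map con (filter q (slot_pairs cs vs)))"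
  then obtain i u j v where "((i, u), (j, v)) \<in> set (slot_pairs cs vs)" "q ((i, u), (j, v))" "x = con ((i, u), (j, v))"
    by auto
  then show "\<exists>i\<in>set cs. \<exists>j\<in>set cs. \<exists>u\<in>set vs. \<exists>v\<in>set vs. i \<noteq> j \<and> q ((i, u), (j, v)) \<and> x = Con i u j v"
    by (intro bexI[of _ i] bexI[of _ j] bexI[of _ u] bexI[of _ v]) (auto simp: set_slot_pairs set_slots con_def)
next
  assume "\<exists>i\<in>set cs. \<exists>j\<in>set cs. \<exists>u\<in>set vs. \<exists>v\<in>set vs. i \<noteq> j \<and> q ((i, u), (j, v)) \<and> x = Con i u j v"
  then obtain i j u v where "i \<in> set cs" "j \<in> set cs" "u \<in> set vs" "v \<in> set vs" "i \<noteq> j"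
    "q ((i, u), (j, v))" "x = Con i u j v" by blast
  then have "((i, u), (j, v)) \<in> set (filter q (slot_pairs cs vs))" "x = con ((i, u), (j, v))"
    by (auto simp: set_slot_pairs set_slots con_def)
  then show "x \<in> set (map con (filter q (slot_pairs cs vs)))" by (metis imageI set_map)
qed

lemma set_map_Sep:
  "x \<in> set (map (\<lambda>s. Sep (fst s) (snd s)) (slots cs vs)) \<longleftrightarrow> (\<exists>i\<in>set cs. \<exists>u\<in>set vs. x = Sep i u)"
  by (auto simp: set_slots image_iff)

lemma set_relevant:
  "x \<in> set (relevant cs vs G) \<longleftrightarrow> (\<exists>i\<in>set cs. \<exists>u\<in>set vs. x = Sep i u) \<or>
     (\<exists>i\<in>set cs. \<exists>j\<in>set cs. \<exists>u\<in>set vs. \<exists>v\<in>set vs. i \<noteq> j \<and> (u, v) \<notin> set G \<and> x = Con i u j v)"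
  unfolding relevant_def set_append Un_iff set_map_con set_map_Sep by simp

lemma set_challengers:
  "x \<in> set (challengers cs vs G) \<longleftrightarrow> x = [0, 0] \<or> x = [0, 1] \<or>
     (\<exists>i\<in>set cs. \<exists>u\<in>set vs. x = Sep i u) \<or>
     (\<exists>i\<in>set cs. \<exists>j\<in>set cs. \<exists>u\<in>set vs. \<exists>v\<in>set vs. i \<noteq> j \<and> x = Con i u j v) \<or>
     (\<exists>i\<in>set cs. \<exists>y\<in>set (seq cs vs i). x = 3 # i # y)"
proof -
  have "x \<in> set (concat (map (\<lambda>i. map (\<lambda>x. 3 # i # x) (seq cs vs i)) cs)) \<longleftrightarrow>
      (\<exists>i\<in>set cs. \<exists>y\<in>set (seq cs vs i). x = 3 # i # y)" by auto
  then show ?thesis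
    unfolding challengers_def irrelevant_def set_append list.set(2) Un_iff insert_iff set_relevant set_map_con
      fst_conv snd_conv
    by blast
qed

lemma distinct_challengers:
  assumes "distinct cs" "distinct vs"
  shows "distinct (challengers cs vs G)"
proof -
  have con: "distinct (map con (filter p (slot_pairs cs vs)))" for p
    using distinct_slot_pairs[OF assms] inj_con by (simp add: distinct_map inj_on_subset[OF inj_con])
  have con_disj: "set (map con (filter (\<lambda>p. q p \<in> X) ps)) \<inter> set (map con (filter (\<lambda>p. q p \<notin> X) ps)) = {}"
    for ps :: "((nat \<times> nat) \<times> nat \<times> nat) list" and q :: "(nat \<times> nat) \<times> nat \<times> nat \<Rightarrow> nat \<times> nat" and X
    using inj_con by (auto simp: inj_eq)
  have pad: "distinct (concat (map (\<lambda>i. map (\<lambda>x. 3 # i # x) (seq cs vs i)) cs))"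
    by (rule distinct_concat_map) (auto simp: distinct_map inj_on_def distinct_seq assms)
  have sep: "distinct (map (\<lambda>s. Sep (fst s) (snd s)) (slots cs vs))"
    using distinct_slots[OF assms] by (auto simp: distinct_map inj_on_def Sep_def)
  have neq: "con p \<noteq> 3 # y" "con p \<noteq> 0 # y" "con p \<noteq> Sep i u" "Sep i u \<noteq> con p" "Sep i u \<noteq> 3 # y" "Sep i u \<noteq> 0 # y"
    "3 # y \<noteq> con p" "0 # y \<noteq> con p" "3 # y \<noteq> Sep i u" "0 # y \<noteq> Sep i u"
    for p y i u by (simp_all add: con_def Con_def Sep_def)
  show ?thesis
    unfolding challengers_def irrelevant_def relevant_def
    using con pad sep con_disj[of "\<lambda>p. (snd (fst p), snd (snd p))" "set G" "slot_pairs cs vs"]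
    by (auto simp: neq)
qed

lemma challengers_not:
  assumes "x \<in> set (challengers cs vs G)"
  shows "x \<noteq> []" "4 \<le> j \<Longrightarrow> x \<noteq> j # y"
  using assms unfolding set_challengers by (auto simp: Sep_def Con_def)

lemma distinct_all_cands:
  assumes "distinct cs" "distinct vs"
  shows "distinct (all_cands cs vs G)"
proof -
  have "distinct (tl (challengers cs vs G))"
    using distinct_challengers[OF assms] by (rule distinct_tl)
  then have "distinct (guards j cs vs G)" for j by (simp add: guards_def distinct_map)
  moreover have "set (guards i cs vs G) \<inter> set (guards j cs vs G) = {}" if "i \<noteq> j" for i j
    using that by (auto simp: guards_def)
  moreover have "set (guards j cs vs G) \<inter> set (challengers cs vs G) = {}" if "4 \<le> j" for j
    using challengers_not(2)[OF _ that] by (fastforce simp: guards_def)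
  moreover have "[] \<notin> set (guards j cs vs G)" "[] \<notin> set (challengers cs vs G)" for j
    using challengers_not(1)[of "[]"] by (auto simp: guards_def)
  ultimately show ?thesis
    unfolding all_cands_def distinct.simps distinct_append set_append
    using distinct_challengers[OF assms, of G] by (simp add: Int_Un_distrib)
qed

lemma length_filter_seqs:
  "length (filter (\<lambda>sq. y \<in> set sq) (seqs cs vs)) = 2 * length (filter (\<lambda>i. y \<in> set (seq cs vs i)) cs)"
proof -
  have "length (filter (\<lambda>sq. y \<in> set sq) (concat (map (\<lambda>i. [f i, rev (f i)]) xs))) =
      2 * length (filter (\<lambda>i. y \<in> set (f i)) xs)" for f :: "nat \<Rightarrow> nat list list" and xs
    by (induction xs) auto
  then show ?thesis unfolding seqs_def .
qed

lemma length_filter_seq_le: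
  assumes "distinct cs"
  shows "length (filter (\<lambda>i. y \<in> set (seq cs vs i)) cs) \<le> 2"
proof -
  \<comment> \<open>Entries 1 and 3 of a \<open>Con\<close> are its colours, and entry 1 of a
    \<open>Sep\<close> is its colour.\<close>
  have "set (filter (\<lambda>i. y \<in> set (seq cs vs i)) cs) \<subseteq> {y ! 1, y ! 3}"
    by (auto simp: set_seq set_block Sep_def Con_def)
  then have "card (set (filter (\<lambda>i. y \<in> set (seq cs vs i)) cs)) \<le> card {y ! 1, y ! 3}"
    by (intro card_mono) auto
  also have "\<dots> \<le> 2" by (simp add: card_insert_if)
  finally show ?thesis
    using distinct_card[OF distinct_filter[OF assms], of "\<lambda>i. y \<in> set (seq cs vs i)"] by simp
qed

lemma seqs_subset:
  assumes "sq \<in> set (seqs cs vs)"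
  shows "set sq \<subseteq> set (challengers cs vs G)" "distinct cs \<Longrightarrow> distinct vs \<Longrightarrow> distinct sq"
proof -
  obtain i where i: "i \<in> set cs" "sq = seq cs vs i \<or> sq = rev (seq cs vs i)"
    using assms by (auto simp: seqs_def)
  then have "set sq = set (seq cs vs i)" by auto
  moreover have "x \<in> set (challengers cs vs G)" if x: "x \<in> set (seq cs vs i)" for x
  proof -
    obtain u where u: "u \<in> set vs" "x = Sep i u \<or> x \<in> set (block cs vs i u)"
      using x unfolding set_seq by blast
    from u(2) show ?thesis
    proof
      assume "x = Sep i u"
      with i(1) u(1) show ?thesis by (metis set_challengers)
    next
      assume "x \<in> set (block cs vs i u)"
      then obtain j v where "j \<in> set cs" "v \<in> set vs" "j \<noteq> i" "x = Con i u j v \<or> x = Con j v i u"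
        unfolding set_block by blast
      with i(1) u(1) show ?thesis by (metis set_challengers)
    qed
  qed
  ultimately show "set sq \<subseteq> set (challengers cs vs G)" by auto
  show "distinct cs \<Longrightarrow> distinct vs \<Longrightarrow> distinct sq"
    using i(2) distinct_seq[of cs vs i] by auto
qed

lemma sum_list_map_mono: "(\<And>x. x \<in> set xs \<Longrightarrow> f x \<le> g x) \<Longrightarrow> sum_list (map f xs) \<le> sum_list (map g xs)"
  for f g :: "'a \<Rightarrow> nat"
  by (induction xs) (auto intro: add_mono)

text \<open>The candidates with head 3 copy every sequence once, and the budget share of a colour is
  at most the length of its sequence: the separator of the first vertex pays for the additional
  1.\<close>

lemma cover_budget_le:
  assumes "vs \<noteq> []"
  shows "cover_budget cs vs \<le> length (tl (challengers cs vs G))"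
proof -
  have "cover_budget cs vs \<le> (\<Sum>i\<leftarrow>cs. length (seq cs vs i))"
    unfolding cover_budget_def length_concat map_map comp_def
  proof (rule sum_list_map_mono)
    fix i
    obtain v vs' where vs: "vs = v # vs'" using assms by (cases vs) auto
    show "length ([] # concat (map (\<lambda>u. block cs vs i u @ [Sep i u]) (tl vs))) \<le> length (seq cs vs i)"
      unfolding seq_def vs by simp
  qed
  also have "\<dots> = length (concat (map (\<lambda>i. map (\<lambda>x. 3 # i # x) (seq cs vs i)) cs))"
    by (simp add: length_concat comp_def)
  also have "\<dots> \<le> length (tl (challengers cs vs G))"
    by (simp add: challengers_def irrelevant_def)
  finally show ?thesis .
qed

lemma enc_list_map: "enc_list e (map f xs) = enc_list (\<lambda>x. e (f x)) xs"
  by (induction xs) auto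

lemma enc_list_cong: "xs = ys \<Longrightarrow> (\<And>x. x \<in> set ys \<Longrightarrow> e x = e' x) \<Longrightarrow> enc_list e xs = enc_list e' ys"
  by (induction ys arbitrary: xs) auto

section \<open>The instance for a nonempty graph\<close>

locale reduction =
  fixes c n :: nat and G :: "(nat \<times> nat) list"
  assumes n: "1 \<le> n"
begin

abbreviation "cs \<equiv> [0..<c]"
abbreviation "vs \<equiv> [0..<n]"
abbreviation "cand_list \<equiv> all_cands cs vs G"
abbreviation "nm \<equiv> name cand_list"
abbreviation "I \<equiv> reduction_instance cs vs G"

lemma dist_cands: "distinct cand_list"
  by (rule distinct_all_cands) auto

lemma inj_nm: "inj_on nm (set cand_list)"
  by (rule inj_on_name[OF dist_cands])

lemma names_eq: "names cs vs G xs = map nm xs"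
  by (simp add: names_def)

text \<open>After renaming, the candidates are an initial segment of the numbers in order. This
  yields both the disjointness assumption of \<open>bribery_election\<close> and the set of
  candidates in \<open>C_eq\<close>.\<close>

lemma nm_all:
  "0 # names cs vs G (guards 4 cs vs G) @ names cs vs G (guards 5 cs vs G) @ names cs vs G (guards 6 cs vs G) @
     names cs vs G (challengers cs vs G) = [0..<length cand_list]"
proof -
  have "nm [] = 0" by (simp add: name_def all_cands_def)
  then have "0 # names cs vs G (guards 4 cs vs G) @ names cs vs G (guards 5 cs vs G) @
      names cs vs G (guards 6 cs vs G) @ names cs vs G (challengers cs vs G) = map nm cand_list"
    by (subst (2) all_cands_def) (simp add: names_eq)
  then show ?thesis by (simp add: map_name[OF dist_cands])
qed

lemma challengers_sub: "set (challengers cs vs G) \<subseteq> set cand_list"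
  by (auto simp: all_cands_def)

lemma inj_ch: "inj_on nm (set (challengers cs vs G))"
  by (rule inj_on_subset[OF inj_nm challengers_sub])

sublocale bribery_election 0 "names cs vs G (guards 4 cs vs G)" "names cs vs G (guards 5 cs vs G)"
  "names cs vs G (guards 6 cs vs G)" "names cs vs G (challengers cs vs G)" "names cs vs G (irrelevant cs vs G)"
  "names cs vs G (relevant cs vs G)" "map (\<lambda>sq. names cs vs G sq) (seqs cs vs)"
  "length (tl (challengers cs vs G))" "cover_budget cs vs"
proof
  show dist: "distinct (0 # names cs vs G (guards 4 cs vs G) @ names cs vs G (guards 5 cs vs G) @
      names cs vs G (guards 6 cs vs G) @ names cs vs G (challengers cs vs G))"
    unfolding nm_all by simp
  show "length (names cs vs G (guards 4 cs vs G)) = length (tl (challengers cs vs G))"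
    "length (names cs vs G (guards 5 cs vs G)) = length (tl (challengers cs vs G))"
    "length (names cs vs G (guards 6 cs vs G)) = length (tl (challengers cs vs G))"
    by (simp_all add: names_eq guards_def)
  \<comment> \<open>The two candidates \<open>[0, 0]\<close> and \<open>[0, 1]\<close> ensure at
    least one guard per list even if there are no colours.\<close>
  show "length (names cs vs G (challengers cs vs G)) = length (tl (challengers cs vs G)) + 1"
    "1 \<le> length (tl (challengers cs vs G))"
    by (simp_all add: names_eq challengers_def irrelevant_def)
  show "cover_budget cs vs \<le> length (tl (challengers cs vs G))"
    by (rule cover_budget_le) (use n in simp)
  have "names cs vs G (irrelevant cs vs G) @ names cs vs G (relevant cs vs G) = names cs vs G (challengers cs vs G)"
    by (simp add: names_eq challengers_def)
  with dist show "distinct (names cs vs G (irrelevant cs vs G) @ names cs vs G (relevant cs vs G))"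
    "set (names cs vs G (irrelevant cs vs G)) \<union> set (names cs vs G (relevant cs vs G)) =
       set (names cs vs G (challengers cs vs G))"
    by (simp_all flip: set_append)
  show "distinct sq" "set sq \<subseteq> set (names cs vs G (challengers cs vs G))"
    if sq: "sq \<in> set (map (\<lambda>sq. names cs vs G sq) (seqs cs vs))" for sq
  proof -
    obtain sq' where sq': "sq' \<in> set (seqs cs vs)" "sq = map nm sq'" using sq by (auto simp: names_eq)
    note sub = seqs_subset(1)[OF sq'(1), of G]
    show "set sq \<subseteq> set (names cs vs G (challengers cs vs G))" using sub sq'(2) by (auto simp: names_eq)
    show "distinct sq"
      using seqs_subset(2)[OF sq'(1)] inj_on_subset[OF inj_ch sub] by (simp add: sq'(2) distinct_map)
  qed
  show "length (filter (\<lambda>sq. y \<in> set sq) (map (\<lambda>sq. names cs vs G sq) (seqs cs vs))) \<le> 4"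
    if y: "y \<in> set (names cs vs G (challengers cs vs G))" for y
  proof -
    obtain x where x: "x \<in> set (challengers cs vs G)" "y = nm x" using y by (auto simp: names_eq)
    have "filter (\<lambda>sq. y \<in> set (map nm sq)) (seqs cs vs) = filter (\<lambda>sq. x \<in> set sq) (seqs cs vs)"
      using inj_on_image_mem_iff[OF inj_ch x(1)] seqs_subset(1)[of _ cs vs G] x(2)
      by (intro filter_cong) auto
    then have "length (filter (\<lambda>sq. y \<in> set sq) (map (\<lambda>sq. names cs vs G sq) (seqs cs vs))) =
        2 * length (filter (\<lambda>i. x \<in> set (seq cs vs i)) cs)"
      by (simp add: filter_map comp_def names_eq flip: length_filter_seqs)
    with length_filter_seq_le[of cs x vs] show ?thesis by simp
  qed
qed

lemma profile_eq: "reduction_profile cs vs G = profile"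
  by (simp add: reduction_profile_def)

lemma C_eq: "C = {..<length cand_list}"
proof -
  have "C = set [0..<length cand_list]"
    using arg_cong[OF nm_all, of set] by (simp only: list.set(2) set_append Un_assoc)
  then show ?thesis by (simp add: atLeast0LessThan)
qed

lemma pos_vote: "x \<in> set profile \<Longrightarrow> pos (fst x @ 0 # snd x) 0 = length (fst x) + 1"
  by (rule pos_Cons_middle) (use profile_ok in blast)

lemma length_vote:
  assumes "x \<in> set profile"
  shows "length cand_list = length (fst x) + 1 + length (snd x)"
proof -
  have "card (set (fst x @ 0 # snd x)) = length (fst x @ 0 # snd x)"
    using profile_ok[OF assms] by (intro distinct_card) auto
  moreover have "set (fst x @ 0 # snd x) = {..<length cand_list}"
    using profile_ok[OF assms] C_eq by simp
  ultimately show ?thesis by simp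
qed

lemma reduction_in_instances: "I \<in> dsb_instances"
proof -
  have "is_election (cands I, votes I)"
    unfolding is_election_def reduction_instance_def profile_eq
    using profile_ok C_eq by auto
  moreover have "0 < length cand_list" by (simp add: all_cands_def)
  moreover have "price_function (length cand_list) (pos (fst x @ 0 # snd x) 0) (unit_price x)"
    if "x \<in> set profile" for x
    using pos_vote[OF that] length_vote[OF that]
    by (auto simp: price_function_def unit_price_def zero_enat_def)
  ultimately show ?thesis
    by (auto simp: dsb_instances_def reduction_instance_def profile_eq)
qed

lemma reduction_in_unit_prices: "I \<in> unit_prices"
proof -
  have "length cand_list - pos (fst x @ 0 # snd x) 0 = length (snd x)" if "x \<in> set profile" for x
    using pos_vote[OF that] length_vote[OF that] by simp
  then show ?thesis
    by (auto simp: unit_prices_def reduction_instance_def profile_eq unit_price_def)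
qed

lemma enc_dsb_reduction: "enc_dsb I = enc_output (reduction_output cs vs G)"
proof -
  have "map (\<lambda>i. enc_list (\<lambda>\<tau>. enc_enat ((map unit_price profile ! i) \<tau>))
      [0..<length cand_list - pos (map (\<lambda>x. fst x @ 0 # snd x) profile ! i) 0 + 1]) [0..<length profile] =
    map (\<lambda>x. enc_list enc_enat (map enat [0..<length (0 # snd x)])) profile"
  proof (rule nth_equalityI)
    fix i assume "i < length (map (\<lambda>i. enc_list (\<lambda>\<tau>. enc_enat ((map unit_price profile ! i) \<tau>))
      [0..<length cand_list - pos (map (\<lambda>x. fst x @ 0 # snd x) profile ! i) 0 + 1]) [0..<length profile])"
    then have i: "i < length profile" by simp
    then have "length cand_list - pos (fst (profile ! i) @ 0 # snd (profile ! i)) 0 = length (snd (profile ! i))"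
      using pos_vote[of "profile ! i"] length_vote[of "profile ! i"] by simp
    then have "enc_list (\<lambda>\<tau>. enc_enat (unit_price (profile ! i) \<tau>))
        [0..<length cand_list - pos (fst (profile ! i) @ 0 # snd (profile ! i)) 0 + 1] =
      enc_list enc_enat (map enat [0..<length (0 # snd (profile ! i))])"
      unfolding enc_list_map by (intro enc_list_cong) (auto simp: unit_price_def)
    with i show "map (\<lambda>i. enc_list (\<lambda>\<tau>. enc_enat ((map unit_price profile ! i) \<tau>))
      [0..<length cand_list - pos (map (\<lambda>x. fst x @ 0 # snd x) profile ! i) 0 + 1]) [0..<length profile] ! i =
      map (\<lambda>x. enc_list enc_enat (map enat [0..<length (0 # snd x)])) profile ! i"
      by simp
  qed simp
  from arg_cong[OF this, of "enc_list (\<lambda>t. t)"]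
  have "enc_list (\<lambda>i. enc_list (\<lambda>\<tau>. enc_enat ((map unit_price profile ! i) \<tau>))
      [0..<length cand_list - pos (map (\<lambda>x. fst x @ 0 # snd x) profile ! i) 0 + 1]) [0..<length profile] =
    enc_list (enc_list enc_enat) (map (\<lambda>x. map enat [0..<length (0 # snd x)]) profile)"
    unfolding enc_list_map .
  moreover have "sorted_list_of_set {..<length cand_list} = [0..<length cand_list]"
    by (metis atLeast_upt sorted_list_of_set_range lessThan_atLeast0)
  ultimately show ?thesis
    unfolding enc_dsb_def reduction_instance_def reduction_output_def profile_eq dsb_instance.simps
      enc_pair_simp length_map card_lessThan
    by (simp only:)
qed

lemma reduction_yes_iff:
  "I \<in> dsb_yes (copeland \<alpha>) \<longleftrightarrow>
    (\<exists>\<phi>. (\<forall>i<c. \<phi> i < n) \<and> (\<forall>i<c. \<forall>j<c. i \<noteq> j \<longrightarrow> (\<phi> i, \<phi> j) \<in> set G))"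
proof -
  have votes: "map (\<lambda>i. shift_back 0 (t i) (map (\<lambda>x. fst x @ 0 # snd x) profile ! i)) [0..<length profile] =
      map (\<lambda>i. shift_back 0 (t i) (fst (profile ! i) @ 0 # snd (profile ! i))) [0..<length profile]" for t
    by (rule map_cong) auto
  have "I \<in> dsb_yes (copeland \<alpha>) \<longleftrightarrow>
     (\<exists>t. (\<Sum>i<length profile. unit_price (profile ! i) (t i)) \<le> enat (cover_budget cs vs) \<and>
     copeland \<alpha> (C, map (\<lambda>i. shift_back 0 (t i) (fst (profile ! i) @ 0 # snd (profile ! i)))
        [0..<length profile]) \<noteq> {0})"
    unfolding dsb_yes_def reduction_instance_def profile_eq C_eq
    by (simp add: votes)
  also have "\<dots> \<longleftrightarrow> (\<exists>t. (\<Sum>i<2 * c. t i) \<le> cover_budget cs vs \<and>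
     (\<forall>y\<in>set (names cs vs G (relevant cs vs G)). \<exists>i<2 * c. y \<in> set (take (t i) (map (\<lambda>sq. names cs vs G sq) (seqs cs vs) ! i))))"
    unfolding bribery_iff by (simp add: length_seqs)
  also have "\<dots> \<longleftrightarrow> (\<exists>t. (\<Sum>i<2 * c. t i) \<le> cover_budget cs vs \<and>
     (\<forall>x\<in>set (relevant cs vs G). \<exists>i<2 * c. x \<in> set (take (t i) (seqs cs vs ! i))))"
  proof -
    \<comment> \<open>Renaming is injective on the challengers, so being passed can be tested before
      renaming.\<close>
    have "nm x \<in> set (take k (map (\<lambda>sq. names cs vs G sq) (seqs cs vs) ! i)) \<longleftrightarrow> x \<in> set (take k (seqs cs vs ! i))"
      if "x \<in> set (relevant cs vs G)" "i < 2 * c" for x k i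
    proof -
      have i: "i < length (seqs cs vs)" using that(2) by (simp add: length_seqs)
      have x: "x \<in> set (challengers cs vs G)" using that(1) by (simp add: challengers_def)
      have "set (take k (seqs cs vs ! i)) \<subseteq> set (challengers cs vs G)"
        using seqs_subset(1)[of "seqs cs vs ! i" cs vs G] i set_take_subset by fastforce
      from inj_on_image_mem_iff[OF inj_ch x this] show ?thesis
        using i by (simp add: names_eq take_map)
    qed
    then have "(\<forall>y\<in>set (names cs vs G (relevant cs vs G)). \<exists>i<2 * c.
        y \<in> set (take (t i) (map (\<lambda>sq. names cs vs G sq) (seqs cs vs) ! i))) \<longleftrightarrow>
      (\<forall>x\<in>set (relevant cs vs G). \<exists>i<2 * c. x \<in> set (take (t i) (seqs cs vs ! i)))" for t
      unfolding names_eq[of "relevant cs vs G"] set_map[of nm] ball_simps(9)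
      by (intro ball_cong refl ex_cong1 conj_cong) auto
    then show ?thesis by simp
  qed
  also have "\<dots> \<longleftrightarrow> (\<exists>\<phi>. (\<forall>i<c. \<phi> i < n) \<and> (\<forall>i<c. \<forall>j<c. i \<noteq> j \<longrightarrow> (\<phi> i, \<phi> j) \<in> set G))"
    by (rule cover_iff[OF n]) (simp add: set_relevant Bex_def; blast)
  finally show ?thesis .
qed

text \<open>Two sequences per colour give \<open>s = 2 * c\<close>; the number of voters does not
  grow with the graph for a fixed number of colours.\<close>

lemma length_votes: "length (votes I) = 4 * c + 23"
  by (simp add: reduction_instance_def profile_eq length_profile length_seqs)

end

section \<open>Adjacency matrices and the reduction on clique instances\<close>

definition adjacency :: "nat \<Rightarrow> nat set set \<Rightarrow> bool list list" where
  "adjacency n E = map (\<lambda>i. map (\<lambda>j. {i, j} \<in> E) [0..<n]) [0..<n]"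

lemma set_edges:
  "(u, v) \<in> set (edges M) \<longleftrightarrow> u < length M \<and> v < length (M ! u) \<and> M ! u ! v"
proof -
  have "set (edges M) = (\<Union>p\<in>set (List.enumerate 0 M).
      (\<lambda>q. (fst p, fst q)) ` {q \<in> set (List.enumerate 0 (snd p)). snd q})"
    by (simp add: edges_def)
  then have "(u, v) \<in> set (edges M) \<longleftrightarrow> (\<exists>p q. p \<in> set (List.enumerate 0 M) \<and>
      q \<in> set (List.enumerate 0 (snd p)) \<and> snd q \<and> u = fst p \<and> v = fst q)" by blast
  also have "\<dots> \<longleftrightarrow> u < length M \<and> v < length (M ! u) \<and> M ! u ! v" (is "?L \<longleftrightarrow> ?R")
  proof
    assume ?L
    then obtain p q where "p \<in> set (List.enumerate 0 M)" "q \<in> set (List.enumerate 0 (snd p))"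
      "snd q" "u = fst p" "v = fst q" by blast
    then show ?R by (simp add: in_set_enumerate_eq)
  next
    assume ?R
    then show ?L
      by (intro exI[of _ "(u, M ! u)"] exI[of _ "(v, M ! u ! v)"]) (simp add: in_set_enumerate_eq)
  qed
  finally show ?thesis .
qed

lemma set_edges_adjacency: "(u, v) \<in> set (edges (adjacency n E)) \<longleftrightarrow> u < n \<and> v < n \<and> {u, v} \<in> E"
  unfolding set_edges by (simp add: adjacency_def cong: conj_cong)

lemma colours_eq: "colours M k = [0..<min k (length M + 1)]"
proof -
  have "takeWhile (\<lambda>i. i \<noteq> k) [0..<m] = take k [0..<m]" for m
    by (rule takeWhile_eq_take_P_nth) auto
  then have "takeWhile (\<lambda>i. i \<noteq> k) [0..<m] = [0..<min k m]" for m
    by (simp add: take_upt min_def)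
  then show ?thesis by (simp add: colours_def del: upt_Suc)
qed

definition clique_reduction :: "clique_instance \<Rightarrow> dsb_instance" where
  "clique_reduction = (\<lambda>(n, E, k).
     let M = normalize_graph (adjacency n E)
     in reduction_instance (colours M (normalize_size (adjacency n E) k)) [0..<length M] (edges M))"

lemma clique_reduction_cases:
  assumes E: "\<forall>e\<in>E. e \<subseteq> {..<n} \<and> card e = 2"
  obtains n' E' k' where "1 \<le> n'" "\<forall>e\<in>E'. e \<subseteq> {..<n'} \<and> card e = 2" "k' \<le> 2 * k"
    "(\<exists>S \<subseteq> {..<n}. card S = k \<and> (\<forall>u\<in>S. \<forall>v\<in>S. u \<noteq> v \<longrightarrow> {u, v} \<in> E)) \<longleftrightarrow>
     (\<exists>S \<subseteq> {..<n'}. card S = k' \<and> (\<forall>u\<in>S. \<forall>v\<in>S. u \<noteq> v \<longrightarrow> {u, v} \<in> E'))"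
    "normalize_graph (adjacency n E) = adjacency n' E'" "normalize_size (adjacency n E) k = k'"
proof (cases "n = 0")
  case False
  have "normalize_graph (adjacency n E) = adjacency n E" "normalize_size (adjacency n E) k = k"
    using False by (simp_all add: normalize_graph_def normalize_size_def adjacency_def)
  note norm = this
  have "1 \<le> n" "k \<le> 2 * k" using False by simp_all
  then show thesis by (intro that[OF _ E _ refl norm])
next
  case True
  \<comment> \<open>A graph with one vertex has a clique of size 1, so keeping \<open>k = 1\<close>
    would turn a no-instance into a yes-instance; 2 is the least size without a clique.\<close>
  define k' :: nat where "k' = (if k = 0 then 0 else 2)"
  have norm: "normalize_graph (adjacency n E) = adjacency 1 {}" "normalize_size (adjacency n E) k = k'"
    using True by (simp_all add: normalize_graph_def normalize_size_def adjacency_def k'_def)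
  have "(\<exists>S \<subseteq> {..<n}. card S = k \<and> (\<forall>u\<in>S. \<forall>v\<in>S. u \<noteq> v \<longrightarrow> {u, v} \<in> E)) \<longleftrightarrow> k = 0"
    using True by auto
  moreover have "(\<exists>S \<subseteq> {..<1::nat}. card S = k' \<and> (\<forall>u\<in>S. \<forall>v\<in>S. u \<noteq> v \<longrightarrow> {u, v} \<in> {})) \<longleftrightarrow> k = 0"
    (is "?L \<longleftrightarrow> _")
  proof
    assume ?L
    then obtain S where S: "S \<subseteq> {..<1::nat}" "card S = k'" by blast
    have "card S \<le> card {..<1::nat}" by (rule card_mono[OF _ S(1)]) simp
    then show "k = 0" using S(2) by (simp add: k'_def split: if_splits)
  next
    assume "k = 0"
    then show ?L by (intro exI[of _ "{}"]) (simp add: k'_def)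
  qed
  ultimately have "(\<exists>S \<subseteq> {..<n}. card S = k \<and> (\<forall>u\<in>S. \<forall>v\<in>S. u \<noteq> v \<longrightarrow> {u, v} \<in> E)) \<longleftrightarrow>
     (\<exists>S \<subseteq> {..<1::nat}. card S = k' \<and> (\<forall>u\<in>S. \<forall>v\<in>S. u \<noteq> v \<longrightarrow> {u, v} \<in> {}))" by (simp only:)
  moreover have "(1::nat) \<le> 1" "\<forall>e\<in>{}. e \<subseteq> {..<1::nat} \<and> card e = 2" "k' \<le> 2 * k"
    by (simp_all add: k'_def)
  ultimately show thesis by (intro that[OF _ _ _ _ norm])
qed

section \<open>Back to the machine model\<close>

lemma computes_poly_time:
  assumes "poly_time e e' f"
  obtains p C k where "\<And>x. \<exists>t. computes p (e x) (e' (f x)) t \<and> t \<le> C * tree_size (e x) ^ k"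
proof -
  obtain T c where T: "poly_bounded e T" and c: "\<And>b s x. s b = e x \<Longrightarrow> runs (c b) b s (e' (f x)) (T x)"
    by (rule poly_timeE[OF assms]) blast
  obtain C k where C: "\<And>x. T x \<le> C * tree_size (e x) ^ k"
    using T unfolding poly_bounded_def by blast
  have "\<exists>t. computes (c 0) (e x) (e' (f x)) t \<and> t \<le> C * tree_size (e x) ^ k" for x
  proof -
    have "runs (c 0) 0 ((\<lambda>_. Leaf)(0 := e x)) (e' (f x)) (T x)" by (rule c) simp
    then show ?thesis unfolding runs_def computes_def using C[of x] le_trans by blast
  qed
  with that show thesis by blast
qed

lemma computable_expr:
  assumes "\<And>n s. s 0 = enc_nat n \<Longrightarrow> eval_expr a s = enc_nat (f n)"
  shows "computable f"
  unfolding computable_def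
proof (intro exI allI)
  fix n
  let ?s = "(\<lambda>_. Leaf)(0 := enc_nat n)"
  show "computes (Assign 0 a) (enc_nat n) (enc_nat (f n)) (1 + cost a ?s)"
    unfolding computes_def using exec.Assign[of 0 a ?s] assms[of ?s n] by fastforce
qed

lemma computable_const: "computable (\<lambda>_. C)"
  by (rule computable_expr[of "const_expr (enc_nat C)"]) simp

lemma enc_nat_odd: "enc_nat (2 * n + 1) = Node (enc_bool True) (enc_nat n)"
  by (subst enc_nat.simps) simp

text \<open>With the least significant bit first, this function prepends five one bits, which is a
  single expression. It dominates the number of voters, which is at most
  \<open>4 * (2 * k) + 23\<close>.\<close>

lemma computable_linear: "computable (\<lambda>n. 32 * n + 31)"
proof (rule computable_expr)
  let ?T = "const_expr (enc_bool True)"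
  fix n and s :: state assume s: "s 0 = enc_nat n"
  have "32 * n + 31 = 2 * (2 * (2 * (2 * (2 * n + 1) + 1) + 1) + 1) + 1" by simp
  then have "enc_nat (32 * n + 31) = enc_nat (2 * (2 * (2 * (2 * (2 * n + 1) + 1) + 1) + 1) + 1)" by (rule arg_cong)
  then show "eval_expr (NodeE ?T (NodeE ?T (NodeE ?T (NodeE ?T (NodeE ?T (Var 0)))))) s = enc_nat (32 * n + 31)"
    using s by (simp only: enc_nat_odd eval_expr.simps eval_const_expr)
qed

text \<open>One map serves both problems, since all its instances have unit prices. It runs in
  polynomial time, so the factor depending on the parameter is a constant.\<close>

theorem param_reduction_clique:
  shows "param_reduction clique_problem
     (restrict_problem (destructive_shift_bribery (copeland \<alpha>)) unit_prices) clique_reduction"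
    "param_reduction clique_problem (destructive_shift_bribery (copeland \<alpha>)) clique_reduction"
proof -
  have main: "clique_reduction x \<in> dsb_instances \<inter> unit_prices \<and>
      (x \<in> yes clique_problem \<longleftrightarrow> clique_reduction x \<in> dsb_yes (copeland \<alpha>)) \<and>
      length (votes (clique_reduction x)) \<le> 32 * param clique_problem x + 31 \<and>
      enc_dsb (clique_reduction x) = enc_output (clique_output (adjacency (fst x) (fst (snd x))) (snd (snd x))) \<and>
      enc clique_problem x = (enc_list (enc_list enc_bool) \<otimes> enc_nat) (adjacency (fst x) (fst (snd x)), snd (snd x))"
    if x: "x \<in> instances clique_problem" for x
  proof -
    obtain n E k where x_eq: "x = (n, E, k)" by (cases x)
    with x have E: "\<forall>e\<in>E. e \<subseteq> {..<n} \<and> card e = 2" by (simp add: clique_problem_def)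
    obtain n' E' k' where n': "1 \<le> n'" "\<forall>e\<in>E'. e \<subseteq> {..<n'} \<and> card e = 2" "k' \<le> 2 * k"
      "(\<exists>S \<subseteq> {..<n}. card S = k \<and> (\<forall>u\<in>S. \<forall>v\<in>S. u \<noteq> v \<longrightarrow> {u, v} \<in> E)) \<longleftrightarrow>
       (\<exists>S \<subseteq> {..<n'}. card S = k' \<and> (\<forall>u\<in>S. \<forall>v\<in>S. u \<noteq> v \<longrightarrow> {u, v} \<in> E'))"
      "normalize_graph (adjacency n E) = adjacency n' E'" "normalize_size (adjacency n E) k = k'"
      by (rule clique_reduction_cases[OF E])
    have length_adj: "length (adjacency n' E') = n'" by (simp add: adjacency_def)
    interpret reduction "min k' (n' + 1)" n' "edges (adjacency n' E')" by unfold_locales (rule n'(1))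
    have r: "clique_reduction x = I"
      by (simp add: x_eq clique_reduction_def n' colours_eq length_adj Let_def)
    have "x \<in> yes clique_problem \<longleftrightarrow> I \<in> dsb_yes (copeland \<alpha>)"
      unfolding reduction_yes_iff set_edges_adjacency
      using n'(4) clique_iff[OF n'(2), of k'] by (auto simp: x_eq clique_problem_def)
    moreover have "4 * a + 23 \<le> 32 * k + 31" if "a \<le> 2 * k" for a
      using that by linarith
    then have "length (votes I) \<le> 32 * k + 31"
      unfolding length_votes using le_trans[OF min.cobounded1 n'(3)] by blast
    moreover have "enc_dsb I = enc_output (clique_output (adjacency n E) k)"
      unfolding enc_dsb_reduction by (simp add: clique_output_def n' colours_eq length_adj)
    moreover have "enc clique_problem x = (enc_list (enc_list enc_bool) \<otimes> enc_nat) (adjacency n E, k)"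
      by (simp add: clique_problem_def x_eq adjacency_def enc_list_def foldr_map comp_def)
    ultimately show ?thesis
      using reduction_in_instances reduction_in_unit_prices unfolding r
      by (simp add: x_eq clique_problem_def)
  qed
  obtain p C j where p: "\<And>z. \<exists>t. computes p ((enc_list (enc_list enc_bool) \<otimes> enc_nat) z)
      (enc_output (clique_output (fst z) (snd z))) t \<and>
      t \<le> C * tree_size ((enc_list (enc_list enc_bool) \<otimes> enc_nat) z) ^ j"
    by (rule computes_poly_time[OF poly_time_clique_output]) blast
  have time: "\<exists>t. computes p (enc clique_problem x) (enc_dsb (clique_reduction x)) t \<and>
      t \<le> (\<lambda>_. C) (param clique_problem x) * tree_size (enc clique_problem x) ^ j"
    if "x \<in> instances clique_problem" for x
    using p[of "(adjacency (fst x) (fst (snd x)), snd (snd x))"] main[OF that] by simp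
  have 1: "\<exists>f c e. computable f \<and> (\<forall>x\<in>instances clique_problem. \<exists>t.
      computes c (enc clique_problem x) (enc_dsb (clique_reduction x)) t \<and>
      t \<le> f (param clique_problem x) * tree_size (enc clique_problem x) ^ e)"
    using computable_const[of C] time by blast
  have 2: "\<exists>g. computable g \<and> (\<forall>x\<in>instances clique_problem.
      length (votes (clique_reduction x)) \<le> g (param clique_problem x))"
    using computable_linear main by blast
  show "param_reduction clique_problem
     (restrict_problem (destructive_shift_bribery (copeland \<alpha>)) unit_prices) clique_reduction"
    "param_reduction clique_problem (destructive_shift_bribery (copeland \<alpha>)) clique_reduction"
    unfolding param_reduction_def restrict_problem_def destructive_shift_bribery_def
    using 1 2 main by simp_all
qed

theorem theorem7:
  fixes \<alpha> :: rat
  assumes "0 \<le> \<alpha>" and "\<alpha> \<le> 1"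
  shows "W1_hard (destructive_shift_bribery (copeland \<alpha>)) \<and>
         W1_hard (restrict_problem (destructive_shift_bribery (copeland \<alpha>)) unit_prices)"
  unfolding W1_hard_def
  by (intro conjI exI, rule param_reduction_clique(2), rule param_reduction_clique(1))

end
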